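(* Let $\mathcal{B}$ be a finite set of positive reals with $b\ge\gamma>0$ for all $b\in\mathcal{B}$, and for $x\ge0$ let $\theta_b(x)=(x+b)^{-1}$. Let $A\ge\gamma^{-1}$ and $H=\{x\in\mathbb{R}:0<x<A\}$, so $\theta_b(\bar H)\subset[0,\gamma^{-1}]$. Let $m$ be a positive integer and for each $b\in\mathcal{B}$ let $g_b:[0,A]\to\mathbb{R}$ be a $C^m$ function with $g_b(x)>0$ for all $x\in[0,A]$. Let $X=C^m(\bar H)$ and for $s>0$ define $\Lambda_s:X\to X$ by $$(\Lambda_sf)(x)=\sum_{b\in\mathcal{B}}[g_b(x)]^sf(\theta_b(x)).$$ Then $\Lambda_s$ has a strictly positive eigenfunction $v_s\in X$, unique up to multiplication by a positive scalar, with eigenvalue $r(\Lambda_s)>0$ (the spectral radius of $\Lambda_s$). Furthermore, for $1\le j\le m$ and $x\in[0,A]$, $$\frac{D^jv_s(x)}{v_s(x)}=\lim_{n\to\infty}\frac{\sum_{\omega\in\mathcal{B}_n}D^j\big([g_\omega(x)]^s\big)}{\sum_{\omega\in\mathcal{B}_n}[g_\omega(x)]^s}.$$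
   Context: $D=d/dx$; $C^m(\bar H)$ is the Banach space of real $C^m$ functions on $H$ whose derivatives of order $\le m$ extend continuously to $\bar H$. $\mathcal{B}_n=\{\omega=(b_1,\dots,b_n):b_j\in\mathcal{B}\}$, and for such $\omega$, $g_\omega(x)=g_{b_n}(\theta_{b_{n-1}}\circ\cdots\circ\theta_{b_1}(x))\cdots g_{b_2}(\theta_{b_1}(x))\,g_{b_1}(x)$. *)

theory Defs
  imports "HOL-Analysis.Analysis"
begin

text \<open>Functions on the closure of \<open>H = {0<..<A}\<close> are total functions
  of which only the values on \<open>{0..A}\<close> matter.\<close>

text \<open>\<open>f\<close> is of class \<open>C\<^sup>m\<close> on \<open>H\<close> and every derivative of order at most \<open>m\<close> extends
  continuously to the closure; the values of \<open>f\<close> at the endpoints are those of its continuous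
  extension, whence the first conjunct.\<close>

definition Cm_on :: "nat \<Rightarrow> real \<Rightarrow> (real \<Rightarrow> real) \<Rightarrow> bool" where
  "Cm_on m A f \<longleftrightarrow>
     continuous_on {0..A} f \<and>
     (\<forall>j<m. \<forall>x\<in>{0<..<A}. (deriv ^^ j) f differentiable (at x)) \<and>
     (\<forall>j\<le>m. \<exists>F. continuous_on {0..A} F \<and> (\<forall>x\<in>{0<..<A}. F x = (deriv ^^ j) f x))"

text \<open>\<open>D\<^sup>j f\<close> on the closed interval: the continuous extension of the derivative taken on \<open>H\<close>.\<close>

definition Dext :: "real \<Rightarrow> nat \<Rightarrow> (real \<Rightarrow> real) \<Rightarrow> real \<Rightarrow> real" where
  "Dext A j f x = Lim (at x within {0<..<A}) ((deriv ^^ j) f)"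

text \<open>Setting the functions to \<open>0\<close> off \<open>{0..A}\<close> makes equality of elements of the space the same
  as equality on \<open>{0..A}\<close>, and the space closed under pointwise linear combinations.\<close>

definition Cm_space :: "nat \<Rightarrow> real \<Rightarrow> (real \<Rightarrow> real) set" where
  "Cm_space m A = {f. Cm_on m A f \<and> (\<forall>x. x \<notin> {0..A} \<longrightarrow> f x = 0)}"

definition Cm_norm :: "nat \<Rightarrow> real \<Rightarrow> (real \<Rightarrow> real) \<Rightarrow> real" where
  "Cm_norm m A f = Max ((\<lambda>j. SUP x\<in>{0<..<A}. \<bar>(deriv ^^ j) f x\<bar>) ` {..m})"

text \<open>The spectrum of a linear operator \<open>T\<close> on a real Banach space \<open>(V, N)\<close> of functions is that of
  its complexification \<open>u + \<i>v \<mapsto> T u + \<i>T v\<close> on \<open>V + \<i>V\<close>. The norm used on \<open>V + \<i>V\<close> is equivalent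
  to any of the usual complexification norms, so it yields the same bounded operators.\<close>

definition cplx_space :: "('a \<Rightarrow> real) set \<Rightarrow> ('a \<Rightarrow> complex) set" where
  "cplx_space V = {f. (\<lambda>x. Re (f x)) \<in> V \<and> (\<lambda>x. Im (f x)) \<in> V}"

definition cplx_norm :: "(('a \<Rightarrow> real) \<Rightarrow> real) \<Rightarrow> ('a \<Rightarrow> complex) \<Rightarrow> real" where
  "cplx_norm N f = N (\<lambda>x. Re (f x)) + N (\<lambda>x. Im (f x))"

definition cplx_op :: "(('a \<Rightarrow> real) \<Rightarrow> ('a \<Rightarrow> real)) \<Rightarrow> ('a \<Rightarrow> complex) \<Rightarrow> ('a \<Rightarrow> complex)" where
  "cplx_op T f = (\<lambda>x. Complex (T (\<lambda>y. Re (f y)) x) (T (\<lambda>y. Im (f y)) x))"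

text \<open>\<open>z\<close> is in the resolvent set iff \<open>z - T\<close> is a bijection whose inverse is bounded.\<close>

definition op_resolvent_set ::
  "('a \<Rightarrow> real) set \<Rightarrow> (('a \<Rightarrow> real) \<Rightarrow> real) \<Rightarrow> (('a \<Rightarrow> real) \<Rightarrow> ('a \<Rightarrow> real)) \<Rightarrow> complex set" where
  "op_resolvent_set V N T =
     {z. bij_betw (\<lambda>f x. z * f x - cplx_op T f x) (cplx_space V) (cplx_space V) \<and>
         (\<exists>C. \<forall>f\<in>cplx_space V. cplx_norm N f \<le> C * cplx_norm N (\<lambda>x. z * f x - cplx_op T f x))}"

definition op_spectrum ::
  "('a \<Rightarrow> real) set \<Rightarrow> (('a \<Rightarrow> real) \<Rightarrow> real) \<Rightarrow> (('a \<Rightarrow> real) \<Rightarrow> ('a \<Rightarrow> real)) \<Rightarrow> complex set" where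
  "op_spectrum V N T = - op_resolvent_set V N T"

definition op_spectral_radius ::
  "('a \<Rightarrow> real) set \<Rightarrow> (('a \<Rightarrow> real) \<Rightarrow> real) \<Rightarrow> (('a \<Rightarrow> real) \<Rightarrow> ('a \<Rightarrow> real)) \<Rightarrow> real" where
  "op_spectral_radius V N T = (SUP z\<in>op_spectrum V N T. cmod z)"

definition theta :: "real \<Rightarrow> real \<Rightarrow> real" where
  "theta b x = inverse (x + b)"

definition Lam :: "real set \<Rightarrow> (real \<Rightarrow> real \<Rightarrow> real) \<Rightarrow> real \<Rightarrow> real \<Rightarrow>
    (real \<Rightarrow> real) \<Rightarrow> (real \<Rightarrow> real)" where
  "Lam B g A s f = (\<lambda>x. if x \<in> {0..A} then \<Sum>b\<in>B. g b x powr s * f (theta b x) else 0)"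

definition words :: "real set \<Rightarrow> nat \<Rightarrow> real list set" where
  "words B n = {w. set w \<subseteq> B \<and> length w = n}"

text \<open>The list \<open>[b\<^sub>1, \<dots>, b\<^sub>n]\<close> stands for \<open>\<omega> = (b\<^sub>1, \<dots>, b\<^sub>n)\<close>, and
  \<open>fold theta [b\<^sub>1, \<dots>, b\<^sub>j] x\<close> is \<open>\<theta>\<close> for \<open>b\<^sub>j\<close> after \<open>\<dots>\<close> after \<open>\<theta>\<close> for \<open>b\<^sub>1\<close>, at \<open>x\<close>.\<close>

definition g_word :: "(real \<Rightarrow> real \<Rightarrow> real) \<Rightarrow> real list \<Rightarrow> real \<Rightarrow> real" where
  "g_word g w x = (\<Prod>j<length w. g (w ! j) (fold theta (take j w) x))"

end

theory Submission
  imports Defs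
begin

text \<open>
  Each \<open>\<theta>\<^sub>b\<close> contracts the metric \<open>d(x, y) = \<bar>ln (x + \<gamma>) - ln (y + \<gamma>)\<bar>\<close> by the factor
  \<open>\<kappa> = 1 / (1 + \<gamma>\<^sup>2)\<close>, so \<open>\<Lambda>\<close> maps the cone of nonnegative \<open>f\<close> with \<open>f x \<le> exp (L d(x, y)) f y\<close>
  into a strictly smaller such cone when \<open>L\<close> is large. Hence, for \<open>u\<^sub>n = \<Lambda>\<^sup>n 1\<close>, the ratios
  \<open>u\<^sub>n\<^sub>+\<^sub>1 / u\<^sub>n\<close> are squeezed at a geometric rate to a constant \<open>\<lambda>\<close>, and \<open>u\<^sub>n / \<lambda>\<^sup>n\<close> converges to a
  positive \<open>v\<close> with \<open>\<Lambda> v = \<lambda> v\<close>.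

  Differentiating \<open>j\<close> times, \<open>D\<^sup>j (\<Lambda> f) = \<Sum>\<^sub>b g\<^sub>b\<^sup>s (\<theta>\<^sub>b')\<^sup>j (D\<^sup>j f) \<circ> \<theta>\<^sub>b\<close> plus terms in lower derivatives
  of \<open>f\<close>, and in the norm weighted by \<open>v x / (x + \<gamma>)\<^sup>j\<close> the leading operator has norm at most
  \<open>\<kappa>\<^sup>j \<lambda>\<close>. By induction on \<open>j\<close>, any bound \<open>E \<sigma>\<^sup>n\<close> on \<open>\<Lambda>\<^sup>n f\<close> with \<open>\<sigma> > \<kappa> \<lambda>\<close> passes to its
  derivatives of order at most \<open>m\<close>. With \<open>\<sigma> < \<lambda>\<close> and \<open>f = u\<^sub>1 - \<lambda>\<close> this upgrades the convergence
  to \<open>C\<^sup>m\<close>; with \<open>\<sigma> = \<lambda>\<close> it gives \<open>\<parallel>\<Lambda>\<^sup>n\<parallel> \<le> K \<lambda>\<^sup>n\<close>, so the Neumann series for \<open>(z - \<Lambda>)\<^sup>-\<^sup>1\<close>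
  converges when \<open>\<bar>z\<bar> > \<lambda>\<close> and \<open>\<lambda>\<close> is the spectral radius.
\<close>

section \<open>Functions of class \<open>C\<^sup>m\<close> up to the boundary\<close>

lemma continuous_on_Icc_bounded:
  fixes f :: "real \<Rightarrow> real"
  assumes "continuous_on {a..b} f"
  shows "\<exists>K\<ge>0. \<forall>x\<in>{a..b}. \<bar>f x\<bar> \<le> K"
proof -
  have "compact (f ` {a..b})" using assms by (rule compact_continuous_image) simp
  then have "bounded (f ` {a..b})" by (rule compact_imp_bounded)
  then obtain K where "\<forall>x\<in>{a..b}. \<bar>f x\<bar> \<le> K" unfolding bounded_iff by auto
  then have "\<forall>x\<in>{a..b}. \<bar>f x\<bar> \<le> max K 0" by (auto simp: le_max_iff_disj)
  then show ?thesis by (intro exI[of _ "max K 0"]) auto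
qed

lemma le_on_Icc_if_le_on_Ioo:
  fixes f :: "real \<Rightarrow> real"
  assumes "0 < A" "continuous_on {0..A} f" "\<And>x. x \<in> {0<..<A} \<Longrightarrow> f x \<le> c" "x \<in> {0..A}"
  shows "f x \<le> c"
  using continuous_le_on_closure[of "{0<..<A}" f x c] assms by simp

lemma eq_on_Icc_if_eq_on_Ioo:
  fixes f g :: "real \<Rightarrow> real"
  assumes "0 < A" "continuous_on {0..A} f" "continuous_on {0..A} g"
    and "\<And>x. x \<in> {0<..<A} \<Longrightarrow> f x = g x" "x \<in> {0..A}"
  shows "f x = g x"
proof -
  have "f x - g x \<le> 0"
    by (rule le_on_Icc_if_le_on_Ioo[of A "\<lambda>x. f x - g x"]) (use assms in \<open>auto intro!: continuous_intros\<close>)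
  moreover have "g x - f x \<le> 0"
    by (rule le_on_Icc_if_le_on_Ioo[of A "\<lambda>x. g x - f x"]) (use assms in \<open>auto intro!: continuous_intros\<close>)
  ultimately show ?thesis by simp
qed

text \<open>The \<open>F j\<close> are candidate continuous extensions of the derivatives to the
  closed interval. Pointwise derivative rules apply to them directly, so the basic closure
  properties are obtained for jets and then carried over to iterates of \<open>deriv\<close>, which
  are controlled on the open interval alone.\<close>

definition jet :: "nat \<Rightarrow> real \<Rightarrow> (real \<Rightarrow> real) \<Rightarrow> (nat \<Rightarrow> real \<Rightarrow> real) \<Rightarrow> bool" where
  "jet m A f F \<longleftrightarrow> (\<forall>x\<in>{0..A}. F 0 x = f x) \<and> (\<forall>j\<le>m. continuous_on {0..A} (F j)) \<and>
     (\<forall>j<m. \<forall>x\<in>{0<..<A}. (F j has_real_derivative F (Suc j) x) (at x))"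

lemma jet_deriv:
  assumes "jet m A f F" "j \<le> m" "x \<in> {0<..<A}"
  shows "(deriv ^^ j) f x = F j x"
  using assms(2,3)
proof (induction j arbitrary: x)
  case 0
  then show ?case using assms(1) by (auto simp: jet_def)
next
  case (Suc j)
  have "(F j has_real_derivative F (Suc j) x) (at x)"
    using assms(1) Suc.prems by (auto simp: jet_def)
  then have "((deriv ^^ j) f has_real_derivative F (Suc j) x) (at x)"
    by (rule has_field_derivative_transform_within_open[of _ _ _ "{0<..<A}"]) (use Suc in auto)
  then show ?case by (simp add: DERIV_imp_deriv)
qed

lemma jet_has_deriv:
  assumes "jet m A f F" "j < m" "x \<in> {0<..<A}"
  shows "((deriv ^^ j) f has_real_derivative F (Suc j) x) (at x)"
proof -
  have "(F j has_real_derivative F (Suc j) x) (at x)"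
    using assms by (auto simp: jet_def)
  then show ?thesis
    by (rule has_field_derivative_transform_within_open[of _ _ _ "{0<..<A}"])
      (use assms jet_deriv[OF assms(1)] in auto)
qed

lemma jet_imp_Cm_on:
  assumes "jet m A f F"
  shows "Cm_on m A f"
  unfolding Cm_on_def
proof (intro conjI allI impI ballI)
  have "continuous_on {0..A} (F 0)" using assms by (auto simp: jet_def)
  then show "continuous_on {0..A} f"
    using assms by (subst continuous_on_cong[of _ "{0..A}" _ "F 0"]) (auto simp: jet_def)
  show "(deriv ^^ j) f differentiable (at x)" if "j < m" "x \<in> {0<..<A}" for j x
    using jet_has_deriv[OF assms that] real_differentiable_def by blast
  show "\<exists>F. continuous_on {0..A} F \<and> (\<forall>x\<in>{0<..<A}. F x = (deriv ^^ j) f x)" if "j \<le> m" for j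
    using jet_deriv[OF assms that] assms that by (intro exI[of _ "F j"]) (auto simp: jet_def)
qed

lemma jet_Dext:
  assumes "jet m A f F" "0 < A" "j \<le> m" "x \<in> {0..A}"
  shows "Dext A j f x = F j x"
proof -
  \<comment> \<open>Every point of \<open>{0..A}\<close>, endpoints included, is a limit point of
    the open interval, so the limit that defines \<open>Dext\<close> is unique.\<close>
  have ne: "at x within {0<..<A} \<noteq> bot"
    using assms(2,4) closure_greaterThanLessThan[of 0 A]
    by (cases "x \<in> {0<..<A}")
      (auto simp: trivial_limit_within closure_def intro: interior_limit_point)
  have "(F j \<longlongrightarrow> F j x) (at x within {0..A})"
    using assms by (auto simp: jet_def continuous_on_def)
  then have "(F j \<longlongrightarrow> F j x) (at x within {0<..<A})"
    by (rule tendsto_within_subset) auto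
  moreover have "\<forall>\<^sub>F y in at x within {0<..<A}. F j y = (deriv ^^ j) f y"
    using jet_deriv[OF assms(1,3)] by (auto simp: eventually_at_filter)
  ultimately have "((deriv ^^ j) f \<longlongrightarrow> F j x) (at x within {0<..<A})"
    by (rule Lim_transform_eventually)
  then show ?thesis unfolding Dext_def by (rule tendsto_Lim[OF ne])
qed

lemma Cm_on_obtains_jet:
  assumes "Cm_on m A f"
  obtains F where "jet m A f F"
proof -
  obtain G where G: "\<And>j. j \<le> m \<Longrightarrow> continuous_on {0..A} (G j)"
    "\<And>j x. j \<le> m \<Longrightarrow> x \<in> {0<..<A} \<Longrightarrow> G j x = (deriv ^^ j) f x"
    using assms unfolding Cm_on_def by metis
  \<comment> \<open>\<open>G 0\<close> is known to agree with \<open>f\<close> on the open interval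
    only, whereas entry 0 of a jet must be \<open>f\<close> up to the endpoints; \<open>f\<close> is
    itself continuous there.\<close>
  define F where "F = G(0 := f)"
  have F: "F j x = (deriv ^^ j) f x" if "j \<le> m" "x \<in> {0<..<A}" for j x
    using G(2) that by (cases j) (auto simp: F_def)
  have "(F j has_real_derivative F (Suc j) x) (at x)" if "j < m" "x \<in> {0<..<A}" for j x
  proof -
    have "((deriv ^^ j) f has_real_derivative (deriv ^^ Suc j) f x) (at x)"
      using assms that
      by (simp add: Cm_on_def DERIV_deriv_iff_real_differentiable)
    then have "((deriv ^^ j) f has_real_derivative F (Suc j) x) (at x)"
      using F[of "Suc j" x] that by simp
    then show ?thesis
      by (rule has_field_derivative_transform_within_open[of _ _ _ "{0<..<A}"])
        (use F that in auto)
  qed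
  moreover have "continuous_on {0..A} (F j)" if "j \<le> m" for j
    using G(1)[OF that] assms by (cases j) (auto simp: F_def Cm_on_def)
  ultimately have "jet m A f F" unfolding jet_def by (auto simp: F_def)
  then show ?thesis by (rule that)
qed

lemma jet_cong:
  assumes "jet m A f F" "\<And>j x. j \<le> m \<Longrightarrow> x \<in> {0..A} \<Longrightarrow> F j x = G j x"
    "\<And>x. x \<in> {0..A} \<Longrightarrow> f x = g x"
  shows "jet m A g G"
  unfolding jet_def
proof (intro conjI allI impI ballI)
  show "G 0 x = g x" if "x \<in> {0..A}" for x
    using assms(1) assms(2)[of 0 x] assms(3)[of x] that by (auto simp: jet_def)
  show "continuous_on {0..A} (G j)" if "j \<le> m" for j
    using assms(1) continuous_on_cong[of "{0..A}" "{0..A}" "F j" "G j"] assms(2) that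
    by (auto simp: jet_def)
  show "(G j has_real_derivative G (Suc j) x) (at x)" if "j < m" "x \<in> {0<..<A}" for j x
  proof -
    have "(F j has_real_derivative G (Suc j) x) (at x)"
      using assms(1) assms(2)[of "Suc j" x, symmetric] that by (auto simp: jet_def)
    then show ?thesis
      by (rule has_field_derivative_transform_within_open[of _ _ _ "{0<..<A}"])
        (use assms(2) that in auto)
  qed
qed

lemma Cm_on_jet:
  assumes "0 < A" "Cm_on m A f"
  shows "jet m A f (\<lambda>j. Dext A j f)"
proof -
  obtain F where F: "jet m A f F" using assms(2) by (rule Cm_on_obtains_jet)
  show ?thesis by (rule jet_cong[OF F]) (use jet_Dext[OF F assms(1)] in auto)
qed

lemma Cm_on_Dext:
  assumes "0 < A" "Cm_on m A f"
  shows "x \<in> {0..A} \<Longrightarrow> Dext A 0 f x = f x"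
    and "j \<le> m \<Longrightarrow> continuous_on {0..A} (Dext A j f)"
    and "j < m \<Longrightarrow> x \<in> {0<..<A} \<Longrightarrow> (Dext A j f has_real_derivative Dext A (Suc j) f x) (at x)"
    and "j \<le> m \<Longrightarrow> x \<in> {0<..<A} \<Longrightarrow> (deriv ^^ j) f x = Dext A j f x"
  using Cm_on_jet[OF assms] jet_deriv[OF Cm_on_jet[OF assms]] by (auto simp: jet_def)

lemma Cm_on_cong:
  assumes "Cm_on m A f" "\<And>x. x \<in> {0..A} \<Longrightarrow> f x = g x"
  shows "Cm_on m A g"
  using Cm_on_obtains_jet[OF assms(1)] jet_cong[of m A f _ _ g] assms(2) jet_imp_Cm_on by metis

lemma Dext_cong:
  assumes "0 < A" "Cm_on m A f" "\<And>x. x \<in> {0..A} \<Longrightarrow> f x = g x" "j \<le> m" "x \<in> {0..A}"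
  shows "Dext A j g x = Dext A j f x"
proof -
  have "jet m A g (\<lambda>j. Dext A j f)"
    by (rule jet_cong[OF Cm_on_jet[OF assms(1,2)]]) (use assms in auto)
  then show ?thesis using jet_Dext assms by blast
qed

lemma Cm_on_mono:
  assumes "Cm_on m A f" "k \<le> m"
  shows "Cm_on k A f"
  using assms unfolding Cm_on_def by auto

lemma Cm_on_continuous: "Cm_on m A f \<Longrightarrow> continuous_on {0..A} f"
  by (simp add: Cm_on_def)

lemma Cm_on_0: "continuous_on {0..A} f \<Longrightarrow> Cm_on 0 A f"
  by (rule jet_imp_Cm_on[of _ _ _ "\<lambda>_. f"]) (simp add: jet_def)

text \<open>Together with \<open>Cm_on_SucD\<close> this reduces order \<open>Suc m\<close> to a
  derivative of order \<open>m\<close>, which turns the closure under products, inverses, real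
  powers and compositions into inductions on \<open>m\<close>.\<close>

lemma Cm_on_SucI:
  assumes "continuous_on {0..A} f" "Cm_on m A f'"
    and "\<And>x. x \<in> {0<..<A} \<Longrightarrow> (f has_real_derivative f' x) (at x)"
  shows "Cm_on (Suc m) A f"
proof -
  obtain F where F: "jet m A f' F" using assms(2) by (rule Cm_on_obtains_jet)
  have "jet (Suc m) A f (case_nat f F)"
    unfolding jet_def
  proof (intro conjI allI impI ballI)
    show "continuous_on {0..A} (case_nat f F j)" if "j \<le> Suc m" for j
      using F assms(1) that by (auto simp: jet_def split: nat.split)
    show "(case_nat f F j has_real_derivative case_nat f F (Suc j) x) (at x)"
      if "j < Suc m" "x \<in> {0<..<A}" for j x
      using F assms(3)[OF that(2)] that by (auto simp: jet_def split: nat.split)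
  qed auto
  then show ?thesis by (rule jet_imp_Cm_on)
qed

lemma Cm_on_SucD:
  assumes "Cm_on (Suc m) A f"
  shows "\<exists>f'. Cm_on m A f' \<and> (\<forall>x\<in>{0<..<A}. (f has_real_derivative f' x) (at x))"
proof -
  obtain F where F: "jet (Suc m) A f F" using assms by (rule Cm_on_obtains_jet)
  have "jet m A (F 1) (\<lambda>j. F (Suc j))"
    using F by (auto simp: jet_def)
  moreover have "(f has_real_derivative F 1 x) (at x)" if "x \<in> {0<..<A}" for x
    using jet_has_deriv[OF F, of 0 x] that by simp
  ultimately show ?thesis by (intro exI[of _ "F 1"]) (simp add: jet_imp_Cm_on)
qed

section \<open>Algebraic operations and compositions in class \<open>C^m\<close>\<close>

lemma jet_add:
  assumes "jet m A f F" "jet m A g G"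
  shows "jet m A (\<lambda>x. f x + g x) (\<lambda>j x. F j x + G j x)"
  using assms unfolding jet_def by (auto intro!: continuous_intros derivative_intros)

lemma jet_cmult:
  assumes "jet m A f F"
  shows "jet m A (\<lambda>x. c * f x) (\<lambda>j x. c * F j x)"
  using assms unfolding jet_def by (auto intro!: continuous_intros DERIV_cmult)

lemma jet_zero: "jet m A (\<lambda>x. 0) (\<lambda>j x. 0)"
  unfolding jet_def by auto

lemma jet_sum:
  assumes "\<And>i. i \<in> S \<Longrightarrow> jet m A (f i) (F i)"
  shows "jet m A (\<lambda>x. \<Sum>i\<in>S. f i x) (\<lambda>j x. \<Sum>i\<in>S. F i j x)"
  using assms
  by (induction S rule: infinite_finite_induct) (auto simp: jet_zero intro!: jet_add)

lemma Cm_on_add: "Cm_on m A f \<Longrightarrow> Cm_on m A g \<Longrightarrow> Cm_on m A (\<lambda>x. f x + g x)"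
  by (erule Cm_on_obtains_jet)+ (rule jet_imp_Cm_on[OF jet_add])

lemma Cm_on_cmult: "Cm_on m A f \<Longrightarrow> Cm_on m A (\<lambda>x. c * f x)"
  by (erule Cm_on_obtains_jet) (rule jet_imp_Cm_on[OF jet_cmult])

lemma Cm_on_sum:
  assumes "0 < A" "\<And>i. i \<in> S \<Longrightarrow> Cm_on m A (f i)"
  shows "Cm_on m A (\<lambda>x. \<Sum>i\<in>S. f i x)"
  using jet_sum[of S m A f "\<lambda>i j. Dext A j (f i)"] Cm_on_jet assms jet_imp_Cm_on by blast

lemma Dext_add:
  assumes "0 < A" "Cm_on m A f" "Cm_on m A g" "j \<le> m" "x \<in> {0..A}"
  shows "Dext A j (\<lambda>x. f x + g x) x = Dext A j f x + Dext A j g x"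
  using jet_Dext[OF jet_add[OF Cm_on_jet Cm_on_jet]] assms by blast

lemma Dext_cmult:
  assumes "0 < A" "Cm_on m A f" "j \<le> m" "x \<in> {0..A}"
  shows "Dext A j (\<lambda>x. c * f x) x = c * Dext A j f x"
  using jet_Dext[OF jet_cmult[OF Cm_on_jet]] assms by blast

lemma Dext_sum:
  assumes "0 < A" "\<And>i. i \<in> S \<Longrightarrow> Cm_on m A (f i)" "j \<le> m" "x \<in> {0..A}"
  shows "Dext A j (\<lambda>x. \<Sum>i\<in>S. f i x) x = (\<Sum>i\<in>S. Dext A j (f i) x)"
  using jet_Dext[OF jet_sum[of S m A f "\<lambda>i j. Dext A j (f i)"]] Cm_on_jet assms by blast

lemma Cm_on_const: "Cm_on m A (\<lambda>x. c)"
  by (rule jet_imp_Cm_on[of _ _ _ "\<lambda>j x. if j = 0 then c else 0"]) (auto simp: jet_def)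

lemma Cm_on_mult: "Cm_on m A f \<Longrightarrow> Cm_on m A g \<Longrightarrow> Cm_on m A (\<lambda>x. f x * g x)"
proof (induction m arbitrary: f g)
  case 0
  then show ?case by (auto intro!: Cm_on_0 continuous_intros dest: Cm_on_continuous)
next
  case (Suc m)
  obtain f' where f': "Cm_on m A f'" "\<And>x. x \<in> {0<..<A} \<Longrightarrow> (f has_real_derivative f' x) (at x)"
    using Cm_on_SucD[OF Suc.prems(1)] by blast
  obtain g' where g': "Cm_on m A g'" "\<And>x. x \<in> {0<..<A} \<Longrightarrow> (g has_real_derivative g' x) (at x)"
    using Cm_on_SucD[OF Suc.prems(2)] by blast
  have fg: "Cm_on m A f" "Cm_on m A g" using Suc.prems by (auto intro: Cm_on_mono)
  show ?case
  proof (rule Cm_on_SucI)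
    show "Cm_on m A (\<lambda>x. f' x * g x + f x * g' x)"
      by (intro Cm_on_add Suc.IH f' g' fg)
    show "((\<lambda>x. f x * g x) has_real_derivative f' x * g x + f x * g' x) (at x)"
      if "x \<in> {0<..<A}" for x
      using DERIV_mult[OF f'(2)[OF that] g'(2)[OF that]] by (simp add: algebra_simps)
  qed (use Suc.prems in \<open>auto intro!: continuous_intros dest: Cm_on_continuous\<close>)
qed

lemma Cm_on_power: "Cm_on m A f \<Longrightarrow> Cm_on m A (\<lambda>x. f x ^ n)"
  by (induction n) (auto intro: Cm_on_const Cm_on_mult)

lemma Cm_on_inverse:
  assumes "Cm_on m A f" "\<And>x. x \<in> {0..A} \<Longrightarrow> f x \<noteq> 0"
  shows "Cm_on m A (\<lambda>x. inverse (f x))"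
  using assms
proof (induction m arbitrary: f)
  case 0
  then show ?case by (auto intro!: Cm_on_0 continuous_intros dest: Cm_on_continuous)
next
  case (Suc m)
  obtain f' where f': "Cm_on m A f'" "\<And>x. x \<in> {0<..<A} \<Longrightarrow> (f has_real_derivative f' x) (at x)"
    using Cm_on_SucD[OF Suc.prems(1)] by blast
  have inv: "Cm_on m A (\<lambda>x. inverse (f x))"
    using Suc.prems by (intro Suc.IH) (auto intro: Cm_on_mono)
  show ?case
  proof (rule Cm_on_SucI)
    show "Cm_on m A (\<lambda>x. (- 1) * (inverse (f x) * f' x * inverse (f x)))"
      by (intro Cm_on_cmult Cm_on_mult inv f')
    show "((\<lambda>x. inverse (f x)) has_real_derivative (- 1) * (inverse (f x) * f' x * inverse (f x))) (at x)"
      if "x \<in> {0<..<A}" for x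
      using DERIV_inverse'[OF f'(2)[OF that]] Suc.prems(2)[of x] that by simp
  qed (use Suc.prems in \<open>auto intro!: continuous_intros dest: Cm_on_continuous\<close>)
qed

lemma Cm_on_powr:
  assumes "Cm_on m A f" "\<And>x. x \<in> {0..A} \<Longrightarrow> f x > 0"
  shows "Cm_on m A (\<lambda>x. f x powr s)"
  using assms
proof (induction m arbitrary: f)
  case 0
  then show ?case
    by (intro Cm_on_0 continuous_on_powr)
      (force intro!: continuous_intros dest: Cm_on_continuous)+
next
  case (Suc m)
  obtain f' where f': "Cm_on m A f'" "\<And>x. x \<in> {0<..<A} \<Longrightarrow> (f has_real_derivative f' x) (at x)"
    using Cm_on_SucD[OF Suc.prems(1)] by blast
  have f: "Cm_on m A f" using Suc.prems by (auto intro: Cm_on_mono)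
  have inv: "Cm_on m A (\<lambda>x. inverse (f x))"
    using Suc.prems(2) f by (intro Cm_on_inverse) (force+)
  have pw: "Cm_on m A (\<lambda>x. f x powr s)"
    using Suc.prems f by (intro Suc.IH) auto
  show ?case
  proof (rule Cm_on_SucI)
    \<comment> \<open>The derivative is written with \<open>f' / f\<close> times the power
      \<open>s\<close> instead of with exponent \<open>s - 1\<close>, because the induction
      hypothesis is about the fixed exponent \<open>s\<close>.\<close>
    show "Cm_on m A (\<lambda>x. s * (f x powr s * (f' x * inverse (f x))))"
      by (intro Cm_on_cmult Cm_on_mult inv pw f')
    show "((\<lambda>x. f x powr s) has_real_derivative s * (f x powr s * (f' x * inverse (f x)))) (at x)"
      if "x \<in> {0<..<A}" for x
      using DERIV_fun_powr[OF f'(2)[OF that], of s] Suc.prems(2)[of x] that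
      by (simp add: powr_diff field_simps)
    show "continuous_on {0..A} (\<lambda>x. f x powr s)"
      using Cm_on_continuous[OF pw] .
  qed
qed

lemma Cm_on_add_ident: "Cm_on m A (\<lambda>x. x + b)"
proof (cases m)
  case 0
  then show ?thesis by (auto intro!: Cm_on_0 continuous_intros)
next
  case (Suc k)
  show ?thesis unfolding Suc
    by (rule Cm_on_SucI[OF _ Cm_on_const[of k A 1]])
      (auto intro!: continuous_intros derivative_eq_intros)
qed

text \<open>The chain rule needs \<open>p x\<close> in the open interval, where \<open>f\<close> is
  differentiable; hence \<open>p\<close> has to preserve the open interval as well as its
  closure.\<close>

lemma Cm_on_compose:
  assumes "Cm_on m A f" "Cm_on m A p" "p ` {0..A} \<subseteq> {0..A}" "p ` {0<..<A} \<subseteq> {0<..<A}"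
  shows "Cm_on m A (\<lambda>x. f (p x))"
  using assms
proof (induction m arbitrary: f)
  case 0
  then show ?case
    by (auto intro!: Cm_on_0 continuous_on_compose2[of "{0..A}" f "{0..A}" p]
        dest: Cm_on_continuous)
next
  case (Suc m)
  obtain f' where f': "Cm_on m A f'" "\<And>x. x \<in> {0<..<A} \<Longrightarrow> (f has_real_derivative f' x) (at x)"
    using Cm_on_SucD[OF Suc.prems(1)] by blast
  obtain p' where p': "Cm_on m A p'" "\<And>x. x \<in> {0<..<A} \<Longrightarrow> (p has_real_derivative p' x) (at x)"
    using Cm_on_SucD[OF Suc.prems(2)] by blast
  have p: "Cm_on m A p" using Suc.prems by (auto intro: Cm_on_mono)
  show ?case
  proof (rule Cm_on_SucI)
    show "Cm_on m A (\<lambda>x. f' (p x) * p' x)"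
      by (rule Cm_on_mult[OF Suc.IH[OF f'(1) p Suc.prems(3,4)] p'(1)])
    show "((\<lambda>x. f (p x)) has_real_derivative f' (p x) * p' x) (at x)"
      if "x \<in> {0<..<A}" for x
      by (rule DERIV_chain2[OF f'(2) p'(2)[OF that]]) (use that Suc.prems(4) in blast)
    show "continuous_on {0..A} (\<lambda>x. f (p x))"
      by (rule continuous_on_compose2[of "{0..A}" f "{0..A}" p])
        (use Suc.prems in \<open>auto dest: Cm_on_continuous\<close>)
  qed
qed

text \<open>The Weierstrass test makes the series of every derivative converge uniformly, and
  termwise differentiation makes the sums a jet. This serves as completeness of the space, for the
  eigenfunction and later for the Neumann series.\<close>

lemma Cm_on_series:
  fixes f :: "nat \<Rightarrow> real \<Rightarrow> real"
  assumes A: "0 < A" and f: "\<And>n. Cm_on m A (f n)"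
    and e: "\<And>n j x. j \<le> m \<Longrightarrow> x \<in> {0..A} \<Longrightarrow> \<bar>Dext A j (f n) x\<bar> \<le> e n" and se: "summable e"
    and F: "\<And>x. x \<in> {0..A} \<Longrightarrow> (\<lambda>n. f n x) sums F x"
  shows "Cm_on m A F"
    and "\<And>j x. j \<le> m \<Longrightarrow> x \<in> {0..A} \<Longrightarrow> (\<lambda>n. Dext A j (f n) x) sums Dext A j F x"
proof -
  define S where "S j x = (\<Sum>n. Dext A j (f n) x)" for j x
  have ul: "uniform_limit {0..A} (\<lambda>n x. \<Sum>i<n. Dext A j (f i) x) (S j) sequentially" if "j \<le> m" for j
    unfolding S_def by (rule Weierstrass_m_test[OF _ se]) (use e that in auto)
  have sm: "(\<lambda>n. Dext A j (f n) x) sums S j x" if "j \<le> m" "x \<in> {0..A}" for j x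
    unfolding sums_def by (rule tendsto_uniform_limitI[OF ul]) (use that in auto)
  have jet: "jet m A F S"
    unfolding jet_def
  proof (intro conjI allI impI ballI)
    show "S 0 x = F x" if "x \<in> {0..A}" for x
      using sm[of 0 x] F[of x] Cm_on_Dext(1)[OF A f] that sums_unique2 by fastforce
    show "continuous_on {0..A} (S j)" if "j \<le> m" for j
      by (rule uniform_limit_theorem[OF _ ul[OF that]])
        (use Cm_on_Dext(2)[OF A f] that in \<open>auto intro!: always_eventually continuous_on_sum\<close>)
    show "(S j has_real_derivative S (Suc j) x) (at x)" if j: "j < m" and x: "x \<in> {0<..<A}" for j x
    proof -
      \<comment> \<open>Termwise differentiation yields only some sum function \<open>G\<close>; by
        uniqueness of sums it is \<open>S j\<close> on the open interval.\<close>
      have "\<exists>G. \<forall>x\<in>{0<..<A}. (\<lambda>n. Dext A j (f n) x) sums G x \<and>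
          (G has_field_derivative S (Suc j) x) (at x within {0<..<A})"
      proof (rule has_field_derivative_series[where ?f' = "\<lambda>n. Dext A (Suc j) (f n)"])
        show "(Dext A j (f n) has_field_derivative Dext A (Suc j) (f n) x) (at x within {0<..<A})"
          if "x \<in> {0<..<A}" for n x
          using Cm_on_Dext(3)[OF A f j that] by (rule has_field_derivative_at_within)
        show "uniform_limit {0<..<A} (\<lambda>n x. \<Sum>i<n. Dext A (Suc j) (f i) x) (S (Suc j)) sequentially"
          by (rule uniform_limit_on_subset[OF ul]) (use j in auto)
        show "x \<in> {0<..<A}" by fact
        show "summable (\<lambda>n. Dext A j (f n) x)" using sm[of j x] j x by (auto simp: sums_iff)
      qed auto
      then obtain G where G: "\<And>x. x \<in> {0<..<A} \<Longrightarrow> (\<lambda>n. Dext A j (f n) x) sums G x"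
          "(G has_field_derivative S (Suc j) x) (at x within {0<..<A})"
        using x by blast
      have "G y = S j y" if "y \<in> {0<..<A}" for y
        using G(1)[OF that] sm[of j y] j that sums_unique2 by fastforce
      moreover have "(G has_field_derivative S (Suc j) x) (at x)"
        using G(2) x at_within_open[of x "{0<..<A}"] by simp
      ultimately show ?thesis
        using has_field_derivative_transform_within_open[of G _ x "{0<..<A}"] x by auto
    qed
  qed
  show "Cm_on m A F" using jet by (rule jet_imp_Cm_on)
  show "(\<lambda>n. Dext A j (f n) x) sums Dext A j F x" if "j \<le> m" "x \<in> {0..A}" for j x
    using sm[OF that] jet_Dext[OF jet A that] by simp
qed

section \<open>The norm in terms of extended derivatives\<close>

lemma Dext_le_Cm_norm:
  assumes "0 < A" "Cm_on m A f" "j \<le> m" "x \<in> {0..A}"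
  shows "\<bar>Dext A j f x\<bar> \<le> Cm_norm m A f"
proof -
  have cont: "continuous_on {0..A} (\<lambda>x. \<bar>Dext A j f x\<bar>)"
    using Cm_on_Dext(2)[OF assms(1-3)] by (intro continuous_intros)
  \<comment> \<open>A supremum in \<open>Cm_norm\<close> is an upper bound only if the set is
    bounded; this follows from compactness, as the extended derivative is continuous on the closed
    interval.\<close>
  have bdd: "bdd_above ((\<lambda>x. \<bar>(deriv ^^ j) f x\<bar>) ` {0<..<A})"
  proof -
    have "compact ((\<lambda>x. \<bar>Dext A j f x\<bar>) ` {0..A})"
      by (intro compact_continuous_image cont compact_Icc)
    then have "bdd_above ((\<lambda>x. \<bar>Dext A j f x\<bar>) ` {0..A})"
      by (intro bounded_imp_bdd_above compact_imp_bounded)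
    then have "bdd_above ((\<lambda>x. \<bar>Dext A j f x\<bar>) ` {0<..<A})"
      by (rule bdd_above_mono) auto
    also have "(\<lambda>x. \<bar>Dext A j f x\<bar>) ` {0<..<A} = (\<lambda>x. \<bar>(deriv ^^ j) f x\<bar>) ` {0<..<A}"
      using Cm_on_Dext(4)[OF assms(1-3)] by (intro image_cong) auto
    finally show ?thesis .
  qed
  have "\<bar>Dext A j f y\<bar> \<le> Cm_norm m A f" if y: "y \<in> {0<..<A}" for y
  proof -
    have "\<bar>Dext A j f y\<bar> = \<bar>(deriv ^^ j) f y\<bar>" using Cm_on_Dext(4)[OF assms(1-3) y] by simp
    also have "\<dots> \<le> (SUP x\<in>{0<..<A}. \<bar>(deriv ^^ j) f x\<bar>)" by (rule cSUP_upper[OF y bdd])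
    also have "\<dots> \<le> Cm_norm m A f" unfolding Cm_norm_def by (rule Max_ge) (use assms in auto)
    finally show ?thesis .
  qed
  then show ?thesis using le_on_Icc_if_le_on_Ioo[OF assms(1) cont _ assms(4)] by blast
qed

lemma Cm_norm_le:
  assumes "0 < A" "Cm_on m A f" "\<And>j x. j \<le> m \<Longrightarrow> x \<in> {0..A} \<Longrightarrow> \<bar>Dext A j f x\<bar> \<le> c"
  shows "Cm_norm m A f \<le> c"
  unfolding Cm_norm_def
proof (subst Max_le_iff; (intro ballI)?)
  fix a assume "a \<in> (\<lambda>j. SUP x\<in>{0<..<A}. \<bar>(deriv ^^ j) f x\<bar>) ` {..m}"
  then obtain j where j: "j \<le> m" "a = (SUP x\<in>{0<..<A}. \<bar>(deriv ^^ j) f x\<bar>)" by auto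
  show "a \<le> c" unfolding j(2)
    by (rule cSUP_least) (use Cm_on_Dext(4)[OF assms(1,2) j(1)] assms j in auto)
qed auto

section \<open>The contracting family \<open>\<theta>\<^sub>b\<close>\<close>

lemma ln_diff_le:
  fixes p q a :: real
  assumes "0 < a" "a \<le> p" "a \<le> q"
  shows "\<bar>ln p - ln q\<bar> \<le> \<bar>p - q\<bar> / a"
proof -
  have *: "ln p - ln q \<le> \<bar>p - q\<bar> / a" if "a \<le> p" "a \<le> q" for p q
  proof -
    have "ln p - ln q = ln (p / q)" using that assms by (simp add: ln_div)
    also have "\<dots> \<le> p / q - 1" using that assms by (intro ln_le_minus_one) auto
    also have "\<dots> = (p - q) / q" using that assms by (simp add: field_simps)
    also have "\<dots> \<le> \<bar>p - q\<bar> / q" using that assms by (intro divide_right_mono) auto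
    also have "\<dots> \<le> \<bar>p - q\<bar> / a" using that assms by (intro divide_left_mono) auto
    finally show ?thesis .
  qed
  show ?thesis using *[of p q] *[of q p] assms by (simp add: abs_minus_commute abs_le_iff)
qed

locale positive_transfer =
  fixes B :: "real set" and \<gamma> A s :: real and m :: nat and g :: "real \<Rightarrow> real \<Rightarrow> real"
  assumes finite_B: "finite B" and B_ne: "B \<noteq> {}"
    and \<gamma>_pos: "\<gamma> > 0" and B_ge: "\<And>b. b \<in> B \<Longrightarrow> b \<ge> \<gamma>"
    and A_ge: "A \<ge> inverse \<gamma>"
    and m_ge: "m \<ge> 1"
    and Cm_g: "\<And>b. b \<in> B \<Longrightarrow> Cm_on m A (g b)"
    and g_pos: "\<And>b x. b \<in> B \<Longrightarrow> x \<in> {0..A} \<Longrightarrow> g b x > 0"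
begin

definition h :: "real \<Rightarrow> real \<Rightarrow> real" where "h b x = g b x powr s"

definition \<kappa> :: real where "\<kappa> = inverse (1 + \<gamma>\<^sup>2)"

abbreviation T :: "(real \<Rightarrow> real) \<Rightarrow> real \<Rightarrow> real" where "T \<equiv> Lam B g A s"

definition \<theta>' :: "real \<Rightarrow> real \<Rightarrow> real" where "\<theta>' b x = - (inverse (x + b))\<^sup>2"

definition di :: "real \<Rightarrow> real \<Rightarrow> real" where "di x y = \<bar>ln (x + \<gamma>) - ln (y + \<gamma>)\<bar>"

definition diam :: real where "diam = di 0 A"

lemma A_pos: "A > 0"
  using \<gamma>_pos A_ge positive_imp_inverse_positive[of \<gamma>] by linarith

lemma \<kappa>_pos: "\<kappa> > 0" and \<kappa>_less_1: "\<kappa> < 1"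
  using \<gamma>_pos by (auto simp: \<kappa>_def inverse_less_1_iff add_pos_pos)

lemma theta_mem: "b \<in> B \<Longrightarrow> x \<in> {0..A} \<Longrightarrow> theta b x \<in> {0..A}"
  and theta_mem_open: "b \<in> B \<Longrightarrow> x \<in> {0<..<A} \<Longrightarrow> theta b x \<in> {0<..<A}"
proof -
  assume b: "b \<in> B"
  have le: "theta b x \<le> A" "theta b x > 0" if "x \<ge> 0" for x
  proof -
    have "inverse (x + b) \<le> inverse \<gamma>"
      using B_ge[OF b] \<gamma>_pos that by (intro le_imp_inverse_le) auto
    then show "theta b x \<le> A" using A_ge by (simp add: theta_def)
    show "theta b x > 0" using B_ge[OF b] \<gamma>_pos that by (simp add: theta_def)
  qed
  show "theta b x \<in> {0..A}" if "x \<in> {0..A}" using le[of x] that by simp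
  show "theta b x \<in> {0<..<A}" if "x \<in> {0<..<A}"
  proof -
    have "inverse (x + b) < inverse \<gamma>"
      using B_ge[OF b] \<gamma>_pos that by (intro less_imp_inverse_less) auto
    then show ?thesis using A_ge le[of x] that by (simp add: theta_def)
  qed
qed

lemma theta_deriv: "b \<in> B \<Longrightarrow> x \<ge> 0 \<Longrightarrow> (theta b has_real_derivative \<theta>' b x) (at x)"
  using B_ge[of b] \<gamma>_pos unfolding theta_def \<theta>'_def
  by (auto intro!: derivative_eq_intros simp: power2_eq_square)

text \<open>With \<open>t = x + b\<close>, the factor \<open>\<bar>\<theta>' b x\<bar>\<close> is
  \<open>t^-2\<close> and \<open>theta b x + \<gamma>\<close> is \<open>t^-2\<close> times
  \<open>t (1 + \<gamma> t)\<close>. The claim thus reduces to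
  \<open>(x + \<gamma>) (1 + \<gamma>^2) \<le> t (1 + \<gamma> t)\<close>, true because
  \<open>t \<ge> x + \<gamma> \<ge> \<gamma>\<close>. It is both the infinitesimal contraction of
  \<open>di\<close> and the source of the weights for derivatives.\<close>

lemma \<theta>'_weight:
  assumes "b \<in> B" "x \<ge> 0"
  shows "\<bar>\<theta>' b x\<bar> * (x + \<gamma>) \<le> \<kappa> * (theta b x + \<gamma>)"
proof -
  have b: "b \<ge> \<gamma>" "b > 0" "x + b > 0" using B_ge[OF assms(1)] \<gamma>_pos assms(2) by auto
  have "\<gamma>\<^sup>2 \<le> \<gamma> * (x + b)"
    using b \<gamma>_pos assms(2) by (auto simp: power2_eq_square)
  then have "(x + \<gamma>) * (1 + \<gamma>\<^sup>2) \<le> (x + b) * (1 + \<gamma> * (x + b))"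
    using b assms(2) \<gamma>_pos by (intro mult_mono) auto
  then have "inverse (x + b)^2 * ((x + \<gamma>) * (1 + \<gamma>\<^sup>2)) \<le> inverse (x + b)^2 * ((x + b) * (1 + \<gamma> * (x + b)))"
    by (intro mult_left_mono) auto
  also have "\<dots> = theta b x + \<gamma>"
  proof -
    have "inverse t ^ 2 * (t * (1 + \<gamma> * t)) = inverse t + \<gamma>" if "t > 0" for t
      using that by (simp add: field_simps power2_eq_square)
    then show ?thesis using b(3) by (simp add: theta_def)
  qed
  finally have "\<bar>\<theta>' b x\<bar> * (x + \<gamma>) * (1 + \<gamma>\<^sup>2) \<le> theta b x + \<gamma>"
    by (simp add: \<theta>'_def mult.assoc)
  moreover have "1 + \<gamma>\<^sup>2 > 0" by (simp add: add_pos_nonneg)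
  ultimately show ?thesis
    by (simp add: \<kappa>_def field_simps)
qed

text \<open>Integrated form of \<open>\<theta>'_weight\<close>: in the coordinate
  \<open>ln (x + \<gamma>)\<close> the map has a derivative of absolute value at most
  \<open>\<kappa>\<close>.\<close>

lemma di_theta:
  assumes "b \<in> B" "x \<ge> 0" "y \<ge> 0"
  shows "di (theta b x) (theta b y) \<le> \<kappa> * di x y"
proof -
  have th: "theta b x > 0" if "x \<ge> 0" for x
    using B_ge[OF assms(1)] \<gamma>_pos that by (simp add: theta_def)
  have *: "di (theta b x) (theta b y) \<le> \<kappa> * di x y" if xy: "0 \<le> x" "x \<le> y" for x y
  proof -
    \<comment> \<open>Taking \<open>c\<close> as 1 and as -1 gives the two one-sided bounds that
      make up the absolute value in \<open>di\<close>.\<close>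
    have mono: "\<kappa> * ln (x + \<gamma>) + c * ln (theta b x + \<gamma>) \<le> \<kappa> * ln (y + \<gamma>) + c * ln (theta b y + \<gamma>)"
      if c: "\<bar>c\<bar> = 1" for c
    proof (rule DERIV_nonneg_imp_nondecreasing[OF xy(2)], intro exI conjI)
      fix z assume z: "x \<le> z" "z \<le> y"
      then have z0: "z \<ge> 0" using xy by simp
      show "((\<lambda>x. \<kappa> * ln (x + \<gamma>) + c * ln (theta b x + \<gamma>)) has_real_derivative
          \<kappa> * inverse (z + \<gamma>) + c * (\<theta>' b z * inverse (theta b z + \<gamma>))) (at z)"
        using z0 \<gamma>_pos th[OF z0]
        by (auto intro!: derivative_eq_intros theta_deriv[OF assms(1)] simp: divide_inverse)
      have pos: "z + \<gamma> > 0" "theta b z + \<gamma> > 0" using z0 \<gamma>_pos th[OF z0] by auto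
      have "\<bar>c * (\<theta>' b z * inverse (theta b z + \<gamma>))\<bar> \<le> \<kappa> * inverse (z + \<gamma>)"
        using \<theta>'_weight[OF assms(1) z0] pos c by (simp add: abs_mult field_simps)
      then show "0 \<le> \<kappa> * inverse (z + \<gamma>) + c * (\<theta>' b z * inverse (theta b z + \<gamma>))"
        by linarith
    qed
    have "ln (x + \<gamma>) \<le> ln (y + \<gamma>)" using xy \<gamma>_pos by simp
    then have "\<kappa> * di x y = \<kappa> * ln (y + \<gamma>) - \<kappa> * ln (x + \<gamma>)"
      by (simp add: di_def right_diff_distrib)
    then show ?thesis
      using mono[of 1] mono[of "-1"] by (simp add: di_def)
  qed
  have sym: "di u v = di v u" for u v by (simp add: di_def abs_minus_commute)
  show ?thesis
    using *[of x y] *[of y x] assms sym by (cases "x \<le> y") auto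
qed

lemma di_nonneg: "di x y \<ge> 0" and di_commute: "di x y = di y x"
  by (auto simp: di_def)

lemma di_le_diam:
  assumes "x \<in> {0..A}" "y \<in> {0..A}"
  shows "di x y \<le> diam"
proof -
  have "ln (0 + \<gamma>) \<le> ln (x + \<gamma>)" "ln (x + \<gamma>) \<le> ln (A + \<gamma>)"
    "ln (0 + \<gamma>) \<le> ln (y + \<gamma>)" "ln (y + \<gamma>) \<le> ln (A + \<gamma>)"
    using assms \<gamma>_pos by auto
  then show ?thesis by (simp add: di_def diam_def)
qed

text \<open>Comes from \<open>1 - p / q \<le> ln (q / p)\<close> with
  \<open>q \<le> A + \<gamma>\<close>. It turns ordinary Lipschitz bounds into bounds in
  \<open>di\<close>, and contraction in \<open>di\<close> into ordinary convergence.\<close>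

lemma abs_diff_le_di:
  assumes "x \<in> {0..A}" "y \<in> {0..A}"
  shows "\<bar>x - y\<bar> \<le> (A + \<gamma>) * di x y"
proof -
  have *: "y - x \<le> (A + \<gamma>) * di x y" if "x \<in> {0..A}" "y \<in> {0..A}" "x \<le> y" for x y
  proof -
    have pos: "x + \<gamma> > 0" "y + \<gamma> > 0" using that \<gamma>_pos by auto
    have "ln ((x + \<gamma>) / (y + \<gamma>)) \<le> (x + \<gamma>) / (y + \<gamma>) - 1"
      using pos by (intro ln_le_minus_one) auto
    then have "1 - (x + \<gamma>) / (y + \<gamma>) \<le> di x y"
      using pos by (simp add: ln_div di_def)
    then have "(y + \<gamma>) * (1 - (x + \<gamma>) / (y + \<gamma>)) \<le> (y + \<gamma>) * di x y"
      using pos by (intro mult_left_mono) auto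
    moreover have "(y + \<gamma>) * (1 - (x + \<gamma>) / (y + \<gamma>)) = y - x"
      using pos by (simp add: field_simps)
    moreover have "(y + \<gamma>) * di x y \<le> (A + \<gamma>) * di x y"
      using that di_nonneg by (intro mult_right_mono) auto
    ultimately show ?thesis by linarith
  qed
  show ?thesis
    using *[of x y] *[of y x] assms di_commute[of x y] by (cases "x \<le> y") auto
qed

section \<open>The coefficients of the operator\<close>

lemma T_apply: "x \<in> {0..A} \<Longrightarrow> T f x = (\<Sum>b\<in>B. h b x * f (theta b x))"
  by (simp add: Lam_def h_def)

lemma h_pos: "b \<in> B \<Longrightarrow> x \<in> {0..A} \<Longrightarrow> h b x > 0"
  using g_pos[of b x] by (simp add: h_def)

lemma Cm_h: "b \<in> B \<Longrightarrow> Cm_on m A (h b)"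
  unfolding h_def by (intro Cm_on_powr Cm_g g_pos)

lemma Cm_theta: "b \<in> B \<Longrightarrow> Cm_on k A (theta b)"
  and Cm_\<theta>': "b \<in> B \<Longrightarrow> Cm_on k A (\<theta>' b)"
proof -
  assume b: "b \<in> B"
  have *: "Cm_on k A (\<lambda>x. inverse (x + b))"
    using B_ge[OF b] \<gamma>_pos by (intro Cm_on_inverse Cm_on_add_ident) auto
  then show "Cm_on k A (theta b)" by (simp add: theta_def[abs_def])
  show "Cm_on k A (\<theta>' b)"
    using Cm_on_cmult[OF Cm_on_power[OF *, of 2], of "-1"] by (simp add: \<theta>'_def[abs_def])
qed

lemma Cm_T:
  assumes "Cm_on m A f"
  shows "Cm_on m A (T f)"
proof (rule Cm_on_cong)
  show "Cm_on m A (\<lambda>x. \<Sum>b\<in>B. h b x * f (theta b x))"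
    using theta_mem theta_mem_open
    by (intro Cm_on_sum A_pos Cm_on_mult Cm_h Cm_on_compose[OF assms Cm_theta] image_subsetI)
qed (simp add: T_apply)

text \<open>Each \<open>h b\<close> is Lipschitz, as its derivative is bounded, and has a lower
  bound \<open>c b > 0\<close> by compactness. Hence
  \<open>h b x / h b y \<le> 1 + K b / c b * \<bar>x - y\<bar>\<close>, and
  \<open>1 + t \<le> exp t\<close>.\<close>

lemma ln_h_Lipschitz:
  obtains M where "M \<ge> 0"
    "\<And>b x y. b \<in> B \<Longrightarrow> x \<in> {0..A} \<Longrightarrow> y \<in> {0..A} \<Longrightarrow> h b x \<le> exp (M * di x y) * h b y"
proof -
  have "\<exists>M\<ge>0. \<forall>x\<in>{0..A}. \<forall>y\<in>{0..A}. \<bar>h b x - h b y\<bar> \<le> M * \<bar>x - y\<bar>" if b: "b \<in> B" for b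
  proof -
    have C: "Cm_on m A (h b)" by (rule Cm_h[OF b])
    have lt: "0 < m" using m_ge by simp
    obtain K where K: "\<And>x. x \<in> {0..A} \<Longrightarrow> \<bar>Dext A 1 (h b) x\<bar> \<le> K"
      using continuous_on_Icc_bounded[OF Cm_on_Dext(2)[OF A_pos C m_ge]] by blast
    have *: "\<bar>h b x - h b y\<bar> \<le> K * \<bar>x - y\<bar>" if xy: "x \<in> {0..A}" "y \<in> {0..A}" "x < y" for x y
    proof -
      have "\<exists>z. x < z \<and> z < y \<and> (h b has_real_derivative Dext A 1 (h b) z) (at z)
           \<and> h b y - h b x = (y - x) * Dext A 1 (h b) z"
      proof -
        have D: "(h b has_real_derivative Dext A 1 (h b) z) (at z)" if "x < z" "z < y" for z
        proof -
          have z: "z \<in> {0<..<A}" using that xy by auto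
          have "(Dext A 0 (h b) has_real_derivative Dext A 1 (h b) z) (at z)"
            using Cm_on_Dext(3)[OF A_pos C lt z] by simp
          then show ?thesis
            by (rule has_field_derivative_transform_within_open[of _ _ _ "{0<..<A}"])
              (use z Cm_on_Dext(1)[OF A_pos C] in auto)
        qed
        have "continuous_on {x..y} (h b)"
          by (rule continuous_on_subset[OF Cm_on_continuous[OF C]]) (use xy in auto)
        from MVT[OF xy(3) this] D obtain l z where
          z: "x < z" "z < y" "(h b has_real_derivative l) (at z)" "h b y - h b x = (y - x) * l"
          using real_differentiable_def by blast
        then show ?thesis using D[of z] DERIV_unique by blast
      qed
      then obtain z where z: "x < z" "z < y" "h b y - h b x = (y - x) * Dext A 1 (h b) z" by blast
      have "\<bar>h b y - h b x\<bar> \<le> \<bar>y - x\<bar> * K"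
        unfolding z(3) abs_mult using K[of z] z xy by (intro mult_left_mono) auto
      then show ?thesis by (simp add: abs_minus_commute mult.commute)
    qed
    have "K \<ge> 0" using K[of 0] A_pos by force
    moreover have "\<bar>h b x - h b y\<bar> \<le> K * \<bar>x - y\<bar>" if "x \<in> {0..A}" "y \<in> {0..A}" for x y
      using *[of x y] *[of y x] that by (cases x y rule: linorder_cases) (auto simp: abs_minus_commute)
    ultimately show ?thesis by blast
  qed
  then obtain K where K: "\<And>b. b \<in> B \<Longrightarrow> K b \<ge> 0"
    "\<And>b x y. b \<in> B \<Longrightarrow> x \<in> {0..A} \<Longrightarrow> y \<in> {0..A} \<Longrightarrow> \<bar>h b x - h b y\<bar> \<le> K b * \<bar>x - y\<bar>"
    by metis
  have "\<exists>c>0. \<forall>x\<in>{0..A}. c \<le> h b x" if b: "b \<in> B" for b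
  proof -
    have "\<exists>x\<in>{0..A}. \<forall>y\<in>{0..A}. h b x \<le> h b y"
      using A_pos Cm_on_continuous[OF Cm_h[OF b]] by (intro continuous_attains_inf) auto
    then show ?thesis using h_pos[OF b] by blast
  qed
  then obtain c where c: "\<And>b. b \<in> B \<Longrightarrow> c b > 0" "\<And>b x. b \<in> B \<Longrightarrow> x \<in> {0..A} \<Longrightarrow> c b \<le> h b x"
    by metis
  \<comment> \<open>A sum of nonnegative terms bounds each of them, so one \<open>M\<close> serves
    all branches.\<close>
  define M where "M = (\<Sum>b\<in>B. K b / c b * (A + \<gamma>))"
  have Mb: "K b / c b * (A + \<gamma>) \<le> M" "0 \<le> K b / c b" if "b \<in> B" for b
  proof -
    have nn: "0 \<le> K b / c b" if "b \<in> B" for b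
      using K(1)[OF that] c(1)[OF that] by simp
    then have "\<And>b. b \<in> B \<Longrightarrow> 0 \<le> K b / c b * (A + \<gamma>)"
      using A_pos \<gamma>_pos by (intro mult_nonneg_nonneg) auto
    then show "K b / c b * (A + \<gamma>) \<le> M" unfolding M_def
      by (intro member_le_sum that finite_B) auto
    show "0 \<le> K b / c b" using nn that .
  qed
  show ?thesis
  proof (rule that)
    show "M \<ge> 0" unfolding M_def using Mb(2) A_pos \<gamma>_pos by (intro sum_nonneg mult_nonneg_nonneg) auto
    fix b x y assume b: "b \<in> B" and x: "x \<in> {0..A}" and y: "y \<in> {0..A}"
    have "h b x \<le> h b y + K b * \<bar>x - y\<bar>" using K(2)[OF b x y] by linarith
    also have "K b * \<bar>x - y\<bar> = K b / c b * \<bar>x - y\<bar> * c b" using c(1)[OF b] by simp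
    also have "\<dots> \<le> K b / c b * \<bar>x - y\<bar> * h b y"
      using c(2)[OF b y] Mb(2)[OF b] by (intro mult_left_mono mult_nonneg_nonneg) auto
    also have "h b y + \<dots> = (1 + K b / c b * \<bar>x - y\<bar>) * h b y" by (simp add: algebra_simps)
    also have "\<dots> \<le> exp (M * di x y) * h b y"
    proof (rule mult_right_mono)
      have "K b / c b * \<bar>x - y\<bar> \<le> K b / c b * ((A + \<gamma>) * di x y)"
        by (intro mult_left_mono abs_diff_le_di x y Mb(2) b)
      also have "\<dots> = K b / c b * (A + \<gamma>) * di x y" by simp
      also have "\<dots> \<le> M * di x y" by (intro mult_right_mono Mb(1) b di_nonneg)
      finally show "1 + K b / c b * \<bar>x - y\<bar> \<le> exp (M * di x y)"
        using exp_ge_add_one_self[of "M * di x y"] by linarith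
    qed (use h_pos[OF b y] in simp)
    finally show "h b x \<le> exp (M * di x y) * h b y" by simp
  qed
qed

section \<open>Contraction of cones\<close>

text \<open>A positive \<open>f\<close> belongs to it iff \<open>ln f\<close> is
  \<open>L\<close>-Lipschitz for \<open>di\<close>; the multiplicative form admits the zero function
  as well.\<close>

definition cone :: "real \<Rightarrow> (real \<Rightarrow> real) set" where
  "cone L = {f. (\<forall>x\<in>{0..A}. 0 \<le> f x) \<and> (\<forall>x\<in>{0..A}. \<forall>y\<in>{0..A}. f x \<le> exp (L * di x y) * f y)}"

lemma coneD:
  assumes "f \<in> cone L" "x \<in> {0..A}" "y \<in> {0..A}"
  shows "0 \<le> f x" "f x \<le> exp (L * di x y) * f y"
  using assms by (auto simp: cone_def)

lemma cone_bound:
  assumes "f \<in> cone L" "0 \<le> L" "x \<in> {0..A}" "y \<in> {0..A}"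
  shows "f x \<le> exp (L * diam) * f y"
proof -
  have "exp (L * di x y) * f y \<le> exp (L * diam) * f y"
    using assms coneD(1)[OF assms(1,4,3)] di_le_diam by (intro mult_right_mono) (auto intro: mult_left_mono)
  then show ?thesis using coneD(2)[OF assms(1,3,4)] by linarith
qed

lemma cone_mono:
  assumes "f \<in> cone L" "L \<le> L'"
  shows "f \<in> cone L'"
proof -
  have "f x \<le> exp (L' * di x y) * f y" if "x \<in> {0..A}" "y \<in> {0..A}" for x y
  proof -
    have "exp (L * di x y) * f y \<le> exp (L' * di x y) * f y"
      using assms coneD(1)[OF assms(1) that(2,1)] di_nonneg
      by (intro mult_right_mono) (auto intro: mult_right_mono)
    then show ?thesis using coneD(2)[OF assms(1) that] by linarith
  qed
  then show ?thesis using assms(1) by (auto simp: cone_def)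
qed

text \<open>Passing to \<open>theta b\<close> contracts distances and so multiplies \<open>L\<close>
  by \<open>\<kappa>\<close>, the factor \<open>h b\<close> adds \<open>M\<close>, and the cone
  inequality survives summation over \<open>b\<close>.\<close>

lemma T_cone:
  assumes M: "\<And>b x y. b \<in> B \<Longrightarrow> x \<in> {0..A} \<Longrightarrow> y \<in> {0..A} \<Longrightarrow> h b x \<le> exp (M * di x y) * h b y"
    and f: "f \<in> cone L" and L: "0 \<le> L"
  shows "T f \<in> cone (\<kappa> * L + M)"
proof -
  have nn: "0 \<le> h b x * f (theta b x)" if "b \<in> B" "x \<in> {0..A}" for b x
    using h_pos[OF that] coneD(1)[OF f theta_mem[OF that] theta_mem[OF that]] by simp
  have "T f x \<le> exp ((\<kappa> * L + M) * di x y) * T f y" if x: "x \<in> {0..A}" and y: "y \<in> {0..A}" for x y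
  proof -
    have "h b x * f (theta b x) \<le> exp ((\<kappa> * L + M) * di x y) * (h b y * f (theta b y))" if b: "b \<in> B" for b
    proof -
      note th = theta_mem[OF b x] theta_mem[OF b y]
      have "L * di (theta b x) (theta b y) \<le> L * (\<kappa> * di x y)"
        using x y by (intro mult_left_mono di_theta b L) auto
      then have "exp (L * di (theta b x) (theta b y)) * f (theta b y) \<le> exp (L * (\<kappa> * di x y)) * f (theta b y)"
        using coneD(1)[OF f th(2,1)] by (intro mult_right_mono) auto
      with coneD(2)[OF f th] have "f (theta b x) \<le> exp (L * (\<kappa> * di x y)) * f (theta b y)" by linarith
      then have "h b x * f (theta b x)
          \<le> (exp (M * di x y) * h b y) * (exp (L * (\<kappa> * di x y)) * f (theta b y))"
        using M[OF b x y] h_pos[OF b x] h_pos[OF b y] coneD(1)[OF f th] by (intro mult_mono) auto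
      also have "\<dots> = exp ((\<kappa> * L + M) * di x y) * (h b y * f (theta b y))"
        by (simp add: exp_add algebra_simps)
      finally show ?thesis .
    qed
    then show ?thesis using x y by (simp add: T_apply sum_distrib_left sum_mono)
  qed
  then show ?thesis using nn by (auto simp: cone_def T_apply intro!: sum_nonneg)
qed

text \<open>\<open>gap L\<close> bounds \<open>(exp (L d) - exp (- (L - 1) d)) / (exp (L d) - exp ((L - 1) d))\<close> over
  \<open>0 < d \<le> diam\<close>: this is how much larger \<open>G\<close> must be than \<open>\<eta> u\<close> for the difference of two
  functions in the small cone to stay in the large one.\<close>

definition gap :: "real \<Rightarrow> real" where "gap L = (2 * L - 1) * exp (L * diam)"

lemma diam_nonneg: "diam \<ge> 0"
  by (simp add: diam_def di_nonneg)

lemma gap_ge_1: "L \<ge> 1 \<Longrightarrow> gap L \<ge> 1"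
  using mult_mono[of 1 "2 * L - 1" 1 "exp (L * diam)"] diam_nonneg by (simp add: gap_def)

text \<open>The extreme case is \<open>G x = exp ((L - 1) d) G y\<close> with
  \<open>u x = exp (- (L - 1) d) u y\<close>. It requires \<open>\<eta> (exp (L d) - exp (- (L - 1)
  d)) u y \<le> (exp (L d) - exp ((L - 1) d)) G y\<close>. By \<open>e2\<close> the left side is at
  most \<open>\<eta> gap L d u y\<close>, and by \<open>e1\<close> the right side is at least
  \<open>d G y\<close>.\<close>

lemma cone_diff:
  assumes G: "G \<in> cone (L - 1)" and u: "u \<in> cone (L - 1)" and L: "L \<ge> 1" and \<eta>: "\<eta> \<ge> 0"
    and le: "\<And>y. y \<in> {0..A} \<Longrightarrow> \<eta> * gap L * u y \<le> G y"
  shows "(\<lambda>x. G x - \<eta> * u x) \<in> cone L"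
proof -
  have "0 \<le> G x - \<eta> * u x" if x: "x \<in> {0..A}" for x
  proof -
    have "\<eta> * u x * 1 \<le> \<eta> * u x * gap L"
      using coneD(1)[OF u x x] \<eta> gap_ge_1[OF L] by (intro mult_left_mono) auto
    then show ?thesis using le[OF x] by (simp add: mult_ac)
  qed
  moreover have "G x - \<eta> * u x \<le> exp (L * di x y) * (G y - \<eta> * u y)"
    if x: "x \<in> {0..A}" and y: "y \<in> {0..A}" for x y
  proof -
    define d where "d = di x y"
    have d: "d \<ge> 0" "d \<le> diam" "di y x = d" using di_nonneg di_le_diam x y di_commute by (auto simp: d_def)
    have Gy: "G y \<ge> 0" and uy: "u y \<ge> 0" using coneD(1) G u x y by blast+
    have e1: "d \<le> exp (L * d) - exp ((L - 1) * d)"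
    proof -
      have "d \<le> 1 * (exp d - 1)"
        using exp_ge_add_one_self[of d] by (simp only: mult_1 le_diff_eq add.commute)
      also have "\<dots> \<le> exp ((L - 1) * d) * (exp d - 1)" using d L by (intro mult_right_mono) auto
      also have "\<dots> = exp (L * d) - exp ((L - 1) * d)"
        by (simp add: algebra_simps flip: exp_add)
      finally show ?thesis .
    qed
    have e2: "exp (L * d) - exp (- ((L - 1) * d)) \<le> gap L * d"
    proof -
      have "exp (L * d) - exp (- ((L - 1) * d)) = exp (L * d) * (1 - exp (- ((2 * L - 1) * d)))"
        by (simp add: algebra_simps flip: exp_add)
      also have "\<dots> \<le> exp (L * d) * ((2 * L - 1) * d)"
        using exp_ge_add_one_self[of "- ((2 * L - 1) * d)"] by (intro mult_left_mono) auto
      also have "\<dots> \<le> exp (L * diam) * ((2 * L - 1) * d)"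
        using d L by (intro mult_right_mono) (auto intro: mult_left_mono)
      finally show ?thesis by (simp add: gap_def mult_ac)
    qed
    have G1: "G x \<le> exp ((L - 1) * d) * G y" using coneD(2)[OF G x y] by (simp add: d_def)
    have "u y \<le> exp ((L - 1) * d) * u x" using coneD(2)[OF u y x] d by simp
    then have "exp (- ((L - 1) * d)) * u y \<le> exp (- ((L - 1) * d)) * (exp ((L - 1) * d) * u x)"
      by (intro mult_left_mono) auto
    then have u1: "exp (- ((L - 1) * d)) * u y \<le> u x"
      by (simp only: exp_minus mult.assoc[symmetric] left_inverse[OF exp_not_eq_zero] mult_1)
    have "\<eta> * ((exp (L * d) - exp (- ((L - 1) * d))) * u y) \<le> \<eta> * (gap L * d * u y)"
      using e2 uy \<eta> by (intro mult_left_mono mult_right_mono)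
    also have "\<dots> = d * (\<eta> * gap L * u y)" by simp
    also have "\<dots> \<le> d * G y" by (intro mult_left_mono le y d)
    also have "\<dots> \<le> (exp (L * d) - exp ((L - 1) * d)) * G y" using e1 Gy by (intro mult_right_mono)
    finally have "exp ((L - 1) * d) * G y - \<eta> * (exp (- ((L - 1) * d)) * u y)
        \<le> exp (L * d) * (G y - \<eta> * u y)"
      by (simp add: algebra_simps)
    moreover have "\<eta> * (exp (- ((L - 1) * d)) * u y) \<le> \<eta> * u x" using u1 \<eta> by (intro mult_left_mono)
    ultimately show ?thesis using G1 unfolding d_def[symmetric] by linarith
  qed
  ultimately show ?thesis by (auto simp: cone_def)
qed

lemma T_diff: "T (\<lambda>x. c * f x - d * k x) = (\<lambda>x. c * T f x - d * T k x)"
  by (auto simp: Lam_def fun_eq_iff algebra_simps sum_subtractf sum_distrib_left)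

text \<open>\<open>T f - a T u\<close> and \<open>b T u - T f\<close> lie in the small cone and add up to \<open>(b - a) T u\<close>, so one of
  them is at least half of that at the point \<open>0\<close>, hence comparable to it everywhere; then a fixed
  fraction of \<open>(b - a) T u\<close> can be subtracted from it.\<close>

lemma cone_contraction:
  assumes TL: "\<And>f. f \<in> cone L \<Longrightarrow> T f \<in> cone (L - 1)" and L: "L \<ge> 1"
    and u: "u \<in> cone (L - 1)" and ab: "a \<le> b"
    and fa: "(\<lambda>x. f x - a * u x) \<in> cone L" and fb: "(\<lambda>x. b * u x - f x) \<in> cone L"
  defines "\<eta> \<equiv> exp (- 2 * ((L - 1) * diam)) / (2 * gap L)"
  obtains a' b' where "a \<le> a'" "a' \<le> b'" "b' \<le> b" "b' - a' \<le> (1 - \<eta>) * (b - a)"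
    "(\<lambda>x. T f x - a' * T u x) \<in> cone L" "(\<lambda>x. b' * T u x - T f x) \<in> cone L"
proof -
  have \<eta>: "0 < \<eta>" "\<eta> \<le> 1"
  proof -
    have "exp (- 2 * ((L - 1) * diam)) \<le> 1" using L diam_nonneg by simp
    then have "exp (- 2 * ((L - 1) * diam)) \<le> 2 * gap L" using gap_ge_1[OF L] by linarith
    then show "0 < \<eta>" "\<eta> \<le> 1" using gap_ge_1[OF L] by (simp_all add: \<eta>_def)
  qed
  have G: "T (\<lambda>x. f x - a * u x) = (\<lambda>x. T f x - a * T u x)" using T_diff[of 1 f a u] by simp
  have H: "T (\<lambda>x. b * u x - f x) = (\<lambda>x. b * T u x - T f x)" using T_diff[of b u 1 f] by simp
  have Gc: "(\<lambda>x. T f x - a * T u x) \<in> cone (L - 1)" using TL[OF fa] G by simp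
  have Hc: "(\<lambda>x. b * T u x - T f x) \<in> cone (L - 1)" using TL[OF fb] H by simp
  have uc: "T u \<in> cone (L - 1)" using TL[OF cone_mono[OF u]] by simp
  define t where "t = b - a"
  have t: "t \<ge> 0" using ab by (simp add: t_def)
  have key: "(\<lambda>x. F x - \<eta> * t * T u x) \<in> cone L"
    if F: "F \<in> cone (L - 1)" and half: "F 0 \<ge> t / 2 * T u 0" for F
  proof (rule cone_diff[OF F uc L])
    show "0 \<le> \<eta> * t" using \<eta> t by simp
    fix y assume y: "y \<in> {0..A}"
    have 0: "(0::real) \<in> {0..A}" using A_pos by simp
    have L': "0 \<le> L - 1" using L by simp
    \<comment> \<open>\<open>E\<close> bounds the variation of a function of the small cone over the
      whole interval. Both \<open>T u\<close> and \<open>F\<close> are compared with their values at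
      0, which costs \<open>E\<close> twice and explains the exponential in \<open>\<eta>\<close>;
      the 2 in its denominator comes from \<open>half\<close>, and \<open>gap L\<close> from
      \<open>cone_diff\<close>.\<close>
    define E where "E = exp ((L - 1) * diam)"
    have E: "E > 0" "exp (- 2 * ((L - 1) * diam)) = 1 / E / E"
      using exp_add[of "- ((L - 1) * diam)" "- ((L - 1) * diam)"]
      by (auto simp: E_def exp_minus divide_inverse)
    have "\<eta> * t * gap L * T u y = 1 / E / E * (t / 2) * T u y"
      using gap_ge_1[OF L] E by (simp add: \<eta>_def)
    also have "\<dots> \<le> 1 / E / E * (t / 2) * (E * T u 0)"
      using cone_bound[OF uc L' y 0] E t by (intro mult_left_mono) (auto simp: E_def)
    also have "\<dots> = 1 / E * (t / 2 * T u 0)" using E by simp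
    also have "\<dots> \<le> 1 / E * F 0" using half E by (intro mult_left_mono) auto
    also have "\<dots> \<le> 1 / E * (E * F y)"
      using cone_bound[OF F L' 0 y] E by (intro mult_left_mono) (auto simp: E_def)
    finally show "\<eta> * t * gap L * T u y \<le> F y" using E by simp
  qed
  have sum: "(T f 0 - a * T u 0) + (b * T u 0 - T f 0) = t * T u 0" by (simp add: t_def algebra_simps)
  have \<eta>t: "0 \<le> \<eta> * t" "\<eta> * t \<le> t" using \<eta> t by (auto simp: mult_left_le_one_le)
  show ?thesis
  \<comment> \<open>The interval \<open>[a, b]\<close> shrinks by \<open>\<eta> * t\<close> at its
    lower end in the first case and at its upper end in the other.\<close>
  proof (cases "T f 0 - a * T u 0 \<ge> t / 2 * T u 0")
    case True
    show ?thesis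
    proof (rule that[of "a + \<eta> * t" b])
      show "(\<lambda>x. T f x - (a + \<eta> * t) * T u x) \<in> cone L"
        using key[OF Gc] True by (simp add: algebra_simps)
      show "(\<lambda>x. b * T u x - T f x) \<in> cone L" by (rule cone_mono[OF Hc]) simp
    qed (use \<eta>t in \<open>auto simp: t_def algebra_simps\<close>)
  next
    case False
    then have "b * T u 0 - T f 0 \<ge> t / 2 * T u 0" using sum by (simp add: field_simps)
    from key[OF Hc this] have *: "(\<lambda>x. b * T u x - T f x - \<eta> * t * T u x) \<in> cone L" .
    show ?thesis
    proof (rule that[of a "b - \<eta> * t"])
      show "(\<lambda>x. (b - \<eta> * t) * T u x - T f x) \<in> cone L"
        using * by (simp add: algebra_simps)
      show "(\<lambda>x. T f x - a * T u x) \<in> cone L" by (rule cone_mono[OF Gc]) simp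
    qed (use \<eta>t in \<open>auto simp: t_def algebra_simps\<close>)
  qed
qed

section \<open>Growth of the iterates of the constant function 1\<close>

definition one :: "real \<Rightarrow> real" where "one x = (if x \<in> {0..A} then 1 else 0)"

definition u :: "nat \<Rightarrow> real \<Rightarrow> real" where "u n = (T ^^ n) one"

lemma u_0: "x \<in> {0..A} \<Longrightarrow> u 0 x = 1" and u_Suc: "u (Suc n) = T (u n)"
  by (auto simp: u_def one_def)

lemma T_pos:
  assumes "\<And>x. x \<in> {0..A} \<Longrightarrow> f x > 0" "x \<in> {0..A}"
  shows "T f x > 0"
  using assms h_pos theta_mem B_ne finite_B by (auto simp: T_apply intro!: sum_pos)

lemma u_pos: "x \<in> {0..A} \<Longrightarrow> u n x > 0"
  by (induction n arbitrary: x) (auto simp: u_0 u_Suc intro!: T_pos)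

text \<open>\<open>cone_contraction\<close> is iterated along the pairs \<open>u (Suc n)\<close>,
  \<open>u n\<close>. Each step shortens \<open>[a n, b n]\<close> by a fixed factor, and
  nonnegativity of cone elements turns membership into the two pointwise bounds.\<close>

lemma ratio_bounds:
  "\<exists>(a :: nat \<Rightarrow> real) b \<rho>. 0 < \<rho> \<and> \<rho> < 1 \<and> incseq a \<and> decseq b \<and>
    (\<forall>n. 0 < a n \<and> a n \<le> b n \<and> b n - a n \<le> \<rho> ^ n * (b 0 - a 0) \<and>
      (\<forall>x\<in>{0..A}. a n * u n x \<le> u (Suc n) x \<and> u (Suc n) x \<le> b n * u n x))"
proof -
  obtain M where M: "M \<ge> 0"
    "\<And>b x y. b \<in> B \<Longrightarrow> x \<in> {0..A} \<Longrightarrow> y \<in> {0..A} \<Longrightarrow> h b x \<le> exp (M * di x y) * h b y"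
    using ln_h_Lipschitz by blast
  \<comment> \<open>The solution of \<open>\<kappa> * L + M = L - 1\<close>, so that
    \<open>T_cone\<close> leads from the constant \<open>L\<close> to \<open>L - 1\<close>.\<close>
  define L where "L = (M + 1) / (1 - \<kappa>)"
  have \<kappa>: "1 - \<kappa> > 0" using \<kappa>_less_1 by simp
  have Leq: "\<kappa> * L + M = L - 1" using \<kappa> by (simp add: L_def field_simps)
  have L: "L \<ge> 1"
  proof -
    have "1 * (1 - \<kappa>) \<le> M + 1" using M \<kappa>_pos by simp
    then show ?thesis using \<kappa> by (simp add: L_def pos_le_divide_eq)
  qed
  have TL: "T f \<in> cone (L - 1)" if "f \<in> cone L" for f
    using T_cone[OF M(2) that] L Leq by simp
  have one: "one \<in> cone (L - 1)" using L di_nonneg by (auto simp: cone_def one_def)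
  have uc: "u n \<in> cone (L - 1)" for n
    by (induction n) (auto simp: u_Suc one u_def[of 0] intro!: TL cone_mono[of _ "L - 1" L])
  define \<eta> where "\<eta> = exp (- 2 * ((L - 1) * diam)) / (2 * gap L)"
  have \<eta>: "0 < \<eta>" "\<eta> < 1"
  proof -
    have "exp (- 2 * ((L - 1) * diam)) \<le> 1" using L diam_nonneg by simp
    then have "exp (- 2 * ((L - 1) * diam)) < 2 * gap L" using gap_ge_1[OF L] by linarith
    then show "0 < \<eta>" "\<eta> < 1" using gap_ge_1[OF L] by (simp_all add: \<eta>_def)
  qed
  \<comment> \<open>\<open>P\<close> keeps cone membership and not only the inequalities that follow
    from it, since \<open>cone_contraction\<close> takes membership as a hypothesis;
    \<open>Q\<close> records nesting and shrinking.\<close>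
  define P where "P n ab \<longleftrightarrow> 0 < fst ab \<and> fst ab \<le> snd ab \<and>
      (\<lambda>x. u (Suc n) x - fst ab * u n x) \<in> cone L \<and> (\<lambda>x. snd ab * u n x - u (Suc n) x) \<in> cone L"
    for n and ab :: "real \<times> real"
  define Q where "Q ab ab' \<longleftrightarrow> fst ab \<le> fst ab' \<and> snd ab' \<le> snd ab \<and>
      snd ab' - fst ab' \<le> (1 - \<eta>) * (snd ab - fst ab)" for ab ab' :: "real \<times> real"
  have 0: "(0::real) \<in> {0..A}" using A_pos by simp
  define E where "E = exp ((L - 1) * diam)"
  have E: "E \<ge> 1" using L diam_nonneg by (simp add: E_def)
  have L': "0 \<le> L - 1" using L by simp
  have R: "gap L \<ge> 1" by (rule gap_ge_1[OF L])
  \<comment> \<open>As \<open>u 0\<close> is 1 and \<open>u 1\<close> varies at most by the factor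
    \<open>E\<close>, these values give \<open>a0 * gap L * u 0 \<le> u 1\<close> and
    \<open>gap L * u 1 \<le> b0 * u 0\<close>, which is what \<open>cone_diff\<close> asks
    for.\<close>
  define a0 where "a0 = u 1 0 / E / gap L"
  define b0 where "b0 = gap L * (E * u 1 0)"
  have u10: "u 1 0 > 0" by (rule u_pos[OF 0])
  have ab0: "0 < a0" "a0 \<le> b0"
  proof -
    show "0 < a0" using E R u10 by (simp add: a0_def)
    have "u 1 0 / E \<le> u 1 0" using E u10 by (simp add: divide_le_eq)
    moreover have "u 1 0 / E / gap L \<le> u 1 0 / E" using E R u10 by (simp add: divide_le_eq)
    moreover have "u 1 0 \<le> E * u 1 0" using E u10 by simp
    moreover have "E * u 1 0 \<le> gap L * (E * u 1 0)" using E R u10 by simp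
    ultimately show "a0 \<le> b0" unfolding a0_def b0_def by linarith
  qed
  have P0: "P 0 (a0, b0)"
  proof -
    have "(\<lambda>x. u 1 x - a0 * u 0 x) \<in> cone L"
    proof (rule cone_diff[OF uc uc L])
      fix y assume y: "y \<in> {0..A}"
      have "u 1 0 \<le> E * u 1 y" unfolding E_def by (rule cone_bound[OF uc L' 0 y])
      then show "a0 * gap L * u 0 y \<le> u 1 y"
        using y E R by (simp add: a0_def u_0 field_simps)
    qed (use ab0 in auto)
    moreover have "(\<lambda>x. b0 * u 0 x - 1 * u 1 x) \<in> cone L"
    proof (rule cone_diff[OF _ uc L])
      show "(\<lambda>x. b0 * u 0 x) \<in> cone (L - 1)"
        using uc[of 0] ab0 by (auto simp: cone_def mult.left_commute)
      fix y assume y: "y \<in> {0..A}"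
      have "u 1 y \<le> E * u 1 0" unfolding E_def by (rule cone_bound[OF uc L' y 0])
      then show "1 * gap L * u 1 y \<le> b0 * u 0 y"
        using y R by (simp add: b0_def u_0)
    qed auto
    ultimately show ?thesis using ab0 by (simp add: P_def)
  qed
  have step: "\<exists>ab'. P (Suc n) ab' \<and> Q ab ab'" if "P n ab" for n ab
  proof -
    have ab: "0 < fst ab" "fst ab \<le> snd ab" "(\<lambda>x. u (Suc n) x - fst ab * u n x) \<in> cone L"
      "(\<lambda>x. snd ab * u n x - u (Suc n) x) \<in> cone L"
      using that by (auto simp: P_def)
    obtain a' b' where "fst ab \<le> a'" "a' \<le> b'" "b' \<le> snd ab" "b' - a' \<le> (1 - \<eta>) * (snd ab - fst ab)"
      "(\<lambda>x. T (u (Suc n)) x - a' * T (u n) x) \<in> cone L" "(\<lambda>x. b' * T (u n) x - T (u (Suc n)) x) \<in> cone L"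
      using cone_contraction[OF TL L uc ab(2-4)] unfolding \<eta>_def by blast
    then show ?thesis using ab(1)
      by (intro exI[of _ "(a', b')"]) (auto simp: P_def Q_def u_Suc)
  qed
  obtain ab where ab: "ab 0 = (a0, b0)" "\<And>n. P n (ab n)" "\<And>n. Q (ab n) (ab (Suc n))"
  proof -
    have "\<exists>f. \<forall>n. (P n (f n) \<and> (n = 0 \<longrightarrow> f n = (a0, b0))) \<and> Q (f n) (f (Suc n))"
      by (rule dependent_nat_choice) (use P0 step in auto)
    then show ?thesis using that by blast
  qed
  show ?thesis
  proof (rule exI[of _ "\<lambda>n. fst (ab n)"], rule exI[of _ "\<lambda>n. snd (ab n)"],
      rule exI[of _ "1 - \<eta>"], intro conjI allI ballI)
    show "incseq (\<lambda>n. fst (ab n))" "decseq (\<lambda>n. snd (ab n))"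
      using ab(3) by (auto simp: Q_def incseq_Suc_iff decseq_Suc_iff)
    show "snd (ab n) - fst (ab n) \<le> (1 - \<eta>) ^ n * (snd (ab 0) - fst (ab 0))" for n
    proof (induction n)
      case (Suc n)
      have "snd (ab (Suc n)) - fst (ab (Suc n)) \<le> (1 - \<eta>) * (snd (ab n) - fst (ab n))"
        using ab(3)[of n] by (simp add: Q_def)
      also have "\<dots> \<le> (1 - \<eta>) * ((1 - \<eta>) ^ n * (snd (ab 0) - fst (ab 0)))"
        using Suc \<eta> by (intro mult_left_mono) auto
      finally show ?case by (simp add: mult_ac)
    qed simp
    show "fst (ab n) * u n x \<le> u (Suc n) x" "u (Suc n) x \<le> snd (ab n) * u n x"
      if x: "x \<in> {0..A}" for n x
      using ab(2)[of n] coneD(1)[OF _ x x] by (force simp: P_def)+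
  qed (use \<eta> ab(2) in \<open>auto simp: P_def\<close>)
qed

text \<open>The ratio \<open>u (Suc n) / u n\<close> and \<open>lam\<close> lie in a common interval
  of length at most \<open>\<rho> ^ n * t\<close>. So \<open>ln (u n / lam ^ n)\<close> changes by
  summable amounts and stays bounded, which shows that the growth is exactly of order
  \<open>lam ^ n\<close>.\<close>

lemma leading_growth:
  "\<exists>lam \<rho> C :: real. lam > 0 \<and> 0 < \<rho> \<and> \<rho> < 1 \<and> C > 0 \<and>
    (\<forall>n. \<forall>x\<in>{0..A}. inverse C \<le> u n x / lam ^ n \<and> u n x / lam ^ n \<le> C \<and>
      \<bar>u (Suc n) x - lam * u n x\<bar> \<le> C * (lam * \<rho>) ^ n)"
proof -
  obtain a b :: "nat \<Rightarrow> real" and \<rho> where R: "0 < \<rho> \<and> \<rho> < 1 \<and> incseq a \<and> decseq b \<and>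
    (\<forall>n. 0 < a n \<and> a n \<le> b n \<and> b n - a n \<le> \<rho> ^ n * (b 0 - a 0) \<and>
      (\<forall>x\<in>{0..A}. a n * u n x \<le> u (Suc n) x \<and> u (Suc n) x \<le> b n * u n x))"
    using ratio_bounds by blast
  then have r: "0 < \<rho>" "\<rho> < 1" "\<And>n. 0 < a n" "\<And>n. a n \<le> b n"
    "incseq a" "decseq b" "\<And>n. b n - a n \<le> \<rho> ^ n * (b 0 - a 0)"
    "\<And>n x. x \<in> {0..A} \<Longrightarrow> a n * u n x \<le> u (Suc n) x"
    "\<And>n x. x \<in> {0..A} \<Longrightarrow> u (Suc n) x \<le> b n * u n x"
    by auto
  have ab: "a k \<le> b n" for k n
    using r(4)[of "max k n"] incseqD[OF r(5), of k "max k n"] decseqD[OF r(6), of n "max k n"] by simp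
  \<comment> \<open>The point common to all the nested intervals: the supremum of the lower ends
    lies below every upper end by \<open>ab\<close>.\<close>
  define lam where "lam = (SUP n. a n)"
  have bdd: "bdd_above (range a)" using ab[of _ 0] by (intro bdd_aboveI2)
  have lam: "a n \<le> lam" "lam \<le> b n" for n
    unfolding lam_def using cSUP_upper[OF _ bdd] cSUP_least[of UNIV a] ab by auto
  have lam0: "lam > 0" using lam(1)[of 0] r(3)[of 0] by simp
  define t where "t = b 0 - a 0"
  have t: "t \<ge> 0" using r(4)[of 0] by (simp add: t_def)
  define q where "q n x = u (Suc n) x / u n x" for n x
  have q: "a n \<le> q n x" "q n x \<le> b n" if "x \<in> {0..A}" for n x
    using r(8,9)[OF that, of n] u_pos[OF that, of n] by (simp_all add: q_def field_simps)
  have ql: "\<bar>q n x - lam\<bar> \<le> \<rho> ^ n * t" if "x \<in> {0..A}" for n x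
    using q[OF that, of n] lam[of n] r(7)[of n] unfolding t_def by linarith
  \<comment> \<open>Total of the geometric series of the increments
    \<open>\<rho> ^ k * t / a 0\<close> of the logarithm; the divisor \<open>a 0\<close> is a lower
    bound for all ratios and for \<open>lam\<close>.\<close>
  define c where "c = t / a 0 / (1 - \<rho>)"
  have lnb: "\<bar>ln (u n x / lam ^ n)\<bar> \<le> c" if x: "x \<in> {0..A}" for n x
  proof -
    have "\<bar>ln (u n x / lam ^ n)\<bar> \<le> (\<Sum>k<n. \<rho> ^ k * t / a 0)"
    proof (induction n)
      case (Suc n)
      have "u (Suc n) x / lam ^ Suc n = (u n x / lam ^ n) * (q n x / lam)"
        using u_pos[OF x, of n] by (simp add: q_def)
      moreover have "q n x > 0" using u_pos[OF x] by (simp add: q_def)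
      ultimately have "ln (u (Suc n) x / lam ^ Suc n) = ln (u n x / lam ^ n) + (ln (q n x) - ln lam)"
        using u_pos[OF x, of n] lam0 by (simp add: ln_mult ln_div)
      moreover have "\<bar>ln (q n x) - ln lam\<bar> \<le> \<rho> ^ n * t / a 0"
      proof -
        have "\<bar>ln (q n x) - ln lam\<bar> \<le> \<bar>q n x - lam\<bar> / a 0"
          using q(1)[OF x, of n] incseqD[OF r(5), of 0 n] lam(1)[of 0] r(3)[of 0]
          by (intro ln_diff_le) auto
        also have "\<dots> \<le> \<rho> ^ n * t / a 0" using ql[OF x, of n] r(3)[of 0] by (intro divide_right_mono) auto
        finally show ?thesis .
      qed
      ultimately show ?case using Suc by simp
    qed (use x in \<open>simp add: u_0\<close>)
    also have "\<dots> = (\<Sum>k<n. \<rho> ^ k) * (t / a 0)"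
      by (simp add: sum_distrib_right sum_divide_distrib)
    also have "\<dots> \<le> (1 / (1 - \<rho>)) * (t / a 0)"
    proof (rule mult_right_mono)
      have "(\<Sum>k<n. \<rho> ^ k) \<le> (\<Sum>k. \<rho> ^ k)"
        by (rule sum_le_suminf) (use r in \<open>auto intro: summable_geometric\<close>)
      then show "(\<Sum>k<n. \<rho> ^ k) \<le> 1 / (1 - \<rho>)" using suminf_geometric[of \<rho>] r by simp
    qed (use t r(3)[of 0] in auto)
    finally show ?thesis by (simp add: c_def mult.commute)
  qed
  have pos: "u n x / lam ^ n > 0" if "x \<in> {0..A}" for n x
    using u_pos[OF that, of n] lam0 by simp
  have up: "u n x / lam ^ n \<le> exp c" and lo: "exp (- c) \<le> u n x / lam ^ n" if "x \<in> {0..A}" for n x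
  proof -
    have "- c \<le> ln (u n x / lam ^ n)" "ln (u n x / lam ^ n) \<le> c" using lnb[OF that, of n] by auto
    then have "exp (- c) \<le> exp (ln (u n x / lam ^ n))" "exp (ln (u n x / lam ^ n)) \<le> exp c"
      by (simp_all only: exp_le_cancel_iff)
    then show "u n x / lam ^ n \<le> exp c" "exp (- c) \<le> u n x / lam ^ n"
      by (simp_all only: exp_ln[OF pos[OF that, of n]])
  qed
  \<comment> \<open>One constant for all bounds: the size of \<open>u n\<close> needs
    \<open>exp c\<close>, the residual \<open>u (Suc n) - lam * u n\<close> needs
    \<open>exp c * t\<close>.\<close>
  define C where "C = exp c * (t + 1)"
  have C: "exp c \<le> C" "exp c * t \<le> C" "C > 0" using t by (auto simp: C_def add_nonneg_pos)
  show ?thesis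
  proof (rule exI[of _ lam], rule exI[of _ \<rho>], rule exI[of _ C],
      intro conjI allI ballI lam0 r(1,2) C(3))
    fix n x assume x: "x \<in> {0..A}"
    show "u n x / lam ^ n \<le> C" using up[OF x, of n] C by linarith
    have "inverse C \<le> inverse (exp c)" using C by (intro le_imp_inverse_le) auto
    then show "inverse C \<le> u n x / lam ^ n" using lo[OF x, of n] by (simp add: exp_minus)
    have "u (Suc n) x - lam * u n x = u n x * (q n x - lam)"
      using u_pos[OF x, of n] by (simp add: q_def field_simps)
    then have "\<bar>u (Suc n) x - lam * u n x\<bar> = u n x * \<bar>q n x - lam\<bar>"
      using u_pos[OF x, of n] by (simp add: abs_mult)
    also have "\<dots> \<le> (exp c * lam ^ n) * (\<rho> ^ n * t)"
      using up[OF x, of n] ql[OF x, of n] lam0 u_pos[OF x, of n]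
      by (intro mult_mono) (auto simp: field_simps)
    also have "\<dots> = (exp c * t) * (lam * \<rho>) ^ n" by (simp add: power_mult_distrib)
    also have "\<dots> \<le> C * (lam * \<rho>) ^ n" using C lam0 r(1) by (intro mult_right_mono) auto
    finally show "\<bar>u (Suc n) x - lam * u n x\<bar> \<le> C * (lam * \<rho>) ^ n" .
  qed
qed

section \<open>Bounds on derivatives\<close>

lemma Cm_branch:
  assumes "b \<in> B" "Cm_on k A p" "Cm_on k A f"
  shows "Cm_on k A (\<lambda>y. p y * f (theta b y))"
  using theta_mem[OF assms(1)] theta_mem_open[OF assms(1)]
  by (intro Cm_on_mult assms(2) Cm_on_compose[OF assms(3) Cm_theta[OF assms(1)]] image_subsetI)

text \<open>Only the leading coefficient of the chain rule for \<open>D\<^sup>j (p \<cdot> f \<circ> \<theta>\<^sub>b)\<close> is needed explicitly,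
  which avoids Faa di Bruno's formula.\<close>

definition branch_coeffs :: "real \<Rightarrow> (real \<Rightarrow> real) \<Rightarrow> nat \<Rightarrow> (nat \<Rightarrow> real \<Rightarrow> real) \<Rightarrow> bool" where
  "branch_coeffs b p j c \<longleftrightarrow>
    (\<forall>i\<le>j. Cm_on (m - j) A (c i)) \<and> (\<forall>x\<in>{0..A}. c j x = p x * \<theta>' b x ^ j) \<and>
    (\<forall>f. Cm_on m A f \<longrightarrow> (\<forall>x\<in>{0..A}.
       Dext A j (\<lambda>y. p y * f (theta b y)) x = (\<Sum>i\<le>j. c i x * Dext A i f (theta b x))))"

lemma branch_coeffsD:
  assumes "branch_coeffs b p j c"
  shows "i \<le> j \<Longrightarrow> Cm_on (m - j) A (c i)"
    and "x \<in> {0..A} \<Longrightarrow> c j x = p x * \<theta>' b x ^ j"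
    and "Cm_on m A f \<Longrightarrow> x \<in> {0..A} \<Longrightarrow>
       Dext A j (\<lambda>y. p y * f (theta b y)) x = (\<Sum>i\<le>j. c i x * Dext A i f (theta b x))"
  using assms unfolding branch_coeffs_def by auto

text \<open>The expansion is differentiated once more at each step. This differentiates the
  coefficients too and uses up one order of their smoothness, which is why they are only of order
  \<open>m - j\<close>.\<close>

lemma branch_coeffs_exist:
  assumes b: "b \<in> B" and p: "Cm_on m A p" and "j \<le> m"
  shows "\<exists>c. branch_coeffs b p j c"
  using \<open>j \<le> m\<close>
proof (induction j)
  case 0
  have "Dext A 0 (\<lambda>y. p y * f (theta b y)) x = p x * Dext A 0 f (theta b x)"
    if "Cm_on m A f" "x \<in> {0..A}" for f x
    using Cm_on_Dext(1)[OF A_pos Cm_branch[OF b p that(1)] that(2)]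
      Cm_on_Dext(1)[OF A_pos that(1) theta_mem[OF b that(2)]] by simp
  then show ?case using p by (intro exI[of _ "\<lambda>_. p"]) (auto simp: branch_coeffs_def)
next
  case (Suc j)
  then obtain c where "branch_coeffs b p j c" by auto
  note c = branch_coeffsD[OF this]
  have mj: "m - j = Suc (m - Suc j)" using Suc.prems by simp
  have "\<forall>i. \<exists>c'. i \<le> j \<longrightarrow> Cm_on (m - Suc j) A c' \<and>
      (\<forall>x\<in>{0<..<A}. (c i has_real_derivative c' x) (at x))"
    using Cm_on_SucD c(1) mj by metis
  then obtain c' where c': "\<And>i. i \<le> j \<Longrightarrow> Cm_on (m - Suc j) A (c' i)"
    "\<And>i x. i \<le> j \<Longrightarrow> x \<in> {0<..<A} \<Longrightarrow> (c i has_real_derivative c' i x) (at x)"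
    by metis
  \<comment> \<open>New coefficient of \<open>D^i f\<close>: \<open>c' i\<close> comes from
    differentiating the old one, \<open>c (i - 1) * \<theta>'\<close> from the chain rule applied to
    \<open>D^(i-1) f\<close>. The case distinctions treat the ends \<open>i = Suc j\<close> and
    \<open>i = 0\<close>.\<close>
  define d where "d i x = (if i \<le> j then c' i x else 0) + (if i = 0 then 0 else c (i - 1) x * \<theta>' b x)"
    for i x
  have d: "Cm_on (m - Suc j) A (d i)" if "i \<le> Suc j" for i
  proof -
    have "Cm_on (m - Suc j) A (\<lambda>x. if i \<le> j then c' i x else 0)"
      using c'(1)[of i] Cm_on_const by (cases "i \<le> j") auto
    moreover have "Cm_on (m - Suc j) A (\<lambda>x. if i = 0 then 0 else c (i - 1) x * \<theta>' b x)"
    proof (cases "i = 0")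
      case False
      have "Cm_on (m - Suc j) A (c (i - 1))"
        by (rule Cm_on_mono[OF c(1)]) (use that in auto)
      then show ?thesis using False Cm_on_mult[OF _ Cm_\<theta>'[OF b]] by simp
    qed (simp add: Cm_on_const)
    ultimately show ?thesis unfolding d_def by (rule Cm_on_add)
  qed
  have "Dext A (Suc j) (\<lambda>y. p y * f (theta b y)) x = (\<Sum>i\<le>Suc j. d i x * Dext A i f (theta b x))"
    if f: "Cm_on m A f" and x: "x \<in> {0..A}" for f x
  \<comment> \<open>Two-sided derivatives are available in the interior only; both sides are
    continuous, so the identity extends to the endpoints.\<close>
  proof (rule eq_on_Icc_if_eq_on_Ioo[OF A_pos _ _ _ x])
    note pf = Cm_branch[OF b p f]
    show "continuous_on {0..A} (Dext A (Suc j) (\<lambda>y. p y * f (theta b y)))"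
      by (rule Cm_on_Dext(2)[OF A_pos pf Suc.prems])
    have "continuous_on {0..A} (\<lambda>x. Dext A i f (theta b x))" if "i \<le> Suc j" for i
      by (rule continuous_on_compose2[OF Cm_on_Dext(2)[OF A_pos f]
            Cm_on_continuous[OF Cm_theta[OF b, of 0]]])
        (use that Suc.prems theta_mem[OF b] in auto)
    then show "continuous_on {0..A} (\<lambda>x. \<Sum>i\<le>Suc j. d i x * Dext A i f (theta b x))"
      using Cm_on_continuous[OF d] by (intro continuous_on_sum continuous_on_mult) auto
    fix x assume x: "x \<in> {0<..<A}"
    have j: "j < m" using Suc.prems by simp
    have "((\<lambda>x. \<Sum>i\<le>j. c i x * Dext A i f (theta b x)) has_real_derivative
        (\<Sum>i\<le>j. c' i x * Dext A i f (theta b x)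
          + Dext A (Suc i) f (theta b x) * \<theta>' b x * c i x)) (at x)"
    proof (intro DERIV_sum DERIV_mult)
      fix i assume i: "i \<in> {..j}"
      then show "(c i has_real_derivative c' i x) (at x)" using c'(2) x by simp
      show "((\<lambda>x. Dext A i f (theta b x)) has_real_derivative
          Dext A (Suc i) f (theta b x) * \<theta>' b x) (at x)"
        by (rule DERIV_chain2[OF Cm_on_Dext(3)[OF A_pos f] theta_deriv[OF b]])
          (use i j x theta_mem_open[OF b x] in auto)
    qed
    then have "(Dext A j (\<lambda>y. p y * f (theta b y)) has_real_derivative
        (\<Sum>i\<le>j. c' i x * Dext A i f (theta b x)
          + Dext A (Suc i) f (theta b x) * \<theta>' b x * c i x)) (at x)"
      by (rule has_field_derivative_transform_within_open[of _ _ _ "{0<..<A}"])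
        (use x c(3)[OF f] in auto)
    moreover have "(Dext A j (\<lambda>y. p y * f (theta b y)) has_real_derivative
        Dext A (Suc j) (\<lambda>y. p y * f (theta b y)) x) (at x)"
      by (rule Cm_on_Dext(3)[OF A_pos pf j x])
    ultimately have "Dext A (Suc j) (\<lambda>y. p y * f (theta b y)) x =
        (\<Sum>i\<le>j. c' i x * Dext A i f (theta b x) + Dext A (Suc i) f (theta b x) * \<theta>' b x * c i x)"
      using DERIV_unique by blast
    also have "\<dots> = (\<Sum>i\<le>Suc j. (if i \<le> j then c' i x else 0) * Dext A i f (theta b x))
        + (\<Sum>i\<le>Suc j. (if i = 0 then 0 else c (i - 1) x * \<theta>' b x) * Dext A i f (theta b x))"
      by (subst (2) sum.atMost_Suc_shift) (simp add: sum.distrib mult_ac)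
    also have "\<dots> = (\<Sum>i\<le>Suc j. d i x * Dext A i f (theta b x))"
      unfolding d_def by (simp only: sum.distrib distrib_right)
    finally show "Dext A (Suc j) (\<lambda>y. p y * f (theta b y)) x = (\<Sum>i\<le>Suc j. d i x * Dext A i f (theta b x))" .
  qed
  moreover have "d (Suc j) x = p x * \<theta>' b x ^ Suc j" if "x \<in> {0..A}" for x
    using c(2)[OF that] by (simp add: d_def)
  ultimately show ?case using d by (intro exI[of _ d]) (auto simp: branch_coeffs_def)
qed

lemma Dext_T:
  assumes "Cm_on m A f" "j \<le> m" "x \<in> {0..A}"
  shows "Dext A j (T f) x = (\<Sum>b\<in>B. Dext A j (\<lambda>y. h b y * f (theta b y)) x)"
proof -
  have C: "Cm_on m A (\<lambda>y. h b y * f (theta b y))" if "b \<in> B" for b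
    by (rule Cm_branch[OF that Cm_h[OF that] assms(1)])
  have "Dext A j (T f) x = Dext A j (\<lambda>x. \<Sum>b\<in>B. h b x * f (theta b x)) x"
    by (rule Dext_cong[OF A_pos Cm_on_sum[OF A_pos C] _ assms(2,3)]) (auto simp: T_apply)
  also have "\<dots> = (\<Sum>b\<in>B. Dext A j (\<lambda>y. h b y * f (theta b y)) x)"
    by (rule Dext_sum[OF A_pos C assms(2,3)])
  finally show ?thesis .
qed

text \<open>The leading coefficient is kept exactly, as it decides the growth rate. The others are
  merged into a constant uniform in \<open>f\<close> and \<open>x\<close>, because the lower
  derivatives will already be under control when this is used.\<close>

lemma Dext_T_le:
  assumes j: "j \<le> m"
  shows "\<exists>Q\<ge>0. \<forall>f. Cm_on m A f \<longrightarrow> (\<forall>x\<in>{0..A}. \<bar>Dext A j (T f) x\<bar> \<le>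
    (\<Sum>b\<in>B. h b x * \<bar>\<theta>' b x\<bar> ^ j * \<bar>Dext A j f (theta b x)\<bar>
      + Q * (\<Sum>i<j. \<bar>Dext A i f (theta b x)\<bar>)))"
proof -
  have "\<forall>b\<in>B. \<exists>Q. Q \<ge> 0 \<and> (\<forall>f. Cm_on m A f \<longrightarrow> (\<forall>x\<in>{0..A}.
    \<bar>Dext A j (\<lambda>y. h b y * f (theta b y)) x\<bar> \<le>
    h b x * \<bar>\<theta>' b x\<bar> ^ j * \<bar>Dext A j f (theta b x)\<bar> + Q * (\<Sum>i<j. \<bar>Dext A i f (theta b x)\<bar>)))"
  proof
    fix b assume b: "b \<in> B"
    obtain c where "branch_coeffs b (h b) j c"
      using branch_coeffs_exist[OF b Cm_h[OF b] j] by blast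
    note c = branch_coeffsD[OF this]
    have "\<forall>i. \<exists>K. i \<le> j \<longrightarrow> 0 \<le> K \<and> (\<forall>x\<in>{0..A}. \<bar>c i x\<bar> \<le> K)"
      using continuous_on_Icc_bounded[OF Cm_on_continuous[OF c(1)]] by blast
    then obtain K where K: "\<And>i. i \<le> j \<Longrightarrow> 0 \<le> K i" "\<And>i x. i \<le> j \<Longrightarrow> x \<in> {0..A} \<Longrightarrow> \<bar>c i x\<bar> \<le> K i"
      by metis
    define Q where "Q = (\<Sum>i<j. K i)"
    have Q: "K i \<le> Q" if "i < j" for i
      unfolding Q_def using that K(1) by (intro member_le_sum) auto
    have "\<bar>Dext A j (\<lambda>y. h b y * f (theta b y)) x\<bar> \<le>
      h b x * \<bar>\<theta>' b x\<bar> ^ j * \<bar>Dext A j f (theta b x)\<bar> + Q * (\<Sum>i<j. \<bar>Dext A i f (theta b x)\<bar>)"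
      if f: "Cm_on m A f" and x: "x \<in> {0..A}" for f x
    proof -
      have "Dext A j (\<lambda>y. h b y * f (theta b y)) x =
          c j x * Dext A j f (theta b x) + (\<Sum>i<j. c i x * Dext A i f (theta b x))"
        using c(3)[OF f x] by (simp add: lessThan_Suc_atMost[symmetric])
      also have "\<bar>\<dots>\<bar> \<le> \<bar>c j x * Dext A j f (theta b x)\<bar> + (\<Sum>i<j. \<bar>c i x * Dext A i f (theta b x)\<bar>)"
        by (intro order_trans[OF abs_triangle_ineq] add_mono sum_abs) auto
      also have "(\<Sum>i<j. \<bar>c i x * Dext A i f (theta b x)\<bar>) \<le> (\<Sum>i<j. Q * \<bar>Dext A i f (theta b x)\<bar>)"
        unfolding abs_mult using K(2)[OF _ x] Q
        by (intro sum_mono mult_right_mono) (auto intro: order_trans less_imp_le)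
      also have "\<bar>c j x * Dext A j f (theta b x)\<bar> = h b x * \<bar>\<theta>' b x\<bar> ^ j * \<bar>Dext A j f (theta b x)\<bar>"
        using h_pos[OF b x] c(2)[OF x] by (simp add: abs_mult power_abs)
      finally show ?thesis by (simp add: sum_distrib_left)
    qed
    moreover have "Q \<ge> 0" unfolding Q_def using K(1) by (intro sum_nonneg) auto
    ultimately show "\<exists>Q. Q \<ge> 0 \<and> (\<forall>f. Cm_on m A f \<longrightarrow> (\<forall>x\<in>{0..A}.
      \<bar>Dext A j (\<lambda>y. h b y * f (theta b y)) x\<bar> \<le>
      h b x * \<bar>\<theta>' b x\<bar> ^ j * \<bar>Dext A j f (theta b x)\<bar> + Q * (\<Sum>i<j. \<bar>Dext A i f (theta b x)\<bar>)))"
      by blast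
  qed
  from bchoice[OF this] obtain Q where Q0: "\<forall>b\<in>B. Q b \<ge> 0 \<and> (\<forall>f. Cm_on m A f \<longrightarrow> (\<forall>x\<in>{0..A}.
    \<bar>Dext A j (\<lambda>y. h b y * f (theta b y)) x\<bar> \<le>
    h b x * \<bar>\<theta>' b x\<bar> ^ j * \<bar>Dext A j f (theta b x)\<bar> + Q b * (\<Sum>i<j. \<bar>Dext A i f (theta b x)\<bar>)))"
    by (elim exE)
  then have Q: "\<And>b. b \<in> B \<Longrightarrow> Q b \<ge> 0"
    "\<And>b f x. b \<in> B \<Longrightarrow> Cm_on m A f \<Longrightarrow> x \<in> {0..A} \<Longrightarrow> \<bar>Dext A j (\<lambda>y. h b y * f (theta b y)) x\<bar> \<le>
    h b x * \<bar>\<theta>' b x\<bar> ^ j * \<bar>Dext A j f (theta b x)\<bar> + Q b * (\<Sum>i<j. \<bar>Dext A i f (theta b x)\<bar>)"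
    by auto
  have Qs: "Q b \<le> sum Q B" if "b \<in> B" for b
    using that Q(1) finite_B by (intro member_le_sum) auto
  have "\<bar>Dext A j (T f) x\<bar> \<le> (\<Sum>b\<in>B. h b x * \<bar>\<theta>' b x\<bar> ^ j * \<bar>Dext A j f (theta b x)\<bar>
      + sum Q B * (\<Sum>i<j. \<bar>Dext A i f (theta b x)\<bar>))" if "Cm_on m A f" "x \<in> {0..A}" for f x
  proof -
    have "\<bar>Dext A j (T f) x\<bar> \<le> (\<Sum>b\<in>B. \<bar>Dext A j (\<lambda>y. h b y * f (theta b y)) x\<bar>)"
      unfolding Dext_T[OF that(1) j that(2)] by (rule sum_abs)
    also have "\<dots> \<le> (\<Sum>b\<in>B. h b x * \<bar>\<theta>' b x\<bar> ^ j * \<bar>Dext A j f (theta b x)\<bar>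
      + sum Q B * (\<Sum>i<j. \<bar>Dext A i f (theta b x)\<bar>))"
      by (intro sum_mono order_trans[OF Q(2)[OF _ that]] add_left_mono mult_right_mono Qs sum_nonneg) auto
    finally show ?thesis .
  qed
  moreover have "sum Q B \<ge> 0" using Q(1) by (rule sum_nonneg)
  ultimately show ?thesis by blast
qed

lemma Cm_T_power: "Cm_on m A f \<Longrightarrow> Cm_on m A ((T ^^ n) f)"
  by (induction n) (auto intro: Cm_T)

text \<open>\<open>K\<close> is chosen before \<open>f\<close> and \<open>E\<close> and so is
  uniform in the function. With \<open>E\<close> a multiple of \<open>Cm_norm m A f\<close> this
  becomes a bound on the operator norms of the powers.\<close>

definition power_bound :: "real \<Rightarrow> nat \<Rightarrow> real \<Rightarrow> bool" where
  "power_bound \<sigma> j K \<longleftrightarrow> 0 \<le> K \<and> (\<forall>f E. Cm_on m A f \<longrightarrow> E \<ge> 0 \<longrightarrow>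
    (\<forall>n. \<forall>x\<in>{0..A}. \<bar>(T ^^ n) f x\<bar> \<le> E * \<sigma> ^ n) \<longrightarrow>
    (\<forall>i\<le>m. \<forall>x\<in>{0..A}. \<bar>Dext A i f x\<bar> \<le> E) \<longrightarrow>
    (\<forall>n. \<forall>x\<in>{0..A}. \<bar>Dext A j ((T ^^ n) f) x\<bar> \<le> K * E * \<sigma> ^ n))"

lemma power_boundD:
  assumes "power_bound \<sigma> j K"
  shows "0 \<le> K"
    and "Cm_on m A f \<Longrightarrow> E \<ge> 0 \<Longrightarrow> (\<forall>n. \<forall>x\<in>{0..A}. \<bar>(T ^^ n) f x\<bar> \<le> E * \<sigma> ^ n) \<Longrightarrow>
      (\<forall>i\<le>m. \<forall>x\<in>{0..A}. \<bar>Dext A i f x\<bar> \<le> E) \<Longrightarrow> x \<in> {0..A} \<Longrightarrow>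
      \<bar>Dext A j ((T ^^ n) f) x\<bar> \<le> K * E * \<sigma> ^ n"
  using assms unfolding power_bound_def by auto

text \<open>Let \<open>d n\<close> be the supremum of \<open>\<bar>D^j T^n f\<bar> / W\<close> for
  the weight \<open>W\<close> below. The leading operator sends \<open>W\<close> below
  \<open>\<kappa> lam W\<close>, so
  \<open>d (n + 1) \<le> \<kappa> lam d n + const E \<sigma>^n\<close>, and
  \<open>\<sigma> > \<kappa> lam\<close> forces \<open>d n = O(E \<sigma>^n)\<close>. Of
  \<open>v\<close> only the eigenvalue equation and two-sided positive bounds are assumed, so the
  lemma can be applied before \<open>v\<close> is known to be smooth.\<close>

lemma Dext_T_power_le:
  assumes lam: "lam > 0" and c0: "c0 > 0"
    and v: "\<And>x. x \<in> {0..A} \<Longrightarrow> c0 \<le> v x" "\<And>x. x \<in> {0..A} \<Longrightarrow> v x \<le> c1"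
    and Tv: "\<And>x. x \<in> {0..A} \<Longrightarrow> T v x = lam * v x"
    and \<sigma>: "\<kappa> * lam < \<sigma>" and "j \<le> m"
  shows "\<exists>K. power_bound \<sigma> j K"
  using \<open>j \<le> m\<close>
proof (induction j rule: less_induct)
  case (less j)
  have \<sigma>0: "\<sigma> > 0" using \<sigma> mult_pos_pos[OF \<kappa>_pos lam] by linarith
  show ?case
  proof (cases "j = 0")
    case True
    then show ?thesis
      using Cm_on_Dext(1)[OF A_pos Cm_T_power] by (intro exI[of _ 1]) (auto simp: power_bound_def)
  next
    case False
    have "\<forall>i\<in>{..<j}. \<exists>K. power_bound \<sigma> i K"
      using less.IH less.prems by simp
    then obtain K where K0: "\<forall>i\<in>{..<j}. power_bound \<sigma> i (K i)"
      by (rule bchoice[THEN exE])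
    then have K: "power_bound \<sigma> i (K i)" if "i < j" for i using that by simp
    obtain Q where Q: "Q \<ge> 0" "\<And>f x. Cm_on m A f \<Longrightarrow> x \<in> {0..A} \<Longrightarrow> \<bar>Dext A j (T f) x\<bar> \<le>
      (\<Sum>b\<in>B. h b x * \<bar>\<theta>' b x\<bar> ^ j * \<bar>Dext A j f (theta b x)\<bar>
        + Q * (\<Sum>i<j. \<bar>Dext A i f (theta b x)\<bar>))"
      using Dext_T_le[OF less.prems] by blast
    define S where "S = (\<Sum>i<j. K i)"
    have S: "S \<ge> 0" unfolding S_def using power_boundD(1)[OF K] by (intro sum_nonneg) auto
    \<comment> \<open>The power of \<open>x + \<gamma>\<close> absorbs
      \<open>\<bar>\<theta>' b x\<bar> ^ j\<close> through \<open>\<theta>'_weight\<close>; the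
      factor \<open>v\<close> turns the remaining sum into \<open>T v = lam v\<close>.\<close>
    define W where "W x = v x / (x + \<gamma>) ^ j" for x
    define w0 where "w0 = c0 / (A + \<gamma>) ^ j"
    define w1 where "w1 = c1 / \<gamma> ^ j"
    have w0: "w0 > 0" using c0 A_pos \<gamma>_pos by (simp add: w0_def)
    have W0: "w0 \<le> W x" and W1: "W x \<le> w1" if "x \<in> {0..A}" for x
    proof -
      show "w0 \<le> W x" unfolding w0_def W_def
        using v(1)[OF that] c0 that \<gamma>_pos by (intro frac_le power_mono) auto
      show "W x \<le> w1" unfolding w1_def W_def
        using v(1,2)[OF that] c0 that \<gamma>_pos by (intro frac_le power_mono) auto
    qed
    have TW: "(\<Sum>b\<in>B. h b x * \<bar>\<theta>' b x\<bar> ^ j * W (theta b x)) \<le> \<kappa> * lam * W x"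
      if x: "x \<in> {0..A}" for x
    proof -
      have "h b x * \<bar>\<theta>' b x\<bar> ^ j * W (theta b x) \<le> \<kappa> / (x + \<gamma>) ^ j * (h b x * v (theta b x))"
        if b: "b \<in> B" for b
      proof -
        have th: "theta b x \<in> {0..A}" by (rule theta_mem[OF b x])
        have pos: "x + \<gamma> > 0" "theta b x + \<gamma> > 0" using x th \<gamma>_pos by auto
        have "(\<bar>\<theta>' b x\<bar> * (x + \<gamma>)) ^ j \<le> (\<kappa> * (theta b x + \<gamma>)) ^ j"
          using \<theta>'_weight[OF b] x pos by (intro power_mono) auto
        also have "\<dots> \<le> \<kappa> * (theta b x + \<gamma>) ^ j"
        proof -
          \<comment> \<open>Here \<open>j \<ge> 1\<close> enters: weakening
            \<open>\<kappa> ^ j\<close> to \<open>\<kappa>\<close> gives the same threshold for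
            \<open>\<sigma>\<close> at every order.\<close>
          have "\<kappa> ^ j \<le> \<kappa> ^ 1" using False \<kappa>_pos \<kappa>_less_1 by (intro power_decreasing) auto
          then have "\<kappa> ^ j * (theta b x + \<gamma>) ^ j \<le> \<kappa> * (theta b x + \<gamma>) ^ j"
            using pos by (intro mult_right_mono) auto
          then show ?thesis by (simp only: power_mult_distrib)
        qed
        finally have "\<bar>\<theta>' b x\<bar> ^ j * (x + \<gamma>) ^ j \<le> \<kappa> * (theta b x + \<gamma>) ^ j"
          by (simp only: power_mult_distrib)
        moreover have "a / q \<le> k / p" if "a * p \<le> k * q" "p > 0" "q > 0" for a k p q :: real
          using that by (simp add: field_simps)
        ultimately have "\<bar>\<theta>' b x\<bar> ^ j / (theta b x + \<gamma>) ^ j \<le> \<kappa> / (x + \<gamma>) ^ j"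
          using pos by simp
        then have "\<bar>\<theta>' b x\<bar> ^ j / (theta b x + \<gamma>) ^ j * (h b x * v (theta b x))
            \<le> \<kappa> / (x + \<gamma>) ^ j * (h b x * v (theta b x))"
          using h_pos[OF b x] v(1)[OF th] c0 by (intro mult_right_mono) auto
        then show ?thesis by (simp add: W_def mult_ac)
      qed
      then have "(\<Sum>b\<in>B. h b x * \<bar>\<theta>' b x\<bar> ^ j * W (theta b x))
          \<le> (\<Sum>b\<in>B. \<kappa> / (x + \<gamma>) ^ j * (h b x * v (theta b x)))"
        by (rule sum_mono)
      also have "\<dots> = \<kappa> / (x + \<gamma>) ^ j * (lam * v x)"
        using Tv[OF x] by (simp only: T_apply[OF x] sum_distrib_left[symmetric])
      also have "\<dots> = \<kappa> * lam * W x" by (simp add: W_def)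
      finally show ?thesis .
    qed
    define P where "P = Q * S * card B"
    have P: "P \<ge> 0" using Q S by (simp add: P_def)
    \<comment> \<open>The first summand secures \<open>E \<le> R * E * W x\<close> at
      \<open>n = 0\<close>. The second makes the lower-order contribution \<open>P\<close> at most
      \<open>R * W x * (\<sigma> - \<kappa> * lam)\<close>, the room that the leading term leaves
      between \<open>\<sigma> ^ n\<close> and \<open>\<sigma> ^ Suc n\<close>.\<close>
    define R where "R = 1 / w0 + P / (w0 * (\<sigma> - \<kappa> * lam))"
    have R: "R \<ge> 0" "1 \<le> R * w0" "P \<le> R * w0 * (\<sigma> - \<kappa> * lam)"
    proof -
      define D where "D = \<sigma> - \<kappa> * lam"
      have D: "D > 0" using \<sigma> by (simp add: D_def)
      have Rw: "R * w0 = 1 + P / D"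
        using w0 D unfolding R_def D_def[symmetric] by (simp add: field_simps)
      show "R \<ge> 0" using w0 P D unfolding R_def D_def[symmetric] by simp
      show "1 \<le> R * w0" using P D by (simp add: Rw)
      show "P \<le> R * w0 * (\<sigma> - \<kappa> * lam)"
        using D unfolding Rw D_def[symmetric] by (simp add: field_simps)
    qed
    have main: "\<bar>Dext A j ((T ^^ n) f) x\<bar> \<le> R * E * \<sigma> ^ n * W x"
      if f: "Cm_on m A f" and E: "E \<ge> 0" and b0: "\<forall>n. \<forall>x\<in>{0..A}. \<bar>(T ^^ n) f x\<bar> \<le> E * \<sigma> ^ n"
        and bm: "\<forall>i\<le>m. \<forall>x\<in>{0..A}. \<bar>Dext A i f x\<bar> \<le> E" and x: "x \<in> {0..A}" for f E n x
      using x
    proof (induction n arbitrary: x)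
      case 0
      have "\<bar>Dext A j f x\<bar> \<le> E * 1" using bm less.prems 0 by auto
      also have "\<dots> \<le> E * (R * w0)" using E R by (intro mult_left_mono)
      also have "\<dots> \<le> E * (R * W x)" using E R W0[OF 0] by (intro mult_left_mono)
      finally show ?case by (simp add: mult_ac)
    next
      case (Suc n)
      let ?F = "(T ^^ n) f"
      have F: "Cm_on m A ?F" by (rule Cm_T_power[OF f])
      have "h b x * \<bar>\<theta>' b x\<bar> ^ j * \<bar>Dext A j ?F (theta b x)\<bar> + Q * (\<Sum>i<j. \<bar>Dext A i ?F (theta b x)\<bar>)
         \<le> R * E * \<sigma> ^ n * (h b x * \<bar>\<theta>' b x\<bar> ^ j * W (theta b x)) + Q * (S * (E * \<sigma> ^ n))"
        if b: "b \<in> B" for b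
      proof (rule add_mono)
        note th = theta_mem[OF b Suc.prems]
        have "h b x * \<bar>\<theta>' b x\<bar> ^ j * \<bar>Dext A j ?F (theta b x)\<bar>
            \<le> h b x * \<bar>\<theta>' b x\<bar> ^ j * (R * E * \<sigma> ^ n * W (theta b x))"
          using Suc.IH[OF th] h_pos[OF b Suc.prems] by (intro mult_left_mono) auto
        then show "h b x * \<bar>\<theta>' b x\<bar> ^ j * \<bar>Dext A j ?F (theta b x)\<bar>
            \<le> R * E * \<sigma> ^ n * (h b x * \<bar>\<theta>' b x\<bar> ^ j * W (theta b x))"
          by (simp add: mult_ac)
        have "(\<Sum>i<j. \<bar>Dext A i ?F (theta b x)\<bar>) \<le> (\<Sum>i<j. K i * E * \<sigma> ^ n)"
          using power_boundD(2)[OF K f E b0 bm th] by (intro sum_mono) auto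
        also have "\<dots> = S * (E * \<sigma> ^ n)" by (simp add: S_def sum_distrib_right mult.assoc)
        finally show "Q * (\<Sum>i<j. \<bar>Dext A i ?F (theta b x)\<bar>) \<le> Q * (S * (E * \<sigma> ^ n))"
          using Q(1) by (intro mult_left_mono)
      qed
      then have "\<bar>Dext A j (T ?F) x\<bar> \<le> (\<Sum>b\<in>B. R * E * \<sigma> ^ n * (h b x * \<bar>\<theta>' b x\<bar> ^ j * W (theta b x))
          + Q * (S * (E * \<sigma> ^ n)))"
        by (intro order_trans[OF Q(2)[OF F Suc.prems]] sum_mono)
      also have "\<dots> = R * E * \<sigma> ^ n * (\<Sum>b\<in>B. h b x * \<bar>\<theta>' b x\<bar> ^ j * W (theta b x)) + P * (E * \<sigma> ^ n)"
        by (simp add: sum.distrib P_def mult_ac flip: sum_distrib_left)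
      also have "\<dots> \<le> R * E * \<sigma> ^ n * (\<kappa> * lam * W x) + (R * W x * (\<sigma> - \<kappa> * lam)) * (E * \<sigma> ^ n)"
      proof (intro add_mono mult_left_mono mult_right_mono TW Suc.prems)
        have "R * w0 * (\<sigma> - \<kappa> * lam) \<le> R * W x * (\<sigma> - \<kappa> * lam)"
          using R W0[OF Suc.prems] \<sigma> by (intro mult_right_mono mult_left_mono) auto
        then show "P \<le> R * W x * (\<sigma> - \<kappa> * lam)" using R by linarith
      qed (use R E \<sigma>0 in auto)
      also have "\<dots> = R * E * \<sigma> ^ Suc n * W x" by (simp add: algebra_simps)
      finally show ?case by simp
    qed
    have w1: "w1 \<ge> 0" using W0[of 0] W1[of 0] w0 A_pos by simp
    have "\<bar>Dext A j ((T ^^ n) f) x\<bar> \<le> R * w1 * E * \<sigma> ^ n"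
      if "Cm_on m A f" "E \<ge> 0" "\<forall>n. \<forall>x\<in>{0..A}. \<bar>(T ^^ n) f x\<bar> \<le> E * \<sigma> ^ n"
        "\<forall>i\<le>m. \<forall>x\<in>{0..A}. \<bar>Dext A i f x\<bar> \<le> E" "x \<in> {0..A}" for f E n x
    proof -
      have "R * E * \<sigma> ^ n * W x \<le> R * E * \<sigma> ^ n * w1"
        using R that(2) \<sigma>0 W1[OF that(5)] by (intro mult_left_mono) auto
      then show ?thesis using main[OF that, of n] by (simp add: mult_ac)
    qed
    moreover have "R * w1 \<ge> 0" using R w1 by simp
    ultimately have "power_bound \<sigma> j (R * w1)" unfolding power_bound_def by blast
    then show ?thesis by blast
  qed
qed

section \<open>The eigenfunction\<close>

lemma T_power_diff:
  "(T ^^ n) (\<lambda>x. c * f x - d * k x) = (\<lambda>x. c * (T ^^ n) f x - d * (T ^^ n) k x)"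
  by (induction n) (simp_all add: T_diff)

lemma Cm_one: "Cm_on m A one"
  by (rule Cm_on_cong[OF Cm_on_const[of m A 1]]) (simp add: one_def)

lemma Cm_u: "Cm_on m A (u n)"
  unfolding u_def by (rule Cm_T_power[OF Cm_one])

lemma u_outside: "x \<notin> {0..A} \<Longrightarrow> u n x = 0"
  by (cases n) (auto simp: u_def one_def Lam_def)

text \<open>\<open>T\<close> is positive, so the comparison of \<open>\<bar>f\<bar>\<close> with a
  multiple of \<open>v\<close> is transported along the iterates, while \<open>v\<close> only picks
  up powers of \<open>lam\<close>.\<close>

lemma T_power_le:
  assumes Tv: "\<And>x. x \<in> {0..A} \<Longrightarrow> T v x = lam * v x"
    and f: "\<And>x. x \<in> {0..A} \<Longrightarrow> \<bar>f x\<bar> \<le> a * v x" and x: "x \<in> {0..A}"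
  shows "\<bar>(T ^^ n) f x\<bar> \<le> a * lam ^ n * v x"
  using x
proof (induction n arbitrary: x)
  case (Suc n)
  have "\<bar>(T ^^ Suc n) f x\<bar> \<le> (\<Sum>b\<in>B. \<bar>h b x * (T ^^ n) f (theta b x)\<bar>)"
    using Suc.prems by (simp add: T_apply sum_abs)
  also have "\<dots> \<le> (\<Sum>b\<in>B. h b x * (a * lam ^ n * v (theta b x)))"
    unfolding abs_mult using h_pos[OF _ Suc.prems] Suc.IH[OF theta_mem[OF _ Suc.prems]]
    by (intro sum_mono mult_mono) (auto intro: less_imp_le)
  also have "\<dots> = a * lam ^ n * T v x"
    using Suc.prems by (simp add: T_apply sum_distrib_left mult_ac)
  finally show ?case using Tv[OF Suc.prems] by (simp add: mult_ac)
qed (use f in simp)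

lemma power_bound_common:
  assumes "\<And>j. j \<le> m \<Longrightarrow> \<exists>K. power_bound \<sigma> j K" "0 \<le> \<sigma>"
  obtains K where "0 \<le> K" "\<And>j. j \<le> m \<Longrightarrow> power_bound \<sigma> j K"
proof -
  have "\<forall>j\<in>{..m}. \<exists>K. power_bound \<sigma> j K" using assms(1) by simp
  from bchoice[OF this] obtain K where K: "\<forall>j\<in>{..m}. power_bound \<sigma> j (K j)" by (elim exE)
  define S where "S = (\<Sum>j\<le>m. K j)"
  have nn: "0 \<le> K j" if "j \<le> m" for j using K power_boundD(1) that by blast
  have le: "K j \<le> S" if "j \<le> m" for j
    unfolding S_def using nn that by (intro member_le_sum) auto
  show ?thesis
  proof (rule that)
    show "0 \<le> S" unfolding S_def using nn by (intro sum_nonneg) auto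
    fix j assume j: "j \<le> m"
    show "power_bound \<sigma> j S"
      unfolding power_bound_def
    proof (intro conjI allI impI ballI)
      show "0 \<le> S" by fact
      fix f E n x
      assume f: "Cm_on m A f" and E: "0 \<le> E" and H: "\<forall>n. \<forall>x\<in>{0..A}. \<bar>(T ^^ n) f x\<bar> \<le> E * \<sigma> ^ n"
        "\<forall>i\<le>m. \<forall>x\<in>{0..A}. \<bar>Dext A i f x\<bar> \<le> E" and x: "x \<in> {0..A}"
      have "\<bar>Dext A j ((T ^^ n) f) x\<bar> \<le> K j * E * \<sigma> ^ n"
        using power_boundD(2)[OF _ f E H x] K j by simp
      also have "\<dots> \<le> S * E * \<sigma> ^ n"
        using le[OF j] E assms(2) by (intro mult_right_mono) auto
      finally show "\<bar>Dext A j ((T ^^ n) f) x\<bar> \<le> S * E * \<sigma> ^ n" .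
    qed
  qed
qed

text \<open>The order of construction matters: pointwise convergence of \<open>u n / lam ^ n\<close>
  first supplies \<open>v\<close> with its eigenvalue equation; \<open>v\<close> then serves as the
  weight in the derivative bounds; and only these show that \<open>v\<close> is of class
  \<open>C^m\<close>. The norm bound on the powers is the input for the spectral radius.\<close>

lemma eigenfunction_exists:
  "\<exists>lam v K. lam > 0 \<and> v \<in> Cm_space m A \<and> (\<forall>x\<in>{0..A}. v x > 0) \<and> T v = (\<lambda>x. lam * v x) \<and>
    (\<forall>f n. Cm_on m A f \<longrightarrow> Cm_norm m A ((T ^^ n) f) \<le> K * lam ^ n * Cm_norm m A f) \<and>
    (\<forall>j\<le>m. \<forall>x\<in>{0..A}. (\<lambda>n. Dext A j (u n) x / lam ^ n) \<longlonglongrightarrow> Dext A j v x)"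
proof -
  obtain lam \<rho> C where "lam > 0 \<and> 0 < \<rho> \<and> \<rho> < 1 \<and> C > 0 \<and>
    (\<forall>n. \<forall>x\<in>{0..A}. inverse C \<le> u n x / lam ^ n \<and> u n x / lam ^ n \<le> C \<and>
      \<bar>u (Suc n) x - lam * u n x\<bar> \<le> C * (lam * \<rho>) ^ n)"
    using leading_growth by (elim exE)
  then have lam: "lam > 0" and \<rho>: "0 < \<rho>" "\<rho> < 1" and C: "C > 0"
    and bd: "\<And>n x. x \<in> {0..A} \<Longrightarrow> inverse C \<le> u n x / lam ^ n"
      "\<And>n x. x \<in> {0..A} \<Longrightarrow> u n x / lam ^ n \<le> C"
    and du: "\<And>n x. x \<in> {0..A} \<Longrightarrow> \<bar>u (Suc n) x - lam * u n x\<bar> \<le> C * (lam * \<rho>) ^ n"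
    by auto
  \<comment> \<open>The increments of \<open>u n / lam ^ n\<close>. Up to the factor
    \<open>1 / lam ^ Suc n\<close> they are iterates of the single function
    \<open>u 1 - lam * u 0\<close>, to which the power bounds apply.\<close>
  define \<delta> where "\<delta> n x = (u (Suc n) x - lam * u n x) / lam ^ Suc n" for n x
  have \<delta>_out: "\<delta> n x = 0" if "x \<notin> {0..A}" for n x using u_outside[OF that] by (simp add: \<delta>_def)
  have tele: "(\<Sum>k<n. \<delta> k x) = u n x / lam ^ n - one x" for n x
  proof -
    have "(\<Sum>k<n. \<delta> k x) = (\<Sum>k<n. u (Suc k) x / lam ^ Suc k - u k x / lam ^ k)"
      using lam by (intro sum.cong) (auto simp: \<delta>_def field_simps)
    then show ?thesis
      using sum_lessThan_telescope[of "\<lambda>k. u k x / lam ^ k" n]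
      by (simp add: u_def[of 0] del: power_Suc)
  qed
  have "summable (\<lambda>n. \<delta> n x)" if x: "x \<in> {0..A}" for x
  proof (rule summable_comparison_test)
    show "\<exists>N. \<forall>n\<ge>N. norm (\<delta> n x) \<le> C / lam * \<rho> ^ n"
    proof (intro exI allI impI)
      fix n
      have "norm (\<delta> n x) \<le> C * (lam * \<rho>) ^ n / lam ^ Suc n"
        using du[OF x, of n] lam by (simp add: \<delta>_def divide_right_mono)
      also have "\<dots> = C / lam * \<rho> ^ n" using lam by (simp add: power_mult_distrib field_simps)
      finally show "norm (\<delta> n x) \<le> C / lam * \<rho> ^ n" .
    qed
    show "summable (\<lambda>n. C / lam * \<rho> ^ n)" using \<rho> by (intro summable_mult summable_geometric) auto
  qed
  moreover have "summable (\<lambda>n. \<delta> n x)" if "x \<notin> {0..A}" for x using \<delta>_out[OF that] by simp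
  ultimately have sum\<delta>: "summable (\<lambda>n. \<delta> n x)" for x by blast
  define e where "e x = (\<Sum>n. \<delta> n x)" for x
  define v where "v x = one x + e x" for x
  have lim: "(\<lambda>n. u n x / lam ^ n) \<longlonglongrightarrow> v x" for x
  proof -
    have "(\<lambda>n. \<Sum>k<n. \<delta> k x) \<longlonglongrightarrow> e x" using summable_LIMSEQ[OF sum\<delta>] by (simp add: e_def)
    then have "(\<lambda>n. one x + (\<Sum>k<n. \<delta> k x)) \<longlonglongrightarrow> one x + e x" by (intro tendsto_intros)
    then show ?thesis by (simp add: tele v_def)
  qed
  have v: "inverse C \<le> v x" "v x \<le> C" if "x \<in> {0..A}" for x
    using LIMSEQ_le_const[OF lim, of "inverse C"] LIMSEQ_le_const2[OF lim, of x C] bd[OF that] by blast+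
  have v_out: "v x = 0" if "x \<notin> {0..A}" for x
    using \<delta>_out[OF that] that by (simp add: v_def e_def one_def)
  have Tv: "T v x = lam * v x" if x: "x \<in> {0..A}" for x
  proof (rule LIMSEQ_unique)
    have "(\<lambda>n. \<Sum>b\<in>B. h b x * (u n (theta b x) / lam ^ n)) \<longlonglongrightarrow> (\<Sum>b\<in>B. h b x * v (theta b x))"
      by (intro tendsto_intros lim)
    moreover have "(\<Sum>b\<in>B. h b x * (u n (theta b x) / lam ^ n)) = lam * (u (Suc n) x / lam ^ Suc n)" for n
    proof -
      have "(\<Sum>b\<in>B. h b x * (u n (theta b x) / lam ^ n)) = T (u n) x / lam ^ n"
        using x by (simp add: T_apply sum_divide_distrib)
      then show ?thesis using lam by (simp add: u_Suc)
    qed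
    ultimately show "(\<lambda>n. lam * (u (Suc n) x / lam ^ Suc n)) \<longlonglongrightarrow> T v x"
      using x by (simp add: T_apply)
    show "(\<lambda>n. lam * (u (Suc n) x / lam ^ Suc n)) \<longlonglongrightarrow> lam * v x"
      by (intro tendsto_intros LIMSEQ_Suc[OF lim])
  qed
  have pb: "\<exists>K. power_bound \<sigma> j K" if "\<kappa> * lam < \<sigma>" "j \<le> m" for \<sigma> j
    by (rule Dext_T_power_le[OF lam _ v Tv that]) (use C in auto)

  \<comment> \<open>\<open>\<tau>\<close> must exceed \<open>\<kappa>\<close> for the derivative
    bounds, be at least \<open>\<rho>\<close> for the decay of the values, and stay below 1 for
    summability.\<close>
  define \<tau> where "\<tau> = max \<rho> ((1 + \<kappa>) / 2)"
  have \<tau>: "\<tau> < 1" "\<kappa> < \<tau>" "\<rho> \<le> \<tau>" "0 < \<tau>" using \<rho> \<kappa>_less_1 \<kappa>_pos by (auto simp: \<tau>_def less_max_iff_disj)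
  obtain K where K: "0 \<le> K" "\<And>j. j \<le> m \<Longrightarrow> power_bound (lam * \<tau>) j K"
    by (rule power_bound_common[of "lam * \<tau>"]) (use \<tau> lam in \<open>auto intro!: pb simp: mult.commute\<close>)
  \<comment> \<open>This is \<open>u 1 - lam * u 0\<close>; the factor 1 fits it to the shape of
    \<open>T_power_diff\<close>.\<close>
  define f0 where "f0 x = 1 * T one x - lam * one x" for x
  have f0: "Cm_on m A f0"
    using Cm_on_add[OF Cm_T[OF Cm_one] Cm_on_cmult[OF Cm_one, of "- lam"]] by (simp add: f0_def[abs_def])
  have Tf0: "(T ^^ n) f0 x = u (Suc n) x - lam * u n x" for n x
    unfolding f0_def T_power_diff by (simp add: u_def funpow_swap1)
  define E where "E = max C (Cm_norm m A f0)"
  have E: "E \<ge> 0" "C \<le> E" "Cm_norm m A f0 \<le> E" using C by (auto simp: E_def)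
  have b1: "\<forall>n. \<forall>x\<in>{0..A}. \<bar>(T ^^ n) f0 x\<bar> \<le> E * (lam * \<tau>) ^ n"
  proof (intro allI ballI)
    fix n x assume x: "x \<in> {0..A}"
    have "C * (lam * \<rho>) ^ n \<le> E * (lam * \<tau>) ^ n"
      using E C lam \<rho> \<tau> by (intro mult_mono power_mono mult_left_mono) auto
    then show "\<bar>(T ^^ n) f0 x\<bar> \<le> E * (lam * \<tau>) ^ n" using du[OF x, of n] by (simp add: Tf0)
  qed
  have b2: "\<forall>i\<le>m. \<forall>x\<in>{0..A}. \<bar>Dext A i f0 x\<bar> \<le> E"
    using Dext_le_Cm_norm[OF A_pos f0] E(3) by (meson order_trans)
  have \<delta>eq: "\<delta> n = (\<lambda>x. inverse (lam ^ Suc n) * (T ^^ n) f0 x)" for n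
    by (rule ext) (simp add: \<delta>_def Tf0 divide_inverse mult.commute)
  have C\<delta>: "Cm_on m A (\<delta> n)" for n
    unfolding \<delta>eq by (intro Cm_on_cmult Cm_T_power f0)
  have D\<delta>: "\<bar>Dext A j (\<delta> n) x\<bar> \<le> K * E / lam * \<tau> ^ n" if j: "j \<le> m" and x: "x \<in> {0..A}" for n j x
  proof -
    have "\<bar>Dext A j (\<delta> n) x\<bar> = inverse (lam ^ Suc n) * \<bar>Dext A j ((T ^^ n) f0) x\<bar>"
      unfolding \<delta>eq Dext_cmult[OF A_pos Cm_T_power[OF f0] j x] using lam by (simp add: abs_mult)
    also have "\<dots> \<le> inverse (lam ^ Suc n) * (K * E * (lam * \<tau>) ^ n)"
      using power_boundD(2)[OF K(2)[OF j] f0 E(1) b1 b2 x] lam by (intro mult_left_mono) auto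
    also have "\<dots> = K * E / lam * \<tau> ^ n" using lam by (simp add: power_mult_distrib field_simps)
    finally show ?thesis .
  qed
  have "summable (\<lambda>n. K * E / lam * \<tau> ^ n)" using \<tau> by (intro summable_mult summable_geometric) auto
  note ser = Cm_on_series[OF A_pos C\<delta> D\<delta> this]
  have sums_e: "(\<lambda>n. \<delta> n x) sums e x" for x using summable_sums[OF sum\<delta>] by (simp add: e_def)
  have Ce: "Cm_on m A e" by (rule ser(1)[OF _ _ sums_e])
  have Cv: "Cm_on m A v" unfolding v_def[abs_def] by (rule Cm_on_add[OF Cm_one Ce])
  have Dlim: "(\<lambda>n. Dext A j (u n) x / lam ^ n) \<longlonglongrightarrow> Dext A j v x" if j: "j \<le> m" and x: "x \<in> {0..A}" for j x
  proof -
    have "Dext A j (u n) x / lam ^ n = Dext A j one x + (\<Sum>k<n. Dext A j (\<delta> k) x)" for n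
    proof -
      have un: "u n x = lam ^ n * (one x + (\<Sum>k<n. \<delta> k x))" for x using lam by (simp add: tele)
      have "u n = (\<lambda>x. lam ^ n * (one x + (\<Sum>k<n. \<delta> k x)))" using un by (rule ext)
      then have "Dext A j (u n) x = Dext A j (\<lambda>x. lam ^ n * (one x + (\<Sum>k<n. \<delta> k x))) x" by (rule arg_cong)
      also have "\<dots> = lam ^ n * (Dext A j one x + (\<Sum>k<n. Dext A j (\<delta> k) x))"
        by (simp only: Dext_cmult[OF A_pos Cm_on_add[OF Cm_one Cm_on_sum[OF A_pos C\<delta>]] j x]
            Dext_add[OF A_pos Cm_one Cm_on_sum[OF A_pos C\<delta>] j x] Dext_sum[OF A_pos C\<delta> j x])
      finally show ?thesis using lam by simp
    qed
    moreover have "(\<lambda>n. Dext A j one x + (\<Sum>k<n. Dext A j (\<delta> k) x)) \<longlonglongrightarrow> Dext A j one x + Dext A j e x"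
      using ser(2)[OF _ _ sums_e j x] by (intro tendsto_intros) (auto simp: sums_def)
    moreover have "Dext A j v x = Dext A j one x + Dext A j e x"
      unfolding v_def[abs_def] by (rule Dext_add[OF A_pos Cm_one Ce j x])
    ultimately show ?thesis by simp
  qed

  \<comment> \<open>Second use of the derivative bounds, now at the rate \<open>lam\<close> itself,
    which exceeds \<open>\<kappa> * lam\<close>.\<close>
  obtain K' where K': "0 \<le> K'" "\<And>j. j \<le> m \<Longrightarrow> power_bound lam j K'"
    by (rule power_bound_common[of lam]) (use lam \<kappa>_less_1 in \<open>auto intro!: pb\<close>)
  have norm: "Cm_norm m A ((T ^^ n) f) \<le> (K' * max 1 (C * C)) * lam ^ n * Cm_norm m A f"
    if f: "Cm_on m A f" for f n
  proof (rule Cm_norm_le[OF A_pos Cm_T_power[OF f]])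
    fix j x assume j: "j \<le> m" and x: "x \<in> {0..A}"
    have N0: "0 \<le> Cm_norm m A f" using Dext_le_Cm_norm[OF A_pos f, of 0 0] A_pos by simp
    \<comment> \<open>One factor \<open>C\<close> comes from
      \<open>\<bar>f\<bar> \<le> Cm_norm m A f * C * v\<close>, as \<open>v \<ge> inverse C\<close>,
      the other from \<open>v \<le> C\<close>; the maximum with 1 lets \<open>E\<close> bound the
      derivatives of \<open>f\<close> too.\<close>
    define E where "E = max 1 (C * C) * Cm_norm m A f"
    have E: "0 \<le> E" "Cm_norm m A f \<le> E" "C * C * Cm_norm m A f \<le> E"
      using N0 mult_right_mono[OF max.cobounded1[of 1 "C * C"] N0]
        mult_right_mono[OF max.cobounded2[of "C * C" 1] N0] by (auto simp: E_def)
    have "\<forall>n. \<forall>x\<in>{0..A}. \<bar>(T ^^ n) f x\<bar> \<le> E * lam ^ n"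
    proof (intro allI ballI)
      fix n x assume x: "x \<in> {0..A}"
      have "\<bar>(T ^^ n) f x\<bar> \<le> (Cm_norm m A f * C) * lam ^ n * v x"
      proof (rule T_power_le[OF Tv _ x])
        fix y assume y: "y \<in> {0..A}"
        have "\<bar>f y\<bar> \<le> Cm_norm m A f * (C * inverse C)"
          using Dext_le_Cm_norm[OF A_pos f, of 0 y] Cm_on_Dext(1)[OF A_pos f y] y C by simp
        also have "\<dots> \<le> Cm_norm m A f * (C * v y)"
          using N0 C v[OF y] by (intro mult_left_mono) auto
        finally show "\<bar>f y\<bar> \<le> Cm_norm m A f * C * v y" by (simp add: mult.assoc)
      qed
      also have "\<dots> \<le> (Cm_norm m A f * C) * lam ^ n * C"
        using N0 C v[OF x] lam by (intro mult_left_mono) auto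
      also have "\<dots> = (C * C * Cm_norm m A f) * lam ^ n" by simp
      also have "\<dots> \<le> E * lam ^ n" using E lam by (intro mult_right_mono) auto
      finally show "\<bar>(T ^^ n) f x\<bar> \<le> E * lam ^ n" .
    qed
    moreover have "\<forall>i\<le>m. \<forall>x\<in>{0..A}. \<bar>Dext A i f x\<bar> \<le> E"
      using Dext_le_Cm_norm[OF A_pos f] E(2) by (meson order_trans)
    ultimately have "\<bar>Dext A j ((T ^^ n) f) x\<bar> \<le> K' * E * lam ^ n"
      using power_boundD(2)[OF K'(2)[OF j] f E(1)] x by blast
    then show "\<bar>Dext A j ((T ^^ n) f) x\<bar> \<le> (K' * max 1 (C * C)) * lam ^ n * Cm_norm m A f"
      by (simp add: E_def mult_ac)
  qed
  show ?thesis
  proof (rule exI[of _ lam], rule exI[of _ v], rule exI[of _ "K' * max 1 (C * C)"],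
      intro conjI allI impI ballI)
    show "v \<in> Cm_space m A" using Cv v_out by (simp add: Cm_space_def)
    show "v x > 0" if "x \<in> {0..A}" for x
      using v(1)[OF that] positive_imp_inverse_positive[OF C] by linarith
    show "T v = (\<lambda>x. lam * v x)"
      using Tv v_out by (auto simp: fun_eq_iff Lam_def)
  qed (use lam K' norm Dlim in auto)
qed

end

section \<open>Spectral radius of a power-bounded operator\<close>

text \<open>What the Neumann series requires: \<open>V_series\<close> is completeness, stated for
  absolutely convergent series with pointwise sums; \<open>N_ge\<close> lets norm bounds control
  pointwise convergence; \<open>T_sums\<close> lets the operator be applied term by term.\<close>

locale bounded_on_function_space =
  fixes V :: "('a \<Rightarrow> real) set" and N :: "('a \<Rightarrow> real) \<Rightarrow> real"
    and T :: "('a \<Rightarrow> real) \<Rightarrow> ('a \<Rightarrow> real)" and K lam :: real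
  assumes V_lin: "\<And>f k c d. f \<in> V \<Longrightarrow> k \<in> V \<Longrightarrow> (\<lambda>x. c * f x + d * k x) \<in> V"
    and N_lin: "\<And>f k c d. f \<in> V \<Longrightarrow> k \<in> V \<Longrightarrow> N (\<lambda>x. c * f x + d * k x) \<le> \<bar>c\<bar> * N f + \<bar>d\<bar> * N k"
    and N_ge: "\<And>f x. f \<in> V \<Longrightarrow> \<bar>f x\<bar> \<le> N f"
    and V_series: "\<And>f e F. (\<And>n. f n \<in> V) \<Longrightarrow> (\<And>n. N (f n) \<le> e n) \<Longrightarrow> summable e \<Longrightarrow>
      (\<And>x. (\<lambda>n. f n x) sums F x) \<Longrightarrow> F \<in> V \<and> N F \<le> suminf e"
    and T_V: "\<And>f. f \<in> V \<Longrightarrow> T f \<in> V"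
    and T_lin: "\<And>f k c d. T (\<lambda>x. c * f x + d * k x) = (\<lambda>x. c * T f x + d * T k x)"
    and T_sums: "\<And>f F x. (\<And>x. (\<lambda>n. f n x) sums F x) \<Longrightarrow> (\<lambda>n. T (f n) x) sums T F x"
    and T_pow: "\<And>f n. f \<in> V \<Longrightarrow> N ((T ^^ n) f) \<le> K * lam ^ n * N f"
    and lam_nonneg: "0 \<le> lam"
begin

abbreviation "TC \<equiv> cplx_op T"
abbreviation "VC \<equiv> cplx_space V"
abbreviation "NC \<equiv> cplx_norm N"

lemma TC_lin: "TC (\<lambda>x. c * f x + d * k x) = (\<lambda>x. c * TC f x + d * TC k x)"
proof -
  \<comment> \<open>The real and imaginary parts of \<open>c * f + d * k\<close> are each
    combinations of four real functions; the factors 1 make nested uses of \<open>T_lin\<close>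
    match.\<close>
  have *: "T (\<lambda>x. 1 * (a * p x + b * q x) + 1 * (a' * p' x + b' * q' x)) =
      (\<lambda>x. 1 * (a * T p x + b * T q x) + 1 * (a' * T p' x + b' * T q' x))" for a b a' b' p q p' q'
    by (simp only: T_lin)
  have "T (\<lambda>x. Re (c * f x + d * k x)) =
      (\<lambda>x. Re c * T (\<lambda>x. Re (f x)) x - Im c * T (\<lambda>x. Im (f x)) x
        + (Re d * T (\<lambda>x. Re (k x)) x - Im d * T (\<lambda>x. Im (k x)) x))"
    using *[of "Re c" "\<lambda>x. Re (f x)" "- Im c" "\<lambda>x. Im (f x)"
        "Re d" "\<lambda>x. Re (k x)" "- Im d" "\<lambda>x. Im (k x)"] by simp
  moreover have "T (\<lambda>x. Im (c * f x + d * k x)) =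
      (\<lambda>x. Re c * T (\<lambda>x. Im (f x)) x + Im c * T (\<lambda>x. Re (f x)) x
        + (Re d * T (\<lambda>x. Im (k x)) x + Im d * T (\<lambda>x. Re (k x)) x))"
    using *[of "Re c" "\<lambda>x. Im (f x)" "Im c" "\<lambda>x. Re (f x)"
        "Re d" "\<lambda>x. Im (k x)" "Im d" "\<lambda>x. Re (k x)"] by simp
  ultimately show ?thesis
    by (intro ext complex_eqI) (simp_all add: cplx_op_def)
qed

lemma VC_lin:
  assumes "f \<in> VC" "k \<in> VC"
  shows "(\<lambda>x. c * f x + d * k x) \<in> VC"
proof -
  have *: "(\<lambda>x. Re (f x)) \<in> V" "(\<lambda>x. Im (f x)) \<in> V" "(\<lambda>x. Re (k x)) \<in> V" "(\<lambda>x. Im (k x)) \<in> V"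
    using assms by (auto simp: cplx_space_def)
  have "(\<lambda>x. 1 * (Re c * Re (f x) + (- Im c) * Im (f x)) + 1 * (Re d * Re (k x) + (- Im d) * Im (k x))) \<in> V"
    "(\<lambda>x. 1 * (Re c * Im (f x) + Im c * Re (f x)) + 1 * (Re d * Im (k x) + Im d * Re (k x))) \<in> V"
    by (intro V_lin *)+
  then show ?thesis by (simp add: cplx_space_def)
qed

lemma TC_pow_eq: "(TC ^^ n) f = (\<lambda>x. Complex ((T ^^ n) (\<lambda>x. Re (f x)) x) ((T ^^ n) (\<lambda>x. Im (f x)) x))"
  by (induction n) (simp_all add: cplx_op_def)

lemma T_pow_V: "f \<in> V \<Longrightarrow> (T ^^ n) f \<in> V"
  by (induction n) (auto intro: T_V)

lemma TC_VC: "f \<in> VC \<Longrightarrow> TC f \<in> VC"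
  by (simp add: cplx_space_def cplx_op_def T_V)

lemma TC_pow_lin: "(TC ^^ n) (\<lambda>x. c * f x + d * k x) = (\<lambda>x. c * (TC ^^ n) f x + d * (TC ^^ n) k x)"
  by (induction n) (simp_all add: TC_lin)

lemma TC_sums:
  assumes "\<And>x. (\<lambda>n. f n x) sums F x"
  shows "(\<lambda>n. TC (f n) x) sums TC F x"
  using assms T_sums[of "\<lambda>n x. Re (f n x)" "\<lambda>x. Re (F x)" x] T_sums[of "\<lambda>n x. Im (f n x)" "\<lambda>x. Im (F x)" x]
  by (simp add: sums_complex_iff cplx_op_def)

text \<open>Terms of the Neumann series for \<open>(z - T)^-1 h\<close>; the exponent
  \<open>Suc n\<close> includes the leading factor \<open>1 / z\<close>.\<close>

definition res_term :: "complex \<Rightarrow> ('a \<Rightarrow> complex) \<Rightarrow> nat \<Rightarrow> 'a \<Rightarrow> complex" where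
  "res_term z h n x = inverse z ^ Suc n * (TC ^^ n) h x"

definition res_bound :: "complex \<Rightarrow> ('a \<Rightarrow> complex) \<Rightarrow> nat \<Rightarrow> real" where
  "res_bound z h n = cmod (inverse z) * K * NC h * (cmod (inverse z) * lam) ^ n"

definition resolvent :: "complex \<Rightarrow> ('a \<Rightarrow> complex) \<Rightarrow> 'a \<Rightarrow> complex" where
  "resolvent z h x = (\<Sum>n. res_term z h n x)"

lemma N_nonneg: "f \<in> V \<Longrightarrow> 0 \<le> N f"
  using N_ge[of f undefined] by linarith

lemma res_term_bound:
  assumes h: "h \<in> VC"
  shows "(\<lambda>x. Re (res_term z h n x)) \<in> V" "(\<lambda>x. Im (res_term z h n x)) \<in> V"
    "N (\<lambda>x. Re (res_term z h n x)) \<le> res_bound z h n" "N (\<lambda>x. Im (res_term z h n x)) \<le> res_bound z h n"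
proof -
  define P where "P = (T ^^ n) (\<lambda>x. Re (h x))"
  define Q where "Q = (T ^^ n) (\<lambda>x. Im (h x))"
  define w where "w = inverse z ^ Suc n"
  have hV: "(\<lambda>x. Re (h x)) \<in> V" "(\<lambda>x. Im (h x)) \<in> V" using h by (auto simp: cplx_space_def)
  have PQ: "P \<in> V" "Q \<in> V" unfolding P_def Q_def by (intro T_pow_V hV)+
  have NP: "N P \<le> K * lam ^ n * N (\<lambda>x. Re (h x))" "N Q \<le> K * lam ^ n * N (\<lambda>x. Im (h x))"
    unfolding P_def Q_def by (intro T_pow hV)+
  have re: "(\<lambda>x. Re (res_term z h n x)) = (\<lambda>x. Re w * P x + (- Im w) * Q x)"
    and im: "(\<lambda>x. Im (res_term z h n x)) = (\<lambda>x. Im w * P x + Re w * Q x)"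
    by (auto simp: res_term_def TC_pow_eq P_def Q_def w_def simp del: power_Suc)
  show "(\<lambda>x. Re (res_term z h n x)) \<in> V" "(\<lambda>x. Im (res_term z h n x)) \<in> V"
    unfolding re im by (intro V_lin PQ)+
  have w: "\<bar>Re w\<bar> \<le> cmod w" "\<bar>Im w\<bar> \<le> cmod w" by (rule abs_Re_le_cmod abs_Im_le_cmod)+
  have eq: "cmod w * N P + cmod w * N Q \<le> res_bound z h n"
  proof -
    have "cmod w * N P + cmod w * N Q \<le> cmod w * (K * lam ^ n * N (\<lambda>x. Re (h x)))
        + cmod w * (K * lam ^ n * N (\<lambda>x. Im (h x)))"
      by (intro add_mono mult_left_mono NP) auto
    also have "\<dots> = res_bound z h n"
      by (simp add: res_bound_def cplx_norm_def w_def norm_mult norm_power norm_inverse power_mult_distrib algebra_simps)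
    finally show ?thesis .
  qed
  have "N (\<lambda>x. Re (res_term z h n x)) \<le> \<bar>Re w\<bar> * N P + \<bar>- Im w\<bar> * N Q"
    unfolding re by (intro N_lin PQ)
  also have "\<dots> \<le> cmod w * N P + cmod w * N Q"
    using w N_nonneg PQ by (intro add_mono mult_right_mono) auto
  finally show "N (\<lambda>x. Re (res_term z h n x)) \<le> res_bound z h n" using eq by linarith
  have "N (\<lambda>x. Im (res_term z h n x)) \<le> \<bar>Im w\<bar> * N P + \<bar>Re w\<bar> * N Q"
    unfolding im by (intro N_lin PQ)
  also have "\<dots> \<le> cmod w * N P + cmod w * N Q"
    using w N_nonneg PQ by (intro add_mono mult_right_mono) auto
  finally show "N (\<lambda>x. Im (res_term z h n x)) \<le> res_bound z h n" using eq by linarith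
qed

lemma ratio_less_1:
  assumes "lam < cmod z"
  shows "cmod (inverse z) * lam < 1"
proof -
  have "cmod z > 0" using assms lam_nonneg by linarith
  then have "inverse (cmod z) * lam < 1" using assms by (simp add: field_simps)
  then show ?thesis by (simp only: norm_inverse)
qed

lemma res_bound_sums:
  assumes "lam < cmod z"
  shows "res_bound z h sums (cmod (inverse z) * K / (1 - cmod (inverse z) * lam) * NC h)"
proof -
  have "(\<lambda>n. (cmod (inverse z) * lam) ^ n) sums (1 / (1 - cmod (inverse z) * lam))"
    using ratio_less_1[OF assms] lam_nonneg by (intro geometric_sums) simp
  from sums_mult[OF this, of "cmod (inverse z) * K * NC h"] show ?thesis
    by (simp add: res_bound_def[abs_def] mult_ac)
qed

lemma res_term_sums:
  assumes h: "h \<in> VC" and z: "lam < cmod z"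
  shows "(\<lambda>n. res_term z h n x) sums resolvent z h x"
proof -
  have sm: "summable (res_bound z h)" using res_bound_sums[OF z] by (rule sums_summable)
  have "norm (Re (res_term z h n x)) \<le> res_bound z h n" "norm (Im (res_term z h n x)) \<le> res_bound z h n" for n
    using N_ge[OF res_term_bound(1)[OF h], of z n x] N_ge[OF res_term_bound(2)[OF h], of z n x]
      res_term_bound(3,4)[OF h, of z n] by auto
  then have "summable (\<lambda>n. Re (res_term z h n x))" "summable (\<lambda>n. Im (res_term z h n x))"
    by (auto intro: summable_comparison_test[OF _ sm])
  then have "summable (\<lambda>n. res_term z h n x)" by (simp add: summable_complex_iff)
  then show ?thesis unfolding resolvent_def by (rule summable_sums)
qed

lemma resolvent_VC:
  assumes h: "h \<in> VC" and z: "lam < cmod z"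
  shows "resolvent z h \<in> VC"
    "NC (resolvent z h) \<le> 2 * (cmod (inverse z) * K / (1 - cmod (inverse z) * lam)) * NC h"
proof -
  have s: "(\<lambda>n. Re (res_term z h n x)) sums Re (resolvent z h x)"
    "(\<lambda>n. Im (res_term z h n x)) sums Im (resolvent z h x)" for x
    using res_term_sums[OF h z, of x] by (simp_all add: sums_complex_iff)
  note sm = sums_summable[OF res_bound_sums[OF z, of h]]
  have re: "(\<lambda>x. Re (resolvent z h x)) \<in> V \<and> N (\<lambda>x. Re (resolvent z h x)) \<le> suminf (res_bound z h)"
    by (rule V_series[OF res_term_bound(1)[OF h] res_term_bound(3)[OF h] sm s(1)])
  have im: "(\<lambda>x. Im (resolvent z h x)) \<in> V \<and> N (\<lambda>x. Im (resolvent z h x)) \<le> suminf (res_bound z h)"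
    by (rule V_series[OF res_term_bound(2)[OF h] res_term_bound(4)[OF h] sm s(2)])
  show "resolvent z h \<in> VC" using re im by (simp add: cplx_space_def)
  show "NC (resolvent z h) \<le> 2 * (cmod (inverse z) * K / (1 - cmod (inverse z) * lam)) * NC h"
  proof -
    \<comment> \<open>Real and imaginary part are each bounded by the full majorant, whence the
      factor 2.\<close>
    have "NC (resolvent z h) \<le> 2 * suminf (res_bound z h)"
      unfolding cplx_norm_def using re im by linarith
    then show ?thesis unfolding sums_unique[OF res_bound_sums[OF z, of h], symmetric]
      by (simp only: mult.assoc)
  qed
qed

text \<open>The operator applied term by term shifts the series: the image of term \<open>n\<close>
  is \<open>z\<close> times term \<open>n + 1\<close>. What remains is \<open>z\<close> times term
  0, which is \<open>h\<close>.\<close>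

lemma resolvent_right:
  assumes h: "h \<in> VC" and z: "lam < cmod z"
  shows "z * resolvent z h x - TC (resolvent z h) x = h x"
proof -
  have z0: "z \<noteq> 0" using z lam_nonneg by auto
  have "TC (res_term z h n) x = z * res_term z h (Suc n) x" for n
    using fun_cong[OF TC_lin[of "inverse z ^ Suc n" "(TC ^^ n) h" 0 "\<lambda>_. 0"], of x] z0
    by (simp add: res_term_def[abs_def])
  moreover have "(\<lambda>n. TC (res_term z h n) x) sums TC (resolvent z h) x"
    by (rule TC_sums) (rule res_term_sums[OF h z])
  ultimately have "(\<lambda>n. z * res_term z h (Suc n) x) sums TC (resolvent z h) x" by simp
  moreover have "(\<lambda>n. z * res_term z h (Suc n) x) sums (z * (resolvent z h x - res_term z h 0 x))"
    using res_term_sums[OF h z, of x]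
      sums_Suc_iff[of "\<lambda>n. res_term z h n x" "resolvent z h x - res_term z h 0 x"]
    by (intro sums_mult) simp
  ultimately have "TC (resolvent z h) x = z * (resolvent z h x - res_term z h 0 x)"
    by (rule sums_unique2)
  moreover have "z * res_term z h 0 x = h x" using z0 by (simp add: res_term_def)
  ultimately show ?thesis by (simp add: right_diff_distrib)
qed

text \<open>The series for \<open>z f - T f\<close> telescopes to \<open>f\<close> minus the limit
  of \<open>z^-n T^n f\<close>, which is 0 by the geometric bound.\<close>

lemma resolvent_left:
  assumes f: "f \<in> VC" and z: "lam < cmod z"
  shows "resolvent z (\<lambda>x. z * f x - TC f x) x = f x"
proof -
  have z0: "z \<noteq> 0" using z lam_nonneg by auto
  have fV: "(\<lambda>x. Re (f x)) \<in> V" "(\<lambda>x. Im (f x)) \<in> V" using f by (auto simp: cplx_space_def)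
  define a where "a n = inverse z ^ n * (TC ^^ n) f x" for n
  have "cmod (a n) \<le> K * NC f * (cmod (inverse z) * lam) ^ n" for n
  proof -
    have "cmod ((TC ^^ n) f x) \<le> \<bar>(T ^^ n) (\<lambda>x. Re (f x)) x\<bar> + \<bar>(T ^^ n) (\<lambda>x. Im (f x)) x\<bar>"
      unfolding TC_pow_eq using cmod_le[of "Complex _ _"] by simp
    also have "\<dots> \<le> K * lam ^ n * N (\<lambda>x. Re (f x)) + K * lam ^ n * N (\<lambda>x. Im (f x))"
      by (intro add_mono order_trans[OF N_ge T_pow] T_pow_V fV)
    also have "\<dots> = K * lam ^ n * NC f" by (simp add: cplx_norm_def algebra_simps)
    finally have "cmod (inverse z) ^ n * cmod ((TC ^^ n) f x) \<le> cmod (inverse z) ^ n * (K * lam ^ n * NC f)"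
      by (intro mult_left_mono) auto
    then show ?thesis by (simp add: a_def norm_mult norm_power power_mult_distrib mult_ac)
  qed
  moreover have "(\<lambda>n. K * NC f * (cmod (inverse z) * lam) ^ n) \<longlonglongrightarrow> 0"
    using ratio_less_1[OF z] lam_nonneg by (intro tendsto_mult_right_zero LIMSEQ_power_zero) simp
  ultimately have "a \<longlonglongrightarrow> 0" by (intro Lim_null_comparison[of a] always_eventually) auto
  from telescope_sums'[OF this] have "(\<lambda>n. a n - a (Suc n)) sums f x" by (simp add: a_def)
  moreover have "a n - a (Suc n) = res_term z (\<lambda>x. z * f x - TC f x) n x" for n
  proof -
    have "(TC ^^ n) (\<lambda>x. z * f x - TC f x) x = z * (TC ^^ n) f x - (TC ^^ n) (TC f) x"
      using fun_cong[OF TC_pow_lin[of n z f "-1" "TC f"], of x] by simp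
    then show ?thesis using z0 by (simp add: a_def res_term_def funpow_swap1 field_simps)
  qed
  ultimately show ?thesis unfolding resolvent_def by (simp add: sums_unique[symmetric])
qed

lemma resolvent_set_outside:
  assumes z: "lam < cmod z"
  shows "z \<in> op_resolvent_set V N T"
proof -
  have mem: "(\<lambda>x. z * f x - TC f x) \<in> VC" if "f \<in> VC" for f
    using VC_lin[OF that TC_VC[OF that], of z "-1"] by simp
  have "bij_betw (\<lambda>f x. z * f x - TC f x) VC VC"
    by (rule bij_betw_byWitness[where f' = "resolvent z"])
      (use mem resolvent_left[OF _ z] resolvent_right[OF _ z] resolvent_VC(1)[OF _ z] in \<open>auto simp: fun_eq_iff\<close>)
  moreover have "NC f \<le> 2 * (cmod (inverse z) * K / (1 - cmod (inverse z) * lam)) * NC (\<lambda>x. z * f x - TC f x)"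
    if f: "f \<in> VC" for f
  proof -
    have "resolvent z (\<lambda>x. z * f x - TC f x) = f" using resolvent_left[OF f z] by (rule ext)
    then show ?thesis using resolvent_VC(2)[OF mem[OF f] z] by simp
  qed
  ultimately show ?thesis unfolding op_resolvent_set_def by blast
qed

text \<open>A nonzero eigenfunction destroys the injectivity of \<open>lam - T\<close>, which puts
  \<open>lam\<close> into the spectrum, and \<open>resolvent_set_outside\<close> excludes larger
  moduli; so the supremum is an attained maximum.\<close>

lemma spectral_radius_eq:
  assumes v: "v \<in> V" "v x0 \<noteq> 0" "T v = (\<lambda>x. lam * v x)"
  shows "op_spectral_radius V N T = lam"
  unfolding op_spectral_radius_def
proof (rule cSup_eq_maximum)
  have T0: "T (\<lambda>x. 0) = (\<lambda>x. 0)" using T_lin[of 0 v 0 v] by simp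
  have V0: "(\<lambda>x. 0) \<in> V" using V_lin[OF v(1) v(1), of 0 0] by simp
  have "complex_of_real lam \<notin> op_resolvent_set V N T"
  proof
    assume "complex_of_real lam \<in> op_resolvent_set V N T"
    then have inj: "inj_on (\<lambda>f x. complex_of_real lam * f x - TC f x) VC"
      by (simp add: op_resolvent_set_def bij_betw_def)
    have mem: "(\<lambda>x. complex_of_real (v x)) \<in> VC" "(\<lambda>x. 0) \<in> VC"
      using v(1) V0 by (simp_all add: cplx_space_def)
    have "(\<lambda>x. complex_of_real lam * complex_of_real (v x) - TC (\<lambda>x. complex_of_real (v x)) x)
        = (\<lambda>x. complex_of_real lam * 0 - TC (\<lambda>x. 0) x)"
      by (simp add: cplx_op_def v(3) T0 fun_eq_iff complex_eq_iff)
    then have "(\<lambda>x. complex_of_real (v x)) = (\<lambda>x. 0)"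
      by (rule inj_onD[OF inj _ mem])
    then show False using v(2) by (auto dest: fun_cong[of _ _ x0])
  qed
  then show "lam \<in> cmod ` op_spectrum V N T"
    using lam_nonneg by (auto simp: op_spectrum_def image_iff intro!: bexI[of _ "complex_of_real lam"])
  show "y \<le> lam" if "y \<in> cmod ` op_spectrum V N T" for y
    using that resolvent_set_outside by (force simp: op_spectrum_def)
qed

end

section \<open>Uniqueness and the limit formula\<close>

context positive_transfer
begin

section \<open>Iterates of the operator as sums over words\<close>

lemma g_word_Cons: "g_word g (b # w) x = g b x * g_word g w (theta b x)"
  by (simp add: g_word_def prod.lessThan_Suc_shift del: prod.lessThan_Suc)

lemma words_Suc: "words B (Suc n) = (\<lambda>(b, w). b # w) ` (B \<times> words B n)"
  by (auto simp: words_def length_Suc_conv image_iff)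

lemma g_word_pos: "set w \<subseteq> B \<Longrightarrow> x \<in> {0..A} \<Longrightarrow> g_word g w x > 0"
proof (induction w arbitrary: x)
  case (Cons b w)
  then have "g b x > 0" "g_word g w (theta b x) > 0"
    using g_pos[of b x] theta_mem[of b x] by auto
  then show ?case by (simp add: g_word_Cons)
qed (simp add: g_word_def)

lemma g_word_powr_Cons:
  assumes "b \<in> B" "set w \<subseteq> B" "x \<in> {0..A}"
  shows "g_word g (b # w) x powr s = h b x * g_word g w (theta b x) powr s"
  using g_pos[OF assms(1,3)] g_word_pos[OF assms(2) theta_mem[OF assms(1,3)]]
  by (simp add: g_word_Cons h_def powr_mult)

lemma Cm_g_word: "set w \<subseteq> B \<Longrightarrow> Cm_on m A (\<lambda>x. g_word g w x powr s)"
proof (induction w)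
  case Nil
  then show ?case by (simp add: g_word_def Cm_on_const)
next
  case (Cons b w)
  then have "Cm_on m A (\<lambda>x. h b x * g_word g w (theta b x) powr s)"
    using Cm_branch[of b m "h b" "\<lambda>x. g_word g w x powr s"] Cm_h[of b] by simp
  then show ?case
    by (rule Cm_on_cong) (use Cons.prems g_word_powr_Cons[of b w] in auto)
qed

text \<open>The letter split off by \<open>words_Suc\<close> is the first to act on the point, so it
  corresponds to the outermost application of \<open>T\<close>.\<close>

lemma u_eq_sum_words: "x \<in> {0..A} \<Longrightarrow> u n x = (\<Sum>w\<in>words B n. g_word g w x powr s)"
proof (induction n arbitrary: x)
  case 0
  have "words B 0 = {[]}" by (auto simp: words_def)
  then show ?case using 0 by (simp add: u_0 g_word_def)
next
  case (Suc n)
  have "(\<Sum>w\<in>words B (Suc n). g_word g w x powr s)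
      = (\<Sum>(b, w)\<in>B \<times> words B n. g_word g (b # w) x powr s)"
    unfolding words_Suc by (subst sum.reindex) (auto simp: inj_on_def case_prod_unfold)
  also have "\<dots> = (\<Sum>b\<in>B. \<Sum>w\<in>words B n. g_word g (b # w) x powr s)"
    by (rule sum.cartesian_product[symmetric])
  also have "\<dots> = (\<Sum>b\<in>B. h b x * u n (theta b x))"
    using Suc.IH theta_mem Suc.prems
    by (intro sum.cong) (auto simp: sum_distrib_left g_word_powr_Cons words_def)
  also have "\<dots> = u (Suc n) x" using Suc.prems by (simp add: u_Suc T_apply)
  finally show ?case by simp
qed

lemma Dext_u_eq_sum_words:
  assumes "j \<le> m" "x \<in> {0..A}"
  shows "Dext A j (u n) x = (\<Sum>w\<in>words B n. Dext A j (\<lambda>y. g_word g w y powr s) x)"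
proof -
  have C: "Cm_on m A (\<lambda>y. g_word g w y powr s)" if "w \<in> words B n" for w
    using that by (intro Cm_g_word) (simp add: words_def)
  have "Dext A j (u n) x = Dext A j (\<lambda>y. \<Sum>w\<in>words B n. g_word g w y powr s) x"
    by (rule Dext_cong[OF A_pos Cm_on_sum[OF A_pos C] _ assms]) (simp_all add: u_eq_sum_words)
  also have "\<dots> = (\<Sum>w\<in>words B n. Dext A j (\<lambda>y. g_word g w y powr s) x)"
    by (rule Dext_sum[OF A_pos C assms])
  finally show ?thesis .
qed

section \<open>Uniqueness of the positive eigenfunction\<close>

lemma T_mono:
  assumes "\<And>x. x \<in> {0..A} \<Longrightarrow> f x \<le> k x" "x \<in> {0..A}"
  shows "T f x \<le> T k x"
  unfolding T_apply[OF assms(2)] using less_imp_le[OF h_pos[OF _ assms(2)]] theta_mem[OF _ assms(2)]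
  by (intro sum_mono mult_left_mono assms(1)) auto

text \<open>At a zero of \<open>f\<close> the sum \<open>T f\<close> has nonnegative terms with
  positive coefficients and total 0, so \<open>f\<close> vanishes at the image of that point under
  each branch; here one branch is followed.\<close>

lemma zero_propagates:
  assumes f: "\<And>x. x \<in> {0..A} \<Longrightarrow> 0 \<le> f x" and Tf: "\<And>x. x \<in> {0..A} \<Longrightarrow> T f x = lam * f x"
    and b: "b \<in> B" and x: "x \<in> {0..A}" and zero: "f x = 0"
  shows "(theta b ^^ n) x \<in> {0..A} \<and> f ((theta b ^^ n) x) = 0"
proof (induction n)
  case (Suc n)
  let ?y = "(theta b ^^ n) x"
  have y: "?y \<in> {0..A}" "f ?y = 0" using Suc by auto
  have "(\<Sum>b\<in>B. h b ?y * f (theta b ?y)) = 0"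
    using Tf[OF y(1)] y by (simp only: T_apply[OF y(1)] mult_zero_right)
  then have "h b ?y * f (theta b ?y) = 0"
    using b finite_B f[OF theta_mem[OF _ y(1)]] h_pos[OF _ y(1)]
    by (subst (asm) sum_nonneg_eq_0_iff) (auto intro: mult_nonneg_nonneg less_imp_le)
  then show ?case using h_pos[OF b y(1)] theta_mem[OF b y(1)] by simp
qed (use x zero in simp)

lemma di_theta_power:
  assumes "b \<in> B" "x \<in> {0..A}" "y \<in> {0..A}"
  shows "(theta b ^^ n) x \<in> {0..A} \<and> (theta b ^^ n) y \<in> {0..A} \<and>
    di ((theta b ^^ n) x) ((theta b ^^ n) y) \<le> \<kappa> ^ n * di x y"
proof (induction n)
  case (Suc n)
  then have "di ((theta b ^^ Suc n) x) ((theta b ^^ Suc n) y)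
      \<le> \<kappa> * di ((theta b ^^ n) x) ((theta b ^^ n) y)"
    using di_theta[OF assms(1)] by simp
  also have "\<dots> \<le> \<kappa> * (\<kappa> ^ n * di x y)" using Suc \<kappa>_pos by (intro mult_left_mono) auto
  finally show ?case using Suc theta_mem[OF assms(1)] by (simp add: mult.assoc)
qed (use assms in simp)

lemma theta_power_asymptotic:
  assumes "b \<in> B" "x \<in> {0..A}" "y \<in> {0..A}"
  shows "(\<lambda>n. dist ((theta b ^^ n) x) ((theta b ^^ n) y)) \<longlonglongrightarrow> 0"
proof (rule Lim_null_comparison)
  show "\<forall>\<^sub>F n in sequentially. norm (dist ((theta b ^^ n) x) ((theta b ^^ n) y)) \<le> (A + \<gamma>) * (\<kappa> ^ n * di x y)"
  proof (intro always_eventually allI)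
    fix n
    have "\<bar>(theta b ^^ n) x - (theta b ^^ n) y\<bar> \<le> (A + \<gamma>) * di ((theta b ^^ n) x) ((theta b ^^ n) y)"
      using di_theta_power[OF assms, of n] by (intro abs_diff_le_di) auto
    also have "\<dots> \<le> (A + \<gamma>) * (\<kappa> ^ n * di x y)"
      using di_theta_power[OF assms, of n] A_pos \<gamma>_pos by (intro mult_left_mono) auto
    finally show "norm (dist ((theta b ^^ n) x) ((theta b ^^ n) y)) \<le> (A + \<gamma>) * (\<kappa> ^ n * di x y)"
      by (simp add: dist_real_def)
  qed
  have "(\<lambda>n. \<kappa> ^ n) \<longlonglongrightarrow> 0" using \<kappa>_pos \<kappa>_less_1 by (intro LIMSEQ_power_zero) simp
  then show "(\<lambda>n. (A + \<gamma>) * (\<kappa> ^ n * di x y)) \<longlonglongrightarrow> 0"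
    by (intro tendsto_mult_right_zero tendsto_mult_left_zero)
qed

text \<open>Let \<open>\<phi> = w / v\<close>. Comparison at the extreme points of
  \<open>\<phi>\<close> forces the eigenvalues to agree. Then \<open>\<phi>\<close> takes its
  maximum along the whole orbit of \<open>x1\<close> under one branch and its minimum along that of
  \<open>x0\<close>. The orbits merge, so maximum and minimum coincide.\<close>

lemma eigenfunction_unique:
  assumes v: "v \<in> Cm_space m A" "\<And>x. x \<in> {0..A} \<Longrightarrow> v x > 0" "T v = (\<lambda>x. lam * v x)"
    and w: "w \<in> Cm_space m A" "\<And>x. x \<in> {0..A} \<Longrightarrow> w x > 0" "T w = (\<lambda>x. \<mu> * w x)"
  shows "\<exists>c>0. w = (\<lambda>x. c * v x)"
proof -
  define \<phi> where "\<phi> x = w x / v x" for x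
  have cont: "continuous_on {0..A} \<phi>"
    unfolding \<phi>_def using v(1,2) w(1)
    by (intro continuous_on_divide) (force simp: Cm_space_def dest: Cm_on_continuous)+
  have ne: "{0..A} \<noteq> {}" using A_pos by simp
  obtain x0 where x0: "x0 \<in> {0..A}" "\<And>x. x \<in> {0..A} \<Longrightarrow> \<phi> x0 \<le> \<phi> x"
    using continuous_attains_inf[OF compact_Icc ne cont] by blast
  obtain x1 where x1: "x1 \<in> {0..A}" "\<And>x. x \<in> {0..A} \<Longrightarrow> \<phi> x \<le> \<phi> x1"
    using continuous_attains_sup[OF compact_Icc ne cont] by blast
  have w_eq: "w x = \<phi> x * v x" if "x \<in> {0..A}" for x using v(2)[OF that] by (simp add: \<phi>_def)
  have lo: "\<phi> x0 * v x \<le> w x" and hi: "w x \<le> \<phi> x1 * v x" if "x \<in> {0..A}" for x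
    using x0(2)[OF that] x1(2)[OF that] v(2)[OF that] by (simp_all add: w_eq[OF that])
  have Tc: "T (\<lambda>x. c * v x) x = lam * (c * v x)" for c x
    using fun_cong[OF T_diff[of c v 0 v], of x] by (simp add: v(3))
  \<comment> \<open>At \<open>x1\<close> the bound \<open>w \<le> \<phi> x1 * v\<close> is an
    equality, so applying the monotone \<open>T\<close> to it compares \<open>\<mu> * w\<close> with
    \<open>lam * w\<close> there; \<open>x0\<close> gives the reverse inequality.\<close>
  have "\<mu> * w x1 \<le> lam * w x1"
    using T_mono[of w "\<lambda>x. \<phi> x1 * v x", OF hi x1(1)] by (simp add: Tc w(3) w_eq[OF x1(1)])
  then have "\<mu> \<le> lam" using w(2)[OF x1(1)] by simp
  moreover have "lam * w x0 \<le> \<mu> * w x0"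
    using T_mono[of "\<lambda>x. \<phi> x0 * v x" w, OF lo x0(1)] by (simp add: Tc w(3) w_eq[OF x0(1)])
  then have "lam \<le> \<mu>" using w(2)[OF x0(1)] by simp
  ultimately have \<mu>: "\<mu> = lam" by simp
  obtain b where b: "b \<in> B" using B_ne by blast
  \<comment> \<open>General coefficients, in order to cover both nonnegative functions
    \<open>\<phi> x1 * v - w\<close> and \<open>w - \<phi> x0 * v\<close>; the factors 1 and -1
    below follow this pattern.\<close>
  have Td: "T (\<lambda>x. c * v x - d * w x) x = lam * (c * v x - d * w x)" for c d x
    unfolding T_diff v(3) w(3) \<mu> by (simp add: algebra_simps)
  have z1: "(theta b ^^ n) x1 \<in> {0..A} \<and> \<phi> x1 * v ((theta b ^^ n) x1) - 1 * w ((theta b ^^ n) x1) = 0" for n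
    by (rule zero_propagates[OF _ Td b x1(1)]) (use hi w_eq[OF x1(1)] in auto)
  have z0: "(theta b ^^ n) x0 \<in> {0..A} \<and> - \<phi> x0 * v ((theta b ^^ n) x0) - - 1 * w ((theta b ^^ n) x0) = 0" for n
    by (rule zero_propagates[OF _ Td b x0(1)]) (use lo w_eq[OF x0(1)] in auto)
  have p1: "\<phi> ((theta b ^^ n) x1) = \<phi> x1" for n
    using z1[of n] v(2)[of "(theta b ^^ n) x1"] by (simp add: \<phi>_def field_simps)
  have p0: "\<phi> ((theta b ^^ n) x0) = \<phi> x0" for n
    using z0[of n] v(2)[of "(theta b ^^ n) x0"] by (simp add: \<phi>_def field_simps)
  \<comment> \<open>Uniform continuity is the right tool because the orbits are known to approach
    each other, not to converge.\<close>
  have "uniformly_continuous_on {0..A} \<phi>"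
    using cont by (rule compact_uniformly_continuous) simp
  from this[unfolded uniformly_continuous_on_sequentially, rule_format,
      of "\<lambda>n. (theta b ^^ n) x1" "\<lambda>n. (theta b ^^ n) x0"]
  have "(\<lambda>n. dist (\<phi> ((theta b ^^ n) x1)) (\<phi> ((theta b ^^ n) x0))) \<longlonglongrightarrow> 0"
    using z0 z1 theta_power_asymptotic[OF b x1(1) x0(1)] by simp
  then have eq: "\<phi> x1 = \<phi> x0" by (simp add: p0 p1 LIMSEQ_const_iff)
  have "w x = \<phi> x0 * v x" for x
  proof (cases "x \<in> {0..A}")
    case True
    then show ?thesis using lo[of x] hi[of x] eq by simp
  next
    case False
    then show ?thesis using v(1) w(1) by (simp add: Cm_space_def)
  qed
  moreover have "\<phi> x0 > 0" using v(2)[OF x0(1)] w(2)[OF x0(1)] by (simp add: \<phi>_def)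
  ultimately show ?thesis by auto
qed

section \<open>Completeness and linear structure of the function space\<close>

lemma Cm_space_series:
  assumes f: "\<And>n. f n \<in> Cm_space m A" and e: "\<And>n. Cm_norm m A (f n) \<le> e n" and se: "summable e"
    and F: "\<And>x. (\<lambda>n. f n x) sums F x"
  shows "F \<in> Cm_space m A \<and> Cm_norm m A F \<le> suminf e"
proof -
  have Cf: "Cm_on m A (f n)" for n using f by (simp add: Cm_space_def)
  have D: "\<bar>Dext A j (f n) x\<bar> \<le> e n" if "j \<le> m" "x \<in> {0..A}" for j n x
    using Dext_le_Cm_norm[OF A_pos Cf that, of n] e[of n] by linarith
  note ser = Cm_on_series[OF A_pos Cf D se F]
  have "F x = 0" if "x \<notin> {0..A}" for x
  proof -
    have "(\<lambda>n. f n x) = (\<lambda>n. 0)" using f that by (auto simp: Cm_space_def)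
    then show ?thesis using F[of x] by (simp add: sums_unique2[OF _ sums_zero])
  qed
  moreover have CF: "Cm_on m A F" by (rule ser(1))
  moreover have "Cm_norm m A F \<le> suminf e"
  proof (rule Cm_norm_le[OF A_pos CF])
    fix j x assume jx: "j \<le> m" "x \<in> {0..A}"
    have "norm (\<Sum>n. Dext A j (f n) x) \<le> suminf e"
      by (rule norm_suminf_le[OF _ se]) (use D[OF jx] in simp)
    then show "\<bar>Dext A j F x\<bar> \<le> suminf e" using sums_unique[OF ser(2)[OF _ _ jx]] by simp
  qed
  ultimately show ?thesis by (simp add: Cm_space_def)
qed

lemma Cm_space_lin:
  assumes "f \<in> Cm_space m A" "k \<in> Cm_space m A"
  shows "(\<lambda>x. c * f x + d * k x) \<in> Cm_space m A"
    and "Cm_norm m A (\<lambda>x. c * f x + d * k x) \<le> \<bar>c\<bar> * Cm_norm m A f + \<bar>d\<bar> * Cm_norm m A k"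
proof -
  have C: "Cm_on m A f" "Cm_on m A k" using assms by (auto simp: Cm_space_def)
  have Cl: "Cm_on m A (\<lambda>x. c * f x + d * k x)" by (intro Cm_on_add Cm_on_cmult C)
  then show "(\<lambda>x. c * f x + d * k x) \<in> Cm_space m A" using assms by (auto simp: Cm_space_def)
  show "Cm_norm m A (\<lambda>x. c * f x + d * k x) \<le> \<bar>c\<bar> * Cm_norm m A f + \<bar>d\<bar> * Cm_norm m A k"
  proof (rule Cm_norm_le[OF A_pos Cl])
    fix j x assume jx: "j \<le> m" "x \<in> {0..A}"
    have "Dext A j (\<lambda>x. c * f x + d * k x) x = c * Dext A j f x + d * Dext A j k x"
      by (simp only: Dext_add[OF A_pos Cm_on_cmult[OF C(1)] Cm_on_cmult[OF C(2)] jx]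
          Dext_cmult[OF A_pos C(1) jx] Dext_cmult[OF A_pos C(2) jx])
    then have "\<bar>Dext A j (\<lambda>x. c * f x + d * k x) x\<bar> \<le> \<bar>c\<bar> * \<bar>Dext A j f x\<bar> + \<bar>d\<bar> * \<bar>Dext A j k x\<bar>"
      by (simp add: abs_mult[symmetric])
    also have "\<dots> \<le> \<bar>c\<bar> * Cm_norm m A f + \<bar>d\<bar> * Cm_norm m A k"
      using Dext_le_Cm_norm[OF A_pos _ jx] C by (intro add_mono mult_left_mono) auto
    finally show "\<bar>Dext A j (\<lambda>x. c * f x + d * k x) x\<bar> \<le> \<bar>c\<bar> * Cm_norm m A f + \<bar>d\<bar> * Cm_norm m A k" .
  qed
qed

lemma Cm_space_T: "f \<in> Cm_space m A \<Longrightarrow> T f \<in> Cm_space m A"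
  using Cm_T[of f] by (simp add: Cm_space_def Lam_def)

lemma abs_le_Cm_norm:
  assumes "f \<in> Cm_space m A"
  shows "\<bar>f x\<bar> \<le> Cm_norm m A f"
proof -
  have C: "Cm_on m A f" using assms by (simp add: Cm_space_def)
  have in_I: "\<bar>f x\<bar> \<le> Cm_norm m A f" if "x \<in> {0..A}" for x
    using Dext_le_Cm_norm[OF A_pos C _ that, of 0] Cm_on_Dext(1)[OF A_pos C that] by simp
  show ?thesis
  proof (cases "x \<in> {0..A}")
    case False
    then have "f x = 0" using assms by (simp add: Cm_space_def)
    then show ?thesis using in_I[of 0] A_pos by simp
  qed (rule in_I)
qed

lemma T_sums:
  assumes "\<And>x. (\<lambda>n. f n x) sums F x"
  shows "(\<lambda>n. T (f n) x) sums T F x"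
proof (cases "x \<in> {0..A}")
  case True
  then show ?thesis by (simp only: T_apply) (intro sums_sum sums_mult assms)
next
  case False
  then have "T (f n) x = 0" "T F x = 0" for n by (simp_all add: Lam_def del: atLeastAtMost_iff)
  then show ?thesis by simp
qed

lemma eigenfunction_limit:
  fixes r defines "r \<equiv> op_spectral_radius (Cm_space m A) (Cm_norm m A) T"
  shows "T ` Cm_space m A \<subseteq> Cm_space m A \<and> r > 0 \<and>
    (\<exists>v\<in>Cm_space m A.
       (\<forall>x\<in>{0..A}. v x > 0) \<and> T v = (\<lambda>x. r * v x) \<and>
       (\<forall>w\<in>Cm_space m A. \<forall>\<mu>. (\<forall>x\<in>{0..A}. w x > 0) \<and> T w = (\<lambda>x. \<mu> * w x) \<longrightarrow>
          (\<exists>c>0. w = (\<lambda>x. c * v x))) \<and>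
       (\<forall>j\<in>{1..m}. \<forall>x\<in>{0..A}.
          (\<lambda>n. (\<Sum>\<omega>\<in>words B n. Dext A j (\<lambda>y. g_word g \<omega> y powr s) x) /
               (\<Sum>\<omega>\<in>words B n. g_word g \<omega> x powr s))
          \<longlonglongrightarrow> Dext A j v x / v x))"
proof -
  obtain lam v K where "lam > 0 \<and> v \<in> Cm_space m A \<and> (\<forall>x\<in>{0..A}. v x > 0) \<and> T v = (\<lambda>x. lam * v x) \<and>
    (\<forall>f n. Cm_on m A f \<longrightarrow> Cm_norm m A ((T ^^ n) f) \<le> K * lam ^ n * Cm_norm m A f) \<and>
    (\<forall>j\<le>m. \<forall>x\<in>{0..A}. (\<lambda>n. Dext A j (u n) x / lam ^ n) \<longlonglongrightarrow> Dext A j v x)"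
    using eigenfunction_exists by (elim exE)
  then have lam: "lam > 0" and v: "v \<in> Cm_space m A" "\<And>x. x \<in> {0..A} \<Longrightarrow> v x > 0" "T v = (\<lambda>x. lam * v x)"
    and K: "\<And>f n. Cm_on m A f \<Longrightarrow> Cm_norm m A ((T ^^ n) f) \<le> K * lam ^ n * Cm_norm m A f"
    and lim: "\<And>j x. j \<le> m \<Longrightarrow> x \<in> {0..A} \<Longrightarrow> (\<lambda>n. Dext A j (u n) x / lam ^ n) \<longlonglongrightarrow> Dext A j v x"
    by auto
  interpret bounded_on_function_space "Cm_space m A" "Cm_norm m A" T K lam
  proof
    show "T (\<lambda>x. c * f x + d * k x) = (\<lambda>x. c * T f x + d * T k x)" for f k c d
      using T_diff[of c f "- d" k] by simp
    show "Cm_norm m A ((T ^^ n) f) \<le> K * lam ^ n * Cm_norm m A f" if "f \<in> Cm_space m A" for f n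
      using that by (intro K) (simp add: Cm_space_def)
    show "F \<in> Cm_space m A \<and> Cm_norm m A F \<le> suminf e"
      if "\<And>n. f n \<in> Cm_space m A" "\<And>n. Cm_norm m A (f n) \<le> e n" "summable e"
        "\<And>x. (\<lambda>n. f n x) sums F x" for f e F
      using that by (rule Cm_space_series)
    show "(\<lambda>n. T (f n) x) sums T F x" if "\<And>x. (\<lambda>n. f n x) sums F x" for f F x
      using that by (rule T_sums)
  qed (use lam in \<open>auto intro: Cm_space_lin abs_le_Cm_norm Cm_space_T\<close>)
  have "v 0 \<noteq> 0" using v(2)[of 0] A_pos by simp
  then have r: "r = lam" unfolding r_def by (rule spectral_radius_eq[OF v(1) _ v(3)])
  have Cv: "Cm_on m A v" using v(1) by (simp add: Cm_space_def)
  have "(\<lambda>n. (\<Sum>\<omega>\<in>words B n. Dext A j (\<lambda>y. g_word g \<omega> y powr s) x) /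
      (\<Sum>\<omega>\<in>words B n. g_word g \<omega> x powr s)) \<longlonglongrightarrow> Dext A j v x / v x"
    if j: "j \<le> m" and x: "x \<in> {0..A}" for j x
  proof -
    have "(\<lambda>n. u n x / lam ^ n) \<longlonglongrightarrow> v x"
      using lim[of 0 x] x Cm_on_Dext(1)[OF A_pos Cm_u x] Cm_on_Dext(1)[OF A_pos Cv x] by simp
    \<comment> \<open>Scaled by \<open>lam ^ n\<close>, numerator and denominator converge
      separately, the latter to \<open>v x > 0\<close>; the scaling cancels in the quotient.\<close>
    then have "(\<lambda>n. (Dext A j (u n) x / lam ^ n) / (u n x / lam ^ n)) \<longlonglongrightarrow> Dext A j v x / v x"
      using v(2)[OF x] by (intro tendsto_divide lim j x) auto
    then show ?thesis
      using lam by (simp add: u_eq_sum_words[OF x, symmetric] Dext_u_eq_sum_words[OF j x, symmetric])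
  qed
  then show ?thesis
    using lam v r Cm_space_T eigenfunction_unique[OF v]
    by (intro conjI bexI[of _ v]) auto
qed

end

theorem theorem6p3:
  fixes B :: "real set" and \<gamma> A s :: real and m :: nat
    and g :: "real \<Rightarrow> real \<Rightarrow> real"
  assumes "finite B" and "B \<noteq> {}"
    and "\<gamma> > 0" and "\<And>b. b \<in> B \<Longrightarrow> b \<ge> \<gamma>"
    and "A \<ge> inverse \<gamma>"
    and "m \<ge> 1"
    and "\<And>b. b \<in> B \<Longrightarrow> Cm_on m A (g b)"
    and "\<And>b x. b \<in> B \<Longrightarrow> x \<in> {0..A} \<Longrightarrow> g b x > 0"
    and "s > 0"
  defines "X \<equiv> Cm_space m A"
    and "\<Lambda> \<equiv> Lam B g A s"
    and "r \<equiv> op_spectral_radius (Cm_space m A) (Cm_norm m A) (Lam B g A s)"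
  shows "\<Lambda> ` X \<subseteq> X \<and> r > 0 \<and>
    (\<exists>v\<in>X.
       (\<forall>x\<in>{0..A}. v x > 0) \<and> \<Lambda> v = (\<lambda>x. r * v x) \<and>
       (\<forall>w\<in>X. \<forall>\<mu>. (\<forall>x\<in>{0..A}. w x > 0) \<and> \<Lambda> w = (\<lambda>x. \<mu> * w x) \<longrightarrow>
          (\<exists>c>0. w = (\<lambda>x. c * v x))) \<and>
       (\<forall>j\<in>{1..m}. \<forall>x\<in>{0..A}.
          (\<lambda>n. (\<Sum>\<omega>\<in>words B n. Dext A j (\<lambda>y. g_word g \<omega> y powr s) x) /
               (\<Sum>\<omega>\<in>words B n. g_word g \<omega> x powr s))
          \<longlonglongrightarrow> Dext A j v x / v x))"
proof -
  interpret positive_transfer B \<gamma> A s m g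
    using assms(1-8) by unfold_locales auto
  show ?thesis unfolding X_def \<Lambda>_def r_def by (rule eigenfunction_limit)
qed

end
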